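(* There exists a graph on four vertices such that it is not possible on a radical computation tree to construct the coordinates of every possible Kamada and Kawai equilibrium of the graph.
   Context: Points of the plane are identified with complex numbers. An algebraic computation tree is a rooted tree whose computation nodes compute a value as the sum, difference, product or quotient of integer constants and values computed at ancestor nodes, and whose decision nodes test whether a previously computed value is greater than zero and branch accordingly. A radical computation tree additionally allows computing the $k$-th root of a previously computed value ($k$ an integer parameter) and complex conjugation. Kamada--Kawai model (constants $L=K=1$): for a connected graph with vertex positions $p_i$, the energy is $E=\sum_i\sum_{j>i}\frac12 k_{ij}(|p_i-p_j|-\ell_{ij})^2$ where $d_{ij}$ is the graph-theoretic distance between $v_i$ and $v_j$, $\ell_{ij}=d_{ij}$ and $k_{ij}=1/d_{ij}^2$; a Kamada and Kawai equilibrium is a drawing at which $E$ is at a local minimum. *)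

theory Defs
  imports Complex_Main
begin

section \<open>Graphs on vertex set {0..<n}\<close>

text \<open>A finite simple graph on the vertices 0,...,n-1, given by a symmetric,
irreflexive adjacency relation (only pairs of vertices below n are relevant).\<close>

definition simple_graph :: "nat \<Rightarrow> (nat \<Rightarrow> nat \<Rightarrow> bool) \<Rightarrow> bool" where
  "simple_graph n G \<longleftrightarrow> (\<forall>i<n. \<forall>j<n. G i j \<longleftrightarrow> G j i) \<and> (\<forall>i<n. \<not> G i i)"

definition edge_rel :: "nat \<Rightarrow> (nat \<Rightarrow> nat \<Rightarrow> bool) \<Rightarrow> (nat \<times> nat) set" where
  "edge_rel n G = {(i, j). i < n \<and> j < n \<and> G i j}"

definition graph_connected :: "nat \<Rightarrow> (nat \<Rightarrow> nat \<Rightarrow> bool) \<Rightarrow> bool" where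
  "graph_connected n G \<longleftrightarrow> (\<forall>i<n. \<forall>j<n. (i, j) \<in> (edge_rel n G)\<^sup>*)"

text \<open>Graph-theoretic distance: length of a shortest walk.\<close>
definition graph_dist :: "nat \<Rightarrow> (nat \<Rightarrow> nat \<Rightarrow> bool) \<Rightarrow> nat \<Rightarrow> nat \<Rightarrow> nat" where
  "graph_dist n G i j = (LEAST m. (i, j) \<in> (edge_rel n G) ^^ m)"

section \<open>Kamada--Kawai energy and equilibria (L = K = 1)\<close>

text \<open>Drawings: vertex i is placed at the complex number p i.\<close>
definition kk_energy :: "nat \<Rightarrow> (nat \<Rightarrow> nat \<Rightarrow> bool) \<Rightarrow> (nat \<Rightarrow> complex) \<Rightarrow> real" where
  "kk_energy n G p =
     (\<Sum>i<n. \<Sum>j\<in>{i<..<n}.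
        let d = real (graph_dist n G i j) in
        1/2 * (1 / d\<^sup>2) * (cmod (p i - p j) - d)\<^sup>2)"

definition kk_equilibrium :: "nat \<Rightarrow> (nat \<Rightarrow> nat \<Rightarrow> bool) \<Rightarrow> (nat \<Rightarrow> complex) \<Rightarrow> bool" where
  "kk_equilibrium n G p \<longleftrightarrow>
     (\<exists>e>0. \<forall>q. (\<forall>i<n. cmod (q i - p i) < e) \<longrightarrow> kk_energy n G p \<le> kk_energy n G q)"

section \<open>Values constructible on a radical computation tree\<close>

text \<open>A radical computation tree for a fixed graph has no input, so every
decision node has a determined outcome and the values computable along the
(unique) executed path are exactly those obtained from integer constants by
finitely many sums, differences, products, quotients, k-th roots (any root
of a previously computed value) and complex conjugations.\<close>

inductive_set radical_computable :: "complex set" where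
  const: "of_int c \<in> radical_computable"
| add: "x \<in> radical_computable \<Longrightarrow> y \<in> radical_computable \<Longrightarrow> x + y \<in> radical_computable"
| diff: "x \<in> radical_computable \<Longrightarrow> y \<in> radical_computable \<Longrightarrow> x - y \<in> radical_computable"
| mult: "x \<in> radical_computable \<Longrightarrow> y \<in> radical_computable \<Longrightarrow> x * y \<in> radical_computable"
| divide: "x \<in> radical_computable \<Longrightarrow> y \<in> radical_computable \<Longrightarrow> y \<noteq> 0 \<Longrightarrow> x / y \<in> radical_computable"
| root: "x \<in> radical_computable \<Longrightarrow> k > 0 \<Longrightarrow> w ^ k = x \<Longrightarrow> w \<in> radical_computable"
| conj: "x \<in> radical_computable \<Longrightarrow> cnj x \<in> radical_computable"

text \<open>A drawing q of an n-vertex graph is constructible if all its vertex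
coordinates are computable.\<close>
definition drawing_constructible :: "nat \<Rightarrow> (nat \<Rightarrow> complex) \<Rightarrow> bool" where
  "drawing_constructible n q \<longleftrightarrow> (\<forall>i<n. q i \<in> radical_computable)"

text \<open>Congruence (rigid motion incl. reflection) of the plane:
z \<mapsto> a z + b or z \<mapsto> a (cnj z) + b with |a| = 1.\<close>
definition congruent_drawing :: "nat \<Rightarrow> (nat \<Rightarrow> complex) \<Rightarrow> (nat \<Rightarrow> complex) \<Rightarrow> bool" where
  "congruent_drawing n p q \<longleftrightarrow> (\<exists>a b. cmod a = 1 \<and>
     ((\<forall>i<n. q i = a * p i + b) \<or> (\<forall>i<n. q i = a * cnj (p i) + b)))"

end

theory Submission
  imports Defs "HOL-Analysis.Analysis" "HOL-Computational_Algebra.Fundamental_Theorem_Algebra"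
begin

text \<open>
  The graph is the paw: a triangle \<open>0, 1, 2\<close> with a pendant vertex \<open>3\<close> attached to \<open>0\<close>.

  Equilibrium. By AM-GM, each spring energy is bounded below by a quadratic function of the length, with
  equality at the actual length. Hence a drawing whose equilibrium stress has a positive semidefinite
  matrix is a global minimum. We look for a drawing, symmetric in \<open>1\<close> and \<open>2\<close>, with stress matrix of
  rank one, \<open>w \<lambda> \<lambda>\<^sup>T\<close> with \<open>\<lambda> = (- (t + 2), 1, 1, t)\<close>; the lengths are then rational functions of
  \<open>t\<close> and \<open>w\<close>, and realisability in the plane amounts to two equations in \<open>t\<close> and \<open>w\<close>, which have a
  solution by Brouwer's theorem. Eliminating \<open>w\<close> shows that \<open>t\<close>, which is computable from the lengths,
  is a root of an integer polynomial \<open>F\<close> of degree 14.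

  Roots of \<open>F\<close> are not radical. Every radical number is fixed by all \<open>n\<close>-fold commutators of
  automorphisms of the field of algebraic numbers, for some \<open>n\<close>. So if a root of \<open>F\<close> were radical, the
  Galois group of \<open>F\<close> would have a nontrivial abelian normal subgroup. But the group is primitive
  on the 14 roots, and 14 is not a prime power. Primitivity comes from the Frobenius map modulo 67, where
  \<open>F\<close> splits into a linear factor and an irreducible factor of degree 13: the coefficients of the
  polynomial of a block of at most 7 roots have at most 7 conjugates each, so they are fixed by the
  \<open>7!\<close>-th power of Frobenius, which is coprime to 13, and the block is invariant under Frobenius.
\<close>

section \<open>Automorphisms of the algebraic closure of the rationals\<close>

text \<open>Positions alone carry no invariant information, so the parameter \<open>t\<close> is
  recovered from the mutual distances, which every congruent copy of the drawing shares. Certifying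
  a global minimum through the stress replaces a second-order test for a local one. All Galois
  theory takes place in the single group \<open>Gal\<close> acting on the algebraic numbers; the
  Galois group of \<open>F\<close> is seen only through its action on the 14 roots. Frobenius, in
  contrast, lives only on residues. The bridge between the two is that a finite
  \<open>Gal\<close>-stable set of integral elements is the root set of a rational polynomial, so
  that its reduction is stable under the \<open>p\<close>-th power map. Applied to orbits of roots
  this gives transitivity, once rational roots are excluded; applied to conjugates of coefficients
  it controls blocks. A prime with residue degrees 1 and 13 is suitable because one of two orbits,
  and the number of translates of a proper block as well as its size, is at most 7, while 13 is
  coprime to 7!.\<close>

text \<open>Graphs of isomorphisms between subfields of the complex numbers.\<close>

definition part_iso :: "(complex \<times> complex) set \<Rightarrow> bool" where
  "part_iso S \<longleftrightarrow> (1, 1) \<in> S \<and>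
     (\<forall>x y x' y'. (x, x') \<in> S \<longrightarrow> (y, y') \<in> S \<longrightarrow> (x - y, x' - y') \<in> S \<and> (x * y, x' * y') \<in> S) \<and>
     (\<forall>x x'. (x, x') \<in> S \<longrightarrow> (inverse x, inverse x') \<in> S \<and> (x = 0 \<longleftrightarrow> x' = 0))"

text \<open>Relates a polynomial to its image under the isomorphism, coefficient by coefficient, so
  that no map on the field has to be chosen.\<close>

definition pol_rel :: "(complex \<times> complex) set \<Rightarrow> complex poly \<Rightarrow> complex poly \<Rightarrow> bool" where
  "pol_rel S g g' \<longleftrightarrow> (\<forall>i. (coeff g i, coeff g' i) \<in> S)"

context
  fixes S :: "(complex \<times> complex) set"
  assumes S: "part_iso S"
begin

lemma part_iso_one: "(1, 1) \<in> S"
  and part_iso_diff: "(x, x') \<in> S \<Longrightarrow> (y, y') \<in> S \<Longrightarrow> (x - y, x' - y') \<in> S"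
  and part_iso_mult: "(x, x') \<in> S \<Longrightarrow> (y, y') \<in> S \<Longrightarrow> (x * y, x' * y') \<in> S"
  and part_iso_inverse: "(x, x') \<in> S \<Longrightarrow> (inverse x, inverse x') \<in> S"
  and part_iso_zero_iff: "(x, x') \<in> S \<Longrightarrow> x = 0 \<longleftrightarrow> x' = 0"
  using S unfolding part_iso_def by blast+

lemma part_iso_zero: "(0, 0) \<in> S"
  using part_iso_diff[OF part_iso_one part_iso_one] by simp

lemma part_iso_uminus: "(x, x') \<in> S \<Longrightarrow> (- x, - x') \<in> S"
  using part_iso_diff[OF part_iso_zero] by fastforce

lemma part_iso_add: "(x, x') \<in> S \<Longrightarrow> (y, y') \<in> S \<Longrightarrow> (x + y, x' + y') \<in> S"
  using part_iso_diff[OF _ part_iso_uminus, of x x' y y'] by simp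

text \<open>The condition on zero, applied to a difference, makes the relation single-valued and
  injective at once.\<close>

lemma part_iso_unique: "(x, x') \<in> S \<Longrightarrow> (y, y') \<in> S \<Longrightarrow> x = y \<longleftrightarrow> x' = y'"
  using part_iso_zero_iff[OF part_iso_diff, of x x' y y'] by simp

lemma part_iso_sum: "(\<And>i. i \<in> I \<Longrightarrow> (f i, f' i) \<in> S) \<Longrightarrow> (sum f I, sum f' I) \<in> S"
  by (induction I rule: infinite_finite_induct) (auto intro: part_iso_zero part_iso_add)

lemma pol_rel_0: "pol_rel S 0 0"
  by (simp add: pol_rel_def part_iso_zero)

lemma pol_rel_diff: "pol_rel S f f' \<Longrightarrow> pol_rel S g g' \<Longrightarrow> pol_rel S (f - g) (f' - g')"
  by (simp add: pol_rel_def part_iso_diff)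

lemma pol_rel_add: "pol_rel S f f' \<Longrightarrow> pol_rel S g g' \<Longrightarrow> pol_rel S (f + g) (f' + g')"
  by (simp add: pol_rel_def part_iso_add)

lemma pol_rel_uminus: "pol_rel S f f' \<Longrightarrow> pol_rel S (- f) (- f')"
  by (simp add: pol_rel_def part_iso_uminus)

lemma pol_rel_mult: "pol_rel S f f' \<Longrightarrow> pol_rel S g g' \<Longrightarrow> pol_rel S (f * g) (f' * g')"
  by (auto simp: pol_rel_def coeff_mult intro!: part_iso_sum part_iso_mult)

lemma pol_rel_pCons: "(c, c') \<in> S \<Longrightarrow> pol_rel S g g' \<Longrightarrow> pol_rel S (pCons c g) (pCons c' g')"
  by (auto simp: pol_rel_def coeff_pCons split: nat.splits)

lemma pol_rel_monom: "(c, c') \<in> S \<Longrightarrow> pol_rel S (monom c n) (monom c' n)"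
  by (auto simp: pol_rel_def part_iso_zero)

lemma pol_rel_prod: "(\<And>i. i \<in> I \<Longrightarrow> pol_rel S (f i) (f' i)) \<Longrightarrow> pol_rel S (prod f I) (prod f' I)"
proof (induction I rule: infinite_finite_induct)
  case (insert x F)
  then show ?case by (simp add: pol_rel_mult)
qed (auto simp: one_pCons intro!: pol_rel_pCons part_iso_one pol_rel_0)

lemma pol_rel_coeff_zero_iff: "pol_rel S g g' \<Longrightarrow> coeff g i = 0 \<longleftrightarrow> coeff g' i = 0"
  using part_iso_zero_iff unfolding pol_rel_def by blast

lemma pol_rel_zero_iff: "pol_rel S g g' \<Longrightarrow> g = 0 \<longleftrightarrow> g' = 0"
  using pol_rel_coeff_zero_iff by (auto simp: poly_eq_iff)

lemma pol_rel_degree: "pol_rel S g g' \<Longrightarrow> degree g = degree g'"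
  using pol_rel_coeff_zero_iff unfolding degree_def by presburger

text \<open>Long division run in parallel on both sides. The disjunct \<open>r = 0\<close> covers a
  constant \<open>m\<close>, since \<open>degree 0 = 0\<close>.\<close>

lemma pol_rel_division:
  assumes "pol_rel S m m'" "m \<noteq> 0" "pol_rel S g g'"
  shows "\<exists>q q' r r'. pol_rel S q q' \<and> pol_rel S r r' \<and> g = m * q + r \<and> g' = m' * q' + r' \<and>
           (r = 0 \<or> degree r < degree m)"
  using assms(3)
proof (induction "degree g" arbitrary: g g' rule: less_induct)
  case less
  show ?case
  proof (cases "g = 0 \<or> degree g < degree m")
    case True
    then show ?thesis
      using pol_rel_0 less.prems by (intro exI[of _ 0] exI[of _ g] exI[of _ g']) auto
  next
    case False
    define c where "c = lead_coeff g * inverse (lead_coeff m)"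
    define c' where "c' = lead_coeff g' * inverse (lead_coeff m')"
    define k where "k = degree g - degree m"
    have "(c, c') \<in> S"
      unfolding c_def c'_def
      using assms(1) less.prems pol_rel_degree[OF assms(1)] pol_rel_degree[OF less.prems]
      by (auto simp: pol_rel_def intro!: part_iso_mult part_iso_inverse)
    then have mc: "pol_rel S (monom c k) (monom c' k)" by (rule pol_rel_monom)
    define g1 where "g1 = g - m * monom c k"
    define g1' where "g1' = g' - m' * monom c' k"
    have g1: "pol_rel S g1 g1'"
      unfolding g1_def g1'_def using pol_rel_diff pol_rel_mult less.prems mc assms(1) by blast
    have "c \<noteq> 0" using False assms(2) by (simp add: c_def)
    then have deg: "degree (m * monom c k) = degree g"
      using False assms(2) by (simp add: degree_mult_eq degree_monom_eq k_def monom_eq_0_iff)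
    have "lead_coeff (m * monom c k) = lead_coeff g"
      using assms(2) \<open>c \<noteq> 0\<close> by (subst lead_coeff_mult) (simp add: c_def degree_monom_eq)
    then have "coeff g1 (degree g) = 0" unfolding g1_def using deg by simp
    moreover have "degree g1 \<le> degree g" unfolding g1_def using deg by (simp add: degree_diff_le)
    ultimately have "g1 = 0 \<or> degree g1 < degree g"
      by (metis le_neq_implies_less leading_coeff_0_iff)
    then have "\<exists>q q' r r'. pol_rel S q q' \<and> pol_rel S r r' \<and> g1 = m * q + r \<and> g1' = m' * q' + r' \<and>
           (r = 0 \<or> degree r < degree m)"
    proof
      assume "g1 = 0"
      moreover from this have "g1' = 0" using pol_rel_zero_iff[OF g1] by simp
      ultimately show ?thesis
        using pol_rel_0 by (intro exI[of _ 0]) auto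
    next
      assume "degree g1 < degree g"
      then show ?thesis using less.hyps g1 by blast
    qed
    then obtain q q' r r' where *: "pol_rel S q q'" "pol_rel S r r'" "g1 = m * q + r" "g1' = m' * q' + r'"
      "r = 0 \<or> degree r < degree m" by blast
    have "g = m * (q + monom c k) + r" "g' = m' * (q' + monom c' k) + r'"
      using *(3,4) unfolding g1_def g1'_def by (simp_all add: algebra_simps)
    then show ?thesis using * pol_rel_add[OF *(1) mc] by blast
  qed
qed

text \<open>Simple extension by a root: \<open>m\<close> is a minimal polynomial of
  \<open>x\<close>, and the value \<open>g(x)\<close> is sent to \<open>g'(y)\<close>. Relations at
  \<open>x\<close> carry over to \<open>y\<close> by \<open>lr\<close>; that nonzero values stay
  nonzero follows because inverses are again polynomial values.\<close>

lemma part_iso_extend: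
  assumes m: "pol_rel S m m'" "m \<noteq> 0" "poly m x = 0"
    and minimal: "\<And>g g'. pol_rel S g g' \<Longrightarrow> g \<noteq> 0 \<Longrightarrow> poly g x = 0 \<Longrightarrow> degree m \<le> degree g"
    and y: "poly m' y = 0"
  defines "S' \<equiv> {(poly g x, poly g' y) | g g'. pol_rel S g g'}"
  shows "part_iso S'" "S \<subseteq> S'" "(x, y) \<in> S'"
proof -
  have const: "pol_rel S [:c:] [:c':]" if "(c, c') \<in> S" for c c'
    using that pol_rel_pCons pol_rel_0 by blast
  have lr: "poly g' y = 0" if gg: "pol_rel S g g'" "poly g x = 0" for g g'
  proof -
    obtain q q' r r' where *: "pol_rel S q q'" "pol_rel S r r'" "g = m * q + r" "g' = m' * q' + r'"
      "r = 0 \<or> degree r < degree m" using pol_rel_division[OF m(1,2) gg(1)] by blast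
    have "poly r x = 0" using * gg(2) m(3) by simp
    then have "r = 0" using minimal *(2,5) by force
    then have "r' = 0" using pol_rel_zero_iff *(2) by blast
    then show ?thesis using *(4) y by simp
  qed
  \<comment> \<open>Euclid's algorithm by induction on the degree: reduce \<open>g\<close> modulo
    \<open>m\<close>, or, if \<open>g\<close> is already smaller, divide \<open>m\<close> by
    \<open>g\<close>. In the latter case \<open>r(x) = - g(x) q(x)\<close>, so an inverse of
    \<open>r(x)\<close> yields one of \<open>g(x)\<close>.\<close>
  have inv: "\<exists>h h'. pol_rel S h h' \<and> poly h x * poly g x = 1" if "pol_rel S g g'" "poly g x \<noteq> 0" for g g'
    using that
  proof (induction "degree g" arbitrary: g g' rule: less_induct)
    case less
    consider "degree m \<le> degree g" | "degree g < degree m" "degree g = 0"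
      | "degree g < degree m" "degree g \<noteq> 0" by linarith
    then show ?case
    proof cases
      case 1
      obtain q q' r r' where *: "pol_rel S q q'" "pol_rel S r r'" "g = m * q + r" "g' = m' * q' + r'"
        "r = 0 \<or> degree r < degree m" using pol_rel_division[OF m(1,2) less.prems(1)] by blast
      have "poly r x = poly g x" using * m(3) by simp
      then show ?thesis using less.hyps[of r r'] * less.prems 1 by (metis le_trans not_le poly_0)
    next
      case 2
      then obtain c where c: "g = [:c:]" using degree_eq_zeroE by blast
      then have "(c, coeff g' 0) \<in> S" using less.prems(1) by (metis coeff_pCons_0 pol_rel_def)
      then have "pol_rel S [:inverse c:] [:inverse (coeff g' 0):]"
        using const part_iso_inverse by blast
      then show ?thesis using c less.prems(2) by (intro exI conjI) auto
    next
      case 3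
      have g0: "g \<noteq> 0" using less.prems by auto
      obtain q q' r r' where *: "pol_rel S q q'" "pol_rel S r r'" "m = g * q + r" "m' = g' * q' + r'"
        "r = 0 \<or> degree r < degree g" using pol_rel_division[OF less.prems(1) g0 m(1)] by blast
      have "poly r x \<noteq> 0"
      proof
        assume "poly r x = 0"
        then have "r = 0" using minimal *(2,5) 3 by force
        then have mq: "m = g * q" using *(3) by simp
        then have "poly q x = 0" "q \<noteq> 0" using m less.prems by auto
        then have "degree m \<le> degree q" using minimal *(1) by blast
        moreover have "degree m = degree g + degree q"
          using mq m(2) degree_mult_eq by auto
        ultimately show False using 3 by simp
      qed
      then obtain h h' where h: "pol_rel S h h'" "poly h x * poly r x = 1"
        using less.hyps[of r r'] * by fastforce
      have "poly r x = - (poly g x * poly q x)" using *(3) m(3) by (simp add: add_eq_0_iff)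
      then have "poly (- (q * h)) x * poly g x = 1" using h(2) by (simp add: algebra_simps)
      then show ?thesis using pol_rel_uminus[OF pol_rel_mult[OF *(1) h(1)]] by blast
    qed
  qed
  have inv': "\<exists>h h'. pol_rel S h h' \<and> poly h x * poly g x = 1 \<and> poly h' y * poly g' y = 1"
    if "pol_rel S g g'" "poly g x \<noteq> 0" for g g'
  proof -
    from inv[OF that] obtain h h' where h: "pol_rel S h h'" "poly h x * poly g x = 1" by blast
    \<comment> \<open>The polynomial \<open>h g - 1\<close> vanishes at \<open>x\<close>, so its
      image vanishes at \<open>y\<close>.\<close>
    have "pol_rel S (h * g - [:1:]) (h' * g' - [:1:])"
      using pol_rel_diff pol_rel_mult h(1) that(1) const part_iso_one by blast
    from lr[OF this] h(2) have "poly h' y * poly g' y = 1" by simp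
    with h show ?thesis by blast
  qed
  have mem: "(poly g x, poly g' y) \<in> S'" if "pol_rel S g g'" for g g'
    unfolding S'_def using that by blast
  show "part_iso S'"
    unfolding part_iso_def
  proof (intro conjI allI impI)
    have "(poly [:1:] x, poly [:1:] y) \<in> S'"
      unfolding S'_def using const part_iso_one by blast
    then show "(1, 1) \<in> S'" by simp
  next
    fix a a' b b' assume "(a, a') \<in> S'" "(b, b') \<in> S'"
    then obtain g g' h h' where *: "a = poly g x" "a' = poly g' y" "pol_rel S g g'"
       "b = poly h x" "b' = poly h' y" "pol_rel S h h'" unfolding S'_def by blast
    show "(a - b, a' - b') \<in> S'"
      using mem[OF pol_rel_diff[OF *(3,6)]] *(1,2,4,5) by simp
    show "(a * b, a' * b') \<in> S'"
      using mem[OF pol_rel_mult[OF *(3,6)]] *(1,2,4,5) by simp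
  next
    fix a a' assume "(a, a') \<in> S'"
    then obtain g g' where *: "a = poly g x" "a' = poly g' y" "pol_rel S g g'" unfolding S'_def by blast
    show iff: "a = 0 \<longleftrightarrow> a' = 0"
      using lr[OF *(3)] inv'[OF *(3)] * by force
    show "(inverse a, inverse a') \<in> S'"
    proof (cases "a = 0")
      case True
      then show ?thesis using iff \<open>(a, a') \<in> S'\<close> by simp
    next
      case False
      then obtain h h' where h: "pol_rel S h h'" "poly h x * a = 1" "poly h' y * a' = 1"
        using inv'[OF *(3)] * by auto
      then have "poly h x = inverse a" "poly h' y = inverse a'"
        by (metis inverse_unique mult.commute)+
      then show ?thesis using mem[OF h(1)] by simp
    qed
  qed
  show "S \<subseteq> S'"
  proof
    fix z assume "z \<in> S"
    then obtain c c' where z: "z = (c, c')" "(c, c') \<in> S" by (cases z) auto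
    have "(poly [:c:] x, poly [:c':] y) \<in> S'" unfolding S'_def using const z(2) by blast
    then show "z \<in> S'" using z by simp
  qed
  have "pol_rel S [:0, 1:] [:0, 1:]"
    by (intro pol_rel_pCons pol_rel_0 part_iso_one part_iso_zero)
  then have "(poly [:0, 1:] x, poly [:0, 1:] y) \<in> S'" unfolding S'_def by blast
  then show "(x, y) \<in> S'" by simp
qed

end

text \<open>The smallest algebraically closed subfield, that is, the field of algebraic numbers. Defining it by
  closure avoids proving that sums and products of algebraic numbers are algebraic.\<close>

inductive_set Qbar :: "complex set" where
  Qbar_one: "1 \<in> Qbar"
| Qbar_diff: "x \<in> Qbar \<Longrightarrow> y \<in> Qbar \<Longrightarrow> x - y \<in> Qbar"
| Qbar_mult: "x \<in> Qbar \<Longrightarrow> y \<in> Qbar \<Longrightarrow> x * y \<in> Qbar"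
| Qbar_inverse: "x \<in> Qbar \<Longrightarrow> inverse x \<in> Qbar"
| Qbar_root: "(\<forall>i. coeff p i \<in> Qbar) \<Longrightarrow> p \<noteq> 0 \<Longrightarrow> poly p x = 0 \<Longrightarrow> x \<in> Qbar"

lemma Qbar_zero: "0 \<in> Qbar"
  using Qbar_diff[OF Qbar_one Qbar_one] by simp

lemma Qbar_uminus: "x \<in> Qbar \<Longrightarrow> - x \<in> Qbar"
  using Qbar_diff[OF Qbar_zero] by fastforce

lemma Qbar_add: "x \<in> Qbar \<Longrightarrow> y \<in> Qbar \<Longrightarrow> x + y \<in> Qbar"
  using Qbar_diff[OF _ Qbar_uminus, of x y] by simp

lemma Qbar_of_nat: "of_nat n \<in> Qbar"
  by (induction n) (auto intro: Qbar_zero Qbar_add Qbar_one)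

lemma Qbar_of_int: "of_int n \<in> Qbar"
proof (cases n rule: int_cases2)
  case (nonneg m)
  then show ?thesis using Qbar_of_nat[of m] by simp
next
  case (nonpos m)
  then show ?thesis using Qbar_uminus[OF Qbar_of_nat[of m]] by simp
qed

lemma Qbar_divide: "x \<in> Qbar \<Longrightarrow> y \<in> Qbar \<Longrightarrow> x / y \<in> Qbar"
  unfolding divide_inverse by (intro Qbar_mult Qbar_inverse)

lemma Qbar_Rats: "x \<in> \<rat> \<Longrightarrow> x \<in> Qbar"
  by (auto elim!: Rats_cases' intro!: Qbar_divide Qbar_of_int)

lemma Qbar_power: "x \<in> Qbar \<Longrightarrow> x ^ n \<in> Qbar"
  by (induction n) (auto intro: Qbar_one Qbar_mult)

lemma Qbar_poly: "\<forall>i. coeff p i \<in> Qbar \<Longrightarrow> x \<in> Qbar \<Longrightarrow> poly p x \<in> Qbar"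
proof (induction p)
  case (pCons a p)
  have "a \<in> Qbar" using pCons.prems(1)[rule_format, of 0] by simp
  moreover have "\<forall>i. coeff p i \<in> Qbar" using pCons.prems(1)[rule_format, of "Suc _"] by simp
  ultimately show ?case using pCons by (simp add: Qbar_add Qbar_mult)
qed (simp add: Qbar_zero)

text \<open>Extension by the identity outside \<open>Qbar\<close> makes automorphisms bijections of the whole type, so that
  \<open>inv\<close> is the group inverse.\<close>

definition Gal :: "(complex \<Rightarrow> complex) set" where
  "Gal = {\<sigma>. bij_betw \<sigma> Qbar Qbar \<and> (\<forall>x. x \<notin> Qbar \<longrightarrow> \<sigma> x = x) \<and>
     (\<forall>x\<in>Qbar. \<forall>y\<in>Qbar. \<sigma> (x - y) = \<sigma> x - \<sigma> y \<and> \<sigma> (x * y) = \<sigma> x * \<sigma> y)}"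


section \<open>Extension to automorphisms and the fixed field\<close>

lemma part_iso_converse: "part_iso S \<Longrightarrow> part_iso (S\<inverse>)"
  unfolding part_iso_def by blast

lemma part_iso_exists_pol_rel:
  assumes "part_iso S" "\<forall>i. coeff p i \<in> Domain S"
  shows "\<exists>p'. pol_rel S p p'"
proof -
  define f where "f a = (SOME b. (a, b) \<in> S)" for a
  have f: "(a, f a) \<in> S" if "a \<in> Domain S" for a
    using that someI_ex[of "\<lambda>b. (a, b) \<in> S"] by (auto simp: f_def)
  have "f 0 = 0"
    using f[of 0] part_iso_zero[OF assms(1)] part_iso_zero_iff[OF assms(1)] by blast
  then have "pol_rel S p (map_poly f p)"
    using f assms(2) by (simp add: pol_rel_def coeff_map_poly)
  then show ?thesis by blast
qed

text \<open>The image of the minimal polynomial of \<open>x\<close> has the same positive degree,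
  hence a complex root, which serves as the image of \<open>x\<close>.\<close>

lemma part_iso_extend_algebraic:
  assumes S: "part_iso S" "S \<subseteq> Qbar \<times> Qbar"
    and p: "\<forall>i. coeff p i \<in> Domain S" "p \<noteq> 0" "poly p x = 0"
  shows "\<exists>T y. part_iso T \<and> S \<subseteq> T \<and> T \<subseteq> Qbar \<times> Qbar \<and> (x, y) \<in> T"
proof -
  define P where "P m \<longleftrightarrow> (\<exists>m'. pol_rel S m m') \<and> m \<noteq> 0 \<and> poly m x = 0" for m
  have "P p" using part_iso_exists_pol_rel[OF S(1) p(1)] p(2,3) by (auto simp: P_def)
  define m where "m = arg_min degree P"
  have "P m" unfolding m_def using arg_min_natI[of P p degree] \<open>P p\<close> by blast
  then obtain m' where m: "pol_rel S m m'" "m \<noteq> 0" "poly m x = 0" by (auto simp: P_def)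
  have min: "degree m \<le> degree g" if "pol_rel S g g'" "g \<noteq> 0" "poly g x = 0" for g g'
    unfolding m_def using that by (intro arg_min_nat_le) (auto simp: P_def)
  have "degree m \<noteq> 0"
    using m(2,3) by (metis degree_eq_zeroE poly_const_conv pCons_0_0)
  then have "\<not> constant (poly m')"
    using pol_rel_degree[OF S(1) m(1)] by (simp add: constant_degree)
  then obtain y where y: "poly m' y = 0" using fundamental_theorem_of_algebra by blast
  define T where "T = {(poly g x, poly g' y) | g g'. pol_rel S g g'}"
  have ext: "part_iso T" "S \<subseteq> T" "(x, y) \<in> T"
    unfolding T_def using part_iso_extend[OF S(1) m min y] by simp_all
  have rel: "(\<forall>i. coeff g i \<in> Qbar) \<and> (\<forall>i. coeff g' i \<in> Qbar)" if "pol_rel S g g'" for g g'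
    using that S(2) by (auto simp: pol_rel_def)
  have "m' \<noteq> 0" using pol_rel_zero_iff[OF S(1) m(1)] m(2) by simp
  then have "x \<in> Qbar" "y \<in> Qbar"
    using Qbar_root[of m x] Qbar_root[of m' y] m y rel[OF m(1)] by simp_all
  then have "T \<subseteq> Qbar \<times> Qbar"
    unfolding T_def using Qbar_poly rel by auto
  with ext show ?thesis by (intro exI[of _ T] exI[of _ y]) simp
qed

text \<open>The domain of a maximal isomorphism is closed under every rule that generates
  \<open>Qbar\<close>, so rule induction applies.\<close>

lemma maximal_part_iso_Domain:
  assumes S: "part_iso S" "S \<subseteq> Qbar \<times> Qbar"
    and max: "\<And>T. part_iso T \<Longrightarrow> S \<subseteq> T \<Longrightarrow> T \<subseteq> Qbar \<times> Qbar \<Longrightarrow> T = S"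
  shows "Domain S = Qbar"
proof
  show "Domain S \<subseteq> Qbar" using S(2) by blast
  show "Qbar \<subseteq> Domain S"
  proof
    fix x assume "x \<in> Qbar"
    then show "x \<in> Domain S"
    proof induction
      case Qbar_one
      then show ?case using part_iso_one[OF S(1)] by blast
    next
      case (Qbar_diff x y)
      then show ?case using part_iso_diff[OF S(1)] by blast
    next
      case (Qbar_mult x y)
      then show ?case using part_iso_mult[OF S(1)] by blast
    next
      case (Qbar_inverse x)
      then show ?case using part_iso_inverse[OF S(1)] by blast
    next
      case (Qbar_root p x)
      then have "\<forall>i. coeff p i \<in> Domain S" by blast
      from part_iso_extend_algebraic[OF S this Qbar_root(2,3)]
      obtain T y where "part_iso T" "S \<subseteq> T" "T \<subseteq> Qbar \<times> Qbar" "(x, y) \<in> T" by blast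
      then show ?case using max[of T] by blast
    qed
  qed
qed

text \<open>Zorn's lemma. Surjectivity follows by symmetry: the converse of a maximal isomorphism is
  maximal as well, so its domain is all of \<open>Qbar\<close>.\<close>

lemma part_iso_maximal_extension:
  assumes S: "part_iso S" "S \<subseteq> Qbar \<times> Qbar"
  shows "\<exists>M. part_iso M \<and> S \<subseteq> M \<and> Domain M = Qbar \<and> Range M = Qbar"
proof -
  define A where "A = {T. part_iso T \<and> S \<subseteq> T \<and> T \<subseteq> Qbar \<times> Qbar}"
  have "\<exists>M\<in>A. \<forall>X\<in>A. M \<subseteq> X \<longrightarrow> X = M"
  proof (rule subset_Zorn_nonempty)
    show "A \<noteq> {}" using S by (auto simp: A_def)
  next
    fix C assume C: "C \<noteq> {}" "subset.chain A C"
    have two: "\<exists>T\<in>C. u \<in> T \<and> v \<in> T" if "u \<in> \<Union>C" "v \<in> \<Union>C" for u v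
      using that C(2) unfolding subset.chain_def by blast
    have CA: "T \<in> A" if "T \<in> C" for T using that C(2) by (auto simp: subset.chain_def)
    have "part_iso (\<Union>C)"
      unfolding part_iso_def
    proof (intro conjI allI impI)
      show "(1, 1) \<in> \<Union>C" using C(1) CA part_iso_one unfolding A_def by blast
    next
      fix x y x' y' assume "(x, x') \<in> \<Union>C" "(y, y') \<in> \<Union>C"
      then obtain T where T: "T \<in> C" "(x, x') \<in> T" "(y, y') \<in> T" using two by blast
      then have "part_iso T" using CA by (auto simp: A_def)
      then show "(x - y, x' - y') \<in> \<Union>C" "(x * y, x' * y') \<in> \<Union>C"
        using T part_iso_diff part_iso_mult by blast+
    next
      fix x x' assume "(x, x') \<in> \<Union>C"
      then obtain T where T: "T \<in> C" "(x, x') \<in> T" by blast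
      then have "part_iso T" using CA by (auto simp: A_def)
      then show "(inverse x, inverse x') \<in> \<Union>C" "x = 0 \<longleftrightarrow> x' = 0"
        using T part_iso_inverse part_iso_zero_iff by blast+
    qed
    then show "\<Union>C \<in> A" using C(1) CA by (auto simp: A_def)
  qed
  then obtain M where M: "M \<in> A" and max: "\<And>X. X \<in> A \<Longrightarrow> M \<subseteq> X \<Longrightarrow> X = M" by blast
  have "Domain M = Qbar"
    using maximal_part_iso_Domain[of M] M max by (auto simp: A_def)
  moreover have "Domain (M\<inverse>) = Qbar"
  proof (rule maximal_part_iso_Domain)
    show "part_iso (M\<inverse>)" "M\<inverse> \<subseteq> Qbar \<times> Qbar"
      using M part_iso_converse by (auto simp: A_def)
    fix T assume T: "part_iso T" "M\<inverse> \<subseteq> T" "T \<subseteq> Qbar \<times> Qbar"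
    then have "T\<inverse> \<in> A" "M \<subseteq> T\<inverse>"
      using part_iso_converse M by (auto simp: A_def)
    then show "T = M\<inverse>" using max by fastforce
  qed
  ultimately show ?thesis using M by (auto simp: A_def)
qed

lemma Gal_of_part_iso:
  assumes M: "part_iso M" "Domain M = Qbar" "Range M = Qbar"
  shows "\<exists>\<sigma>\<in>Gal. \<forall>x y. (x, y) \<in> M \<longrightarrow> \<sigma> x = y"
proof -
  define \<sigma> where "\<sigma> x = (if x \<in> Qbar then SOME y. (x, y) \<in> M else x)" for x
  have \<sigma>: "(x, \<sigma> x) \<in> M" if "x \<in> Qbar" for x
    using that M(2) someI_ex[of "\<lambda>y. (x, y) \<in> M"] by (auto simp: \<sigma>_def)
  have eq: "\<sigma> x = y" if "(x, y) \<in> M" for x y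
  proof -
    have "x \<in> Qbar" using that M(2) by blast
    from part_iso_unique[OF M(1) \<sigma>[OF this] that] show ?thesis by simp
  qed
  have "bij_betw \<sigma> Qbar Qbar"
    unfolding bij_betw_def
  proof
    show "inj_on \<sigma> Qbar"
      by (rule inj_onI) (use \<sigma> part_iso_unique[OF M(1) \<sigma> \<sigma>] in \<open>simp\<close>)
    show "\<sigma> ` Qbar = Qbar"
    proof
      show "\<sigma> ` Qbar \<subseteq> Qbar" using \<sigma> M(3) by blast
      show "Qbar \<subseteq> \<sigma> ` Qbar"
      proof
        fix y assume "y \<in> Qbar"
        then obtain x where "(x, y) \<in> M" using M(3) by blast
        then show "y \<in> \<sigma> ` Qbar" using eq M(2) by (metis DomainI imageI)
      qed
    qed
  qed
  moreover have "\<sigma> (x - y) = \<sigma> x - \<sigma> y \<and> \<sigma> (x * y) = \<sigma> x * \<sigma> y" if "x \<in> Qbar" "y \<in> Qbar" for x y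
    using eq[OF part_iso_diff[OF M(1) \<sigma>[OF that(1)] \<sigma>[OF that(2)]]]
      eq[OF part_iso_mult[OF M(1) \<sigma>[OF that(1)] \<sigma>[OF that(2)]]] by blast
  moreover have "\<sigma> x = x" if "x \<notin> Qbar" for x using that by (simp add: \<sigma>_def)
  ultimately have "\<sigma> \<in> Gal" by (simp add: Gal_def)
  then show ?thesis using eq by blast
qed

text \<open>The minimal polynomial of an irrational algebraic number has degree at least 2 and is
  separable, so some automorphism moves the number to another root.\<close>

lemma Gal_fixed_Rats:
  assumes alg: "\<forall>i. coeff p i \<in> \<rat>" "p \<noteq> 0" "poly p x = 0"
    and fixed: "\<And>\<sigma>. \<sigma> \<in> Gal \<Longrightarrow> \<sigma> x = x"
  shows "x \<in> \<rat>"
proof (rule ccontr)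
  assume irr: "x \<notin> \<rat>"
  define S where "S = (\<lambda>q. (q, q)) ` (\<rat> :: complex set)"
  have S: "part_iso S" by (auto simp: part_iso_def S_def)
  have SOm: "S \<subseteq> Qbar \<times> Qbar" using Qbar_Rats by (auto simp: S_def)
  have rel: "pol_rel S g g' \<longleftrightarrow> g = g' \<and> (\<forall>i. coeff g i \<in> \<rat>)" for g g'
    unfolding pol_rel_def S_def poly_eq_iff image_iff by (metis prod.inject)
  define P where "P m \<longleftrightarrow> (\<forall>i. coeff m i \<in> \<rat>) \<and> m \<noteq> 0 \<and> poly m x = 0" for m
  have "P p" using alg by (auto simp: P_def)
  define m where "m = arg_min degree P"
  have "P m" unfolding m_def using arg_min_natI[of P p degree] \<open>P p\<close> by blast
  then have m: "\<forall>i. coeff m i \<in> \<rat>" "m \<noteq> 0" "poly m x = 0" by (auto simp: P_def)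
  have min: "degree m \<le> degree g" if "\<forall>i. coeff g i \<in> \<rat>" "g \<noteq> 0" "poly g x = 0" for g
    unfolding m_def using that by (intro arg_min_nat_le) (auto simp: P_def)
  obtain n where n: "m = [:- x, 1:] * n" using m(3) by (auto simp: poly_eq_0_iff_dvd)
  have degm: "degree m = Suc (degree n)" using n m(2) by (subst n, subst degree_mult_eq) auto
  have "degree n \<noteq> 0"
  proof
    assume "degree n = 0"
    then obtain c where "n = [:c:]" by (rule degree_eq_zeroE)
    then have mc: "m = [:- x * c, c:]" using n by simp
    then have "c \<in> \<rat>" "- x * c \<in> \<rat>" "c \<noteq> 0"
      using m(1)[rule_format, of 0] m(1)[rule_format, of 1] m(2,3) by auto
    then have "- (- x * c / c) \<in> \<rat>" by (blast intro: Rats_divide Rats_minus_iff[THEN iffD2])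
    then show False using irr \<open>c \<noteq> 0\<close> by simp
  qed
  then have "\<not> constant (poly n)" by (simp add: constant_degree)
  then obtain y where y: "poly n y = 0" using fundamental_theorem_of_algebra by blast
  \<comment> \<open>Were \<open>x\<close> a double root, the derivative would be a rational
    polynomial of smaller degree vanishing at \<open>x\<close>.\<close>
  have "y \<noteq> x"
  proof
    assume "y = x"
    then have "poly (pderiv m) x = 0" using y unfolding n pderiv_mult by (simp add: pderiv_pCons)
    moreover have "pderiv m \<noteq> 0" using degm by (simp add: pderiv_eq_0_iff)
    moreover have "\<forall>i. coeff (pderiv m) i \<in> \<rat>"
      using m(1) by (simp add: coeff_pderiv Rats_mult)
    ultimately show False using min[of "pderiv m"] degm by (simp add: degree_pderiv)
  qed
  have "pol_rel S m m" using m rel by blast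
  moreover have "poly m y = 0" using n y by simp
  moreover have "degree m \<le> degree g" if "pol_rel S g g'" "g \<noteq> 0" "poly g x = 0" for g g'
    using that rel min by blast
  ultimately have ext: "part_iso {(poly g x, poly g' y) | g g'. pol_rel S g g'}"
    "S \<subseteq> {(poly g x, poly g' y) | g g'. pol_rel S g g'}"
    "(x, y) \<in> {(poly g x, poly g' y) | g g'. pol_rel S g g'}"
    using part_iso_extend[OF S _ m(2,3), of m y] by presburger+
  have "\<forall>i. coeff m i \<in> Qbar" using m(1) Qbar_Rats by blast
  then have "x \<in> Qbar" "y \<in> Qbar"
    using Qbar_root[of m] m(2,3) \<open>poly m y = 0\<close> by blast+
  then have "{(poly g x, poly g' y) | g g'. pol_rel S g g'} \<subseteq> Qbar \<times> Qbar"
    using rel Qbar_Rats by (auto intro!: Qbar_poly)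
  from part_iso_maximal_extension[OF ext(1) this]
  obtain M where "part_iso M" "(x, y) \<in> M" "Domain M = Qbar" "Range M = Qbar" using ext(3) by blast
  then obtain \<sigma> where "\<sigma> \<in> Gal" "\<sigma> x = y" using Gal_of_part_iso[of M] by blast
  then show False using fixed \<open>y \<noteq> x\<close> by blast
qed

section \<open>Arithmetic of automorphisms\<close>

context
  fixes \<sigma> :: "complex \<Rightarrow> complex"
  assumes \<sigma>: "\<sigma> \<in> Gal"
begin

lemma Gal_bij_betw: "bij_betw \<sigma> Qbar Qbar"
  and Gal_diff: "x \<in> Qbar \<Longrightarrow> y \<in> Qbar \<Longrightarrow> \<sigma> (x - y) = \<sigma> x - \<sigma> y"
  and Gal_mult: "x \<in> Qbar \<Longrightarrow> y \<in> Qbar \<Longrightarrow> \<sigma> (x * y) = \<sigma> x * \<sigma> y"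
  and Gal_outside: "x \<notin> Qbar \<Longrightarrow> \<sigma> x = x"
  using \<sigma> by (auto simp: Gal_def)

lemma Gal_Qbar: "x \<in> Qbar \<Longrightarrow> \<sigma> x \<in> Qbar"
  using Gal_bij_betw by (auto simp: bij_betw_def)

lemma Gal_Qbar_iff: "\<sigma> x \<in> Qbar \<longleftrightarrow> x \<in> Qbar"
  using Gal_Qbar Gal_outside by metis

lemma Gal_bij: "bij \<sigma>"
proof -
  have "bij_betw \<sigma> (- Qbar) (- Qbar)"
    using Gal_outside by (subst bij_betw_cong[of _ _ id]) auto
  from bij_betw_combine[OF Gal_bij_betw this] show ?thesis by simp
qed

lemma Gal_eq_iff: "\<sigma> x = \<sigma> y \<longleftrightarrow> x = y"
  using bij_is_inj[OF Gal_bij] by (simp add: inj_eq)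

lemma Gal_zero: "\<sigma> 0 = 0"
  using Gal_diff[OF Qbar_one Qbar_one] by simp

lemma Gal_one: "\<sigma> 1 = 1"
proof -
  have "\<sigma> 1 * \<sigma> 1 = \<sigma> 1" using Gal_mult[OF Qbar_one Qbar_one] by simp
  moreover have "\<sigma> 1 \<noteq> 0" using Gal_eq_iff[of 1 0] Gal_zero by simp
  ultimately show ?thesis by simp
qed

lemma Gal_uminus: "x \<in> Qbar \<Longrightarrow> \<sigma> (- x) = - \<sigma> x"
  using Gal_diff[OF Qbar_zero] Gal_zero by fastforce

lemma Gal_add: "x \<in> Qbar \<Longrightarrow> y \<in> Qbar \<Longrightarrow> \<sigma> (x + y) = \<sigma> x + \<sigma> y"
  using Gal_diff[OF _ Qbar_uminus, of x y] Gal_uminus[of y] by simp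

lemma Gal_inverse: "x \<in> Qbar \<Longrightarrow> \<sigma> (inverse x) = inverse (\<sigma> x)"
proof (cases "x = 0")
  case False
  assume "x \<in> Qbar"
  then have "\<sigma> (inverse x) * \<sigma> x = \<sigma> (inverse x * x)" using Gal_mult Qbar_inverse by simp
  then have "\<sigma> (inverse x) * \<sigma> x = 1" using False Gal_one by simp
  then show ?thesis by (metis inverse_unique mult.commute)
qed (simp add: Gal_zero)

lemma Gal_divide: "x \<in> Qbar \<Longrightarrow> y \<in> Qbar \<Longrightarrow> \<sigma> (x / y) = \<sigma> x / \<sigma> y"
  by (simp add: divide_inverse Gal_mult Gal_inverse Qbar_inverse)

lemma Gal_power: "x \<in> Qbar \<Longrightarrow> \<sigma> (x ^ n) = \<sigma> x ^ n"
  by (induction n) (auto simp: Gal_one Gal_mult Qbar_power)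

lemma Gal_of_nat: "\<sigma> (of_nat n) = of_nat n"
  by (induction n) (auto simp: Gal_zero Gal_one Gal_add Qbar_one Qbar_of_nat)

lemma Gal_of_int: "\<sigma> (of_int n) = of_int n"
proof (cases n rule: int_cases2)
  case (nonneg m)
  then show ?thesis using Gal_of_nat by simp
next
  case (nonpos m)
  then show ?thesis using Gal_of_nat Gal_uminus[OF Qbar_of_nat] by simp
qed

lemma Gal_graph_part_iso: "part_iso {(x, \<sigma> x) | x. x \<in> Qbar}"
  unfolding part_iso_def
  using Gal_one Gal_diff Gal_mult Gal_inverse Gal_eq_iff[of _ 0] Gal_zero
  by (auto intro: Qbar_one Qbar_diff Qbar_mult Qbar_inverse)

end

lemma Gal_id: "id \<in> Gal"
  by (simp add: Gal_def)

lemma Gal_comp: "\<sigma> \<in> Gal \<Longrightarrow> \<tau> \<in> Gal \<Longrightarrow> \<sigma> \<circ> \<tau> \<in> Gal"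
  by (simp add: Gal_def bij_betw_trans[of \<tau> Qbar Qbar \<sigma>] Gal_Qbar)

lemma Gal_inv_apply: "\<sigma> \<in> Gal \<Longrightarrow> inv \<sigma> (\<sigma> x) = x"
  and Gal_apply_inv: "\<sigma> \<in> Gal \<Longrightarrow> \<sigma> (inv \<sigma> x) = x"
  using Gal_bij by (simp_all add: bij_is_inj bij_is_surj surj_f_inv_f)

lemma Gal_inv: assumes "\<sigma> \<in> Gal" shows "inv \<sigma> \<in> Gal"
proof -
  note inv = Gal_inv_apply[OF assms] Gal_apply_inv[OF assms]
  have Qbar: "inv \<sigma> x \<in> Qbar \<longleftrightarrow> x \<in> Qbar" for x
    using Gal_Qbar_iff[OF assms, of "inv \<sigma> x"] inv by simp
  have "bij_betw (inv \<sigma>) Qbar Qbar"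
    by (rule bij_betwI[of _ _ _ \<sigma>]) (use Qbar Gal_Qbar[OF assms] inv in auto)
  moreover have "inv \<sigma> x = x" if "x \<notin> Qbar" for x
    using Gal_outside[OF assms that] inv(1)[of x] by simp
  moreover have "inv \<sigma> (x - y) = inv \<sigma> x - inv \<sigma> y" "inv \<sigma> (x * y) = inv \<sigma> x * inv \<sigma> y"
    if "x \<in> Qbar" "y \<in> Qbar" for x y
  proof -
    have "\<sigma> (inv \<sigma> x - inv \<sigma> y) = x - y" "\<sigma> (inv \<sigma> x * inv \<sigma> y) = x * y"
      using that Qbar Gal_diff[OF assms] Gal_mult[OF assms] inv by simp_all
    then show "inv \<sigma> (x - y) = inv \<sigma> x - inv \<sigma> y" "inv \<sigma> (x * y) = inv \<sigma> x * inv \<sigma> y"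
      using inv(1) by metis+
  qed
  ultimately show ?thesis by (simp add: Gal_def)
qed

section \<open>Iterated commutators and radical numbers\<close>

text \<open>Only commutators, not the subgroups generated by them: closure under conjugation is all that is
  needed, and no derived subgroup has to be generated.\<close>

primrec Der :: "nat \<Rightarrow> (complex \<Rightarrow> complex) set" where
  "Der 0 = Gal"
| "Der (Suc n) = {c \<in> Gal. \<exists>\<sigma>\<in>Der n. \<exists>\<tau>\<in>Der n. \<tau> \<circ> \<sigma> \<circ> c = \<sigma> \<circ> \<tau>}"

declare Der.simps(2) [simp del]

lemma Der_Gal: "c \<in> Der n \<Longrightarrow> c \<in> Gal"
  by (cases n) (auto simp: Der.simps(2))

lemma Der_conj: "\<rho> \<in> Gal \<Longrightarrow> c \<in> Der n \<Longrightarrow> \<rho> \<circ> c \<circ> inv \<rho> \<in> Der n"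
proof (induction n arbitrary: c)
  case 0
  then show ?case using Gal_comp Gal_inv by (simp del: o_apply)
next
  case (Suc n)
  then obtain \<sigma> \<tau> where *: "c \<in> Gal" "\<sigma> \<in> Der n" "\<tau> \<in> Der n" "\<tau> \<circ> \<sigma> \<circ> c = \<sigma> \<circ> \<tau>"
    by (auto simp: Der.simps(2))
  have "(\<rho> \<circ> \<tau> \<circ> inv \<rho>) \<circ> (\<rho> \<circ> \<sigma> \<circ> inv \<rho>) \<circ> (\<rho> \<circ> c \<circ> inv \<rho>) = (\<rho> \<circ> \<sigma> \<circ> inv \<rho>) \<circ> (\<rho> \<circ> \<tau> \<circ> inv \<rho>)"
    using *(4) by (auto simp: fun_eq_iff Gal_inv_apply[OF Suc.prems(1)])
  moreover have "\<rho> \<circ> c \<circ> inv \<rho> \<in> Gal"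
    using Suc.prems(1) *(1) by (intro Gal_comp Gal_inv)
  ultimately show ?case
    unfolding Der.simps mem_Collect_eq using Suc.IH[OF Suc.prems(1)] *(2,3) by blast
qed

lemma Der_commutator_fixes:
  assumes "c \<in> Der (Suc n)" "\<And>\<sigma> \<tau>. \<sigma> \<in> Der n \<Longrightarrow> \<tau> \<in> Der n \<Longrightarrow> \<sigma> (\<tau> x) = \<tau> (\<sigma> x)"
  shows "c x = x"
proof -
  obtain \<sigma> \<tau> where *: "\<sigma> \<in> Der n" "\<tau> \<in> Der n" "\<tau> \<circ> \<sigma> \<circ> c = \<sigma> \<circ> \<tau>"
    using assms(1) by (auto simp: Der.simps(2))
  have "\<tau> (\<sigma> (c x)) = \<tau> (\<sigma> x)"
    using fun_cong[OF *(3), of x] assms(2)[OF *(1,2)] by simp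
  then show ?thesis using Gal_eq_iff Der_Gal *(1,2) by metis
qed

text \<open>Stands in for an inclusion between the sets \<open>Der n\<close>, which are not groups:
  two elements that fix \<open>x\<close> commute at \<open>x\<close>, so their commutator fixes
  it.\<close>

lemma Der_fixes_mono:
  assumes "\<And>c. c \<in> Der m \<Longrightarrow> c x = x" "m \<le> n" "c \<in> Der n"
  shows "c x = x"
  using assms(2,3)
proof (induction n arbitrary: c rule: dec_induct)
  case (step n)
  show ?case by (rule Der_commutator_fixes[OF step.prems]) (simp add: step.IH)
qed (use assms in auto)

text \<open>Cyclotomic step: automorphisms send the primitive root \<open>\<xi>\<close> to powers of
  itself, and power maps commute.\<close>

lemma Der_fixes_root_of_unity:
  assumes "z ^ k = 1" "k > 0" "c \<in> Der (Suc 0)"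
  shows "c z = z"
proof -
  define \<xi> where "\<xi> = exp (2 * of_real pi * \<i> / of_nat k)"
  have roots: "\<exists>j. w = \<xi> ^ j" if "w ^ k = 1" for w
  proof -
    have "w \<in> {exp (2 * of_real pi * \<i> * of_nat j / of_nat k) | j. j < k}"
      using that complex_roots_unity[of k] assms(2) by auto
    then show ?thesis by (auto simp: \<xi>_def exp_of_nat_mult[symmetric] mult_ac)
  qed
  have xi: "\<xi> ^ k = 1"
    using assms(2) by (simp add: \<xi>_def exp_of_nat_mult[symmetric] exp_eq_1) 
  have "poly (monom 1 k - 1) \<xi> = 0" using xi by (simp add: poly_monom)
  moreover have "monom 1 k - 1 \<noteq> (0 :: complex poly)"
  proof -
    have "degree (monom (1 :: complex) k) \<noteq> degree (1 :: complex poly)"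
      using assms(2) by (simp add: degree_monom_eq)
    then show ?thesis by auto
  qed
  moreover have "\<forall>i. coeff (monom 1 k - 1 :: complex poly) i \<in> Qbar"
    by (auto simp: coeff_pCons one_pCons Qbar_one Qbar_zero Qbar_uminus Qbar_diff split: nat.splits)
  ultimately have xiOm: "\<xi> \<in> Qbar" using Qbar_root by blast
  have "c \<xi> = \<xi>"
  proof (rule Der_commutator_fixes[OF assms(3)])
    fix \<sigma> \<tau> assume "\<sigma> \<in> Der 0" "\<tau> \<in> Der 0"
    then have st: "\<sigma> \<in> Gal" "\<tau> \<in> Gal" by simp_all
    have "\<exists>j. \<rho> \<xi> = \<xi> ^ j" if "\<rho> \<in> Gal" for \<rho>
      by (rule roots) (use Gal_power[OF that xiOm, of k] Gal_one[OF that] xi in simp)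
    then obtain a b where "\<sigma> \<xi> = \<xi> ^ a" "\<tau> \<xi> = \<xi> ^ b" using st by blast
    then show "\<sigma> (\<tau> \<xi>) = \<tau> (\<sigma> \<xi>)"
      using st xiOm by (simp add: Gal_power power_mult[symmetric] mult.commute)
  qed
  then show ?thesis
    using roots[OF assms(1)] Gal_power[OF Der_Gal[OF assms(3)] xiOm] by auto
qed

lemma Qbar_nth_root:
  assumes "x \<in> Qbar" "k > 0" "w ^ k = x"
  shows "w \<in> Qbar"
proof (rule Qbar_root)
  show "\<forall>i. coeff (monom 1 k - [:x:]) i \<in> Qbar"
    using assms(1) by (auto simp: coeff_pCons Qbar_one Qbar_zero Qbar_uminus Qbar_diff split: nat.splits)
  have "degree (monom (1 :: complex) k) \<noteq> degree [:x:]"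
    using assms(2) by (simp add: degree_monom_eq)
  then show "monom 1 k - [:x:] \<noteq> 0" by auto
  show "poly (monom 1 k - [:x:]) w = 0" using assms(3) by (simp add: poly_monom)
qed

text \<open>Kummer step. An element of \<open>Der (Suc m)\<close> fixes \<open>x\<close> and all
  \<open>k\<close>-th roots of unity, so it multiplies \<open>w\<close> by a root of unity; such
  multiplications commute, and one more commutator fixes \<open>w\<close>.\<close>

lemma Der_fixes_nth_root:
  assumes x: "x \<in> Qbar" "\<And>c. c \<in> Der m \<Longrightarrow> c x = x" and w: "k > 0" "w ^ k = x"
    and c: "c \<in> Der (Suc (Suc m))"
  shows "c w = w"
proof (rule Der_commutator_fixes[OF c])
  fix \<sigma> \<tau> assume st: "\<sigma> \<in> Der (Suc m)" "\<tau> \<in> Der (Suc m)"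
  have wOm: "w \<in> Qbar" using Qbar_nth_root x(1) w by blast
  have fix1: "\<rho> z = z" if "\<rho> \<in> Der (Suc m)" "z ^ k = 1" for \<rho> z
  proof (rule Der_fixes_mono)
    show "\<And>c. c \<in> Der (Suc 0) \<Longrightarrow> c z = z" by (rule Der_fixes_root_of_unity[OF that(2) w(1)])
    show "\<rho> \<in> Der (Suc m)" by (rule that(1))
  qed simp
  have act: "\<exists>z. z ^ k = 1 \<and> \<rho> w = z * w" if "\<rho> \<in> Der (Suc m)" for \<rho>
  proof (cases "w = 0")
    case True
    then show ?thesis using Gal_zero[OF Der_Gal[OF that]] by (intro exI[of _ 1]) simp
  next
    case False
    have "\<rho> w ^ k = \<rho> x" using Gal_power[OF Der_Gal[OF that] wOm, of k] w(2) by simp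
    also have "\<rho> x = x" using Der_fixes_mono[of m x "Suc m" \<rho>] x(2) that by simp
    finally have "(\<rho> w / w) ^ k = 1"
      using False w(2)[symmetric] by (simp add: power_divide)
    then show ?thesis using False by (intro exI[of _ "\<rho> w / w"]) simp
  qed
  obtain z z' where z: "z ^ k = 1" "\<sigma> w = z * w" "z' ^ k = 1" "\<tau> w = z' * w"
    using act[OF st(1)] act[OF st(2)] by auto
  have zOm: "z \<in> Qbar" "z' \<in> Qbar" using Qbar_nth_root Qbar_one z w(1) by blast+
  have "\<sigma> (\<tau> w) = z' * (z * w)" "\<tau> (\<sigma> w) = z * (z' * w)"
    using z zOm wOm fix1 st by (simp_all add: Gal_mult[OF Der_Gal])
  then show "\<sigma> (\<tau> w) = \<tau> (\<sigma> w)" by simp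
qed

lemma Der_fixed_common:
  assumes "\<exists>m. \<forall>c\<in>Der m. c x = x \<and> c (cnj x) = cnj x" "\<exists>m. \<forall>c\<in>Der m. c y = y \<and> c (cnj y) = cnj y"
  shows "\<exists>m. \<forall>c\<in>Der m. c x = x \<and> c (cnj x) = cnj x \<and> c y = y \<and> c (cnj y) = cnj y"
proof -
  obtain m n where m: "\<forall>c\<in>Der m. c x = x \<and> c (cnj x) = cnj x" and n: "\<forall>c\<in>Der n. c y = y \<and> c (cnj y) = cnj y"
    using assms by blast
  show ?thesis
  proof (intro exI[of _ "max m n"] ballI)
    fix c assume c: "c \<in> Der (max m n)"
    have "c z = z" if "\<And>c. c \<in> Der m \<Longrightarrow> c z = z" for z
      by (rule Der_fixes_mono[of m _ "max m n"]) (use that c in auto)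
    moreover have "c z = z" if "\<And>c. c \<in> Der n \<Longrightarrow> c z = z" for z
      by (rule Der_fixes_mono[of n _ "max m n"]) (use that c in auto)
    ultimately show "c x = x \<and> c (cnj x) = cnj x \<and> c y = y \<and> c (cnj y) = cnj y"
      using m n by simp
  qed
qed

text \<open>A number and its complex conjugate are carried along together, so that the
  \<open>conj\<close> case merely swaps them.\<close>

lemma radical_computable_Der:
  assumes "x \<in> radical_computable"
  shows "x \<in> Qbar \<and> cnj x \<in> Qbar \<and> (\<exists>m. \<forall>c\<in>Der m. c x = x \<and> c (cnj x) = cnj x)"
  using assms
proof induction
  case (const n)
  then show ?case using Qbar_of_int[of n] Gal_of_int[of _ n] by (auto intro!: exI[of _ 0])
next
  case (root x k w)
  then obtain m where m: "\<forall>c\<in>Der m. c x = x \<and> c (cnj x) = cnj x" by blast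
  have "cnj w ^ k = cnj x" using root by (metis complex_cnj_power)
  then show ?case
    using root Qbar_nth_root[of x k w] Qbar_nth_root[of "cnj x" k "cnj w"] m
      Der_fixes_nth_root[of x m k w] Der_fixes_nth_root[of "cnj x" m k "cnj w"]
    by (intro conjI exI[of _ "Suc (Suc m)"]) auto
next
  case (conj x)
  then show ?case by auto
next
  case (add x y)
  then obtain m where "\<forall>c\<in>Der m. c x = x \<and> c (cnj x) = cnj x \<and> c y = y \<and> c (cnj y) = cnj y"
    using Der_fixed_common[of x y] by blast
  then show ?case
    using add by (intro conjI exI[of _ m]) (auto simp: Qbar_add Gal_add[OF Der_Gal])
next
  case (diff x y)
  then obtain m where "\<forall>c\<in>Der m. c x = x \<and> c (cnj x) = cnj x \<and> c y = y \<and> c (cnj y) = cnj y"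
    using Der_fixed_common[of x y] by blast
  then show ?case
    using diff by (intro conjI exI[of _ m]) (auto simp: Qbar_diff Gal_diff[OF Der_Gal])
next
  case (mult x y)
  then obtain m where "\<forall>c\<in>Der m. c x = x \<and> c (cnj x) = cnj x \<and> c y = y \<and> c (cnj y) = cnj y"
    using Der_fixed_common[of x y] by blast
  then show ?case
    using mult by (intro conjI exI[of _ m]) (auto simp: Qbar_mult Gal_mult[OF Der_Gal])
next
  case (divide x y)
  then obtain m where "\<forall>c\<in>Der m. c x = x \<and> c (cnj x) = cnj x \<and> c y = y \<and> c (cnj y) = cnj y"
    using Der_fixed_common[of x y] by blast
  then show ?case
    using divide by (intro conjI exI[of _ m]) (auto simp: Qbar_divide Gal_divide[OF Der_Gal])
qed

section \<open>Reduction modulo a prime\<close>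

definition localint :: "nat \<Rightarrow> complex set" where
  "localint p = {x. \<exists>a b. x = of_int a / of_int b \<and> \<not> int p dvd b}"

text \<open>The module spanned by \<open>E\<close> over \<open>localint p\<close>; as an inductive
  set it gives rule induction in place of finite linear combinations.\<close>

inductive_set lspan :: "nat \<Rightarrow> complex set \<Rightarrow> complex set" for p E where
  lspan_zero: "0 \<in> lspan p E"
| lspan_step: "e \<in> E \<Longrightarrow> r \<in> localint p \<Longrightarrow> x \<in> lspan p E \<Longrightarrow> r * e + x \<in> lspan p E"

context
  fixes p :: nat
  assumes p: "prime p"
begin

lemma prime_int_p: "prime (int p)"
  using p by simp

lemma localint_of_int: "of_int a \<in> localint p"
proof -
  have "of_int a = (of_int a / of_int 1 :: complex)" by simp
  moreover have "\<not> int p dvd 1" using prime_int_p not_prime_unit by blast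
  ultimately show ?thesis unfolding localint_def by blast
qed

lemma localint_zero: "0 \<in> localint p" and localint_one: "1 \<in> localint p"
  using localint_of_int[of 0] localint_of_int[of 1] by simp_all

lemma localint_mult: "x \<in> localint p \<Longrightarrow> y \<in> localint p \<Longrightarrow> x * y \<in> localint p"
proof -
  assume "x \<in> localint p" "y \<in> localint p"
  then obtain a b c d where *: "x = of_int a / of_int b" "\<not> int p dvd b" "y = of_int c / of_int d" "\<not> int p dvd d"
    unfolding localint_def by blast
  have "x * y = of_int (a * c) / of_int (b * d)" using * by simp
  moreover have "\<not> int p dvd b * d" using * prime_int_p prime_dvd_mult_iff by blast
  ultimately show ?thesis unfolding localint_def by blast
qed

lemma localint_add: "x \<in> localint p \<Longrightarrow> y \<in> localint p \<Longrightarrow> x + y \<in> localint p"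
proof -
  assume "x \<in> localint p" "y \<in> localint p"
  then obtain a b c d where *: "x = of_int a / of_int b" "\<not> int p dvd b" "y = of_int c / of_int d" "\<not> int p dvd d"
    unfolding localint_def by blast
  have "b \<noteq> 0" "d \<noteq> 0" using * by auto
  then have "x + y = of_int (a * d + c * b) / of_int (b * d)" using * by (simp add: field_simps)
  moreover have "\<not> int p dvd b * d" using * prime_int_p prime_dvd_mult_iff by blast
  ultimately show ?thesis unfolding localint_def by blast
qed

lemma localint_divide_int: "x \<in> localint p \<Longrightarrow> \<not> int p dvd b \<Longrightarrow> x / of_int b \<in> localint p"
proof -
  assume *: "x \<in> localint p" "\<not> int p dvd b"
  have "of_int 1 / of_int b \<in> localint p"
    unfolding localint_def using *(2) by blast
  from localint_mult[OF *(1) this] show ?thesis by simp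
qed

text \<open>With \<open>r = a / b\<close>, the numerator \<open>b - p a\<close> is prime to
  \<open>p\<close>. This locality is what Nakayama's lemma uses.\<close>

lemma localint_inverse_one_minus:
  assumes "r \<in> localint p"
  shows "1 - of_nat p * r \<noteq> 0" "inverse (1 - of_nat p * r) \<in> localint p"
proof -
  obtain a b where ab: "r = of_int a / of_int b" "\<not> int p dvd b" using assms unfolding localint_def by blast
  then have "b \<noteq> 0" by auto
  then have eq: "1 - of_nat p * r = of_int (b - int p * a) / of_int b" using ab(1) by (simp add: field_simps)
  have nd: "\<not> int p dvd b - int p * a" using ab(2) by (simp add: dvd_diff_left_iff)
  then have "b - int p * a \<noteq> 0" by auto
  then show "1 - of_nat p * r \<noteq> 0" unfolding eq using \<open>b \<noteq> 0\<close> by (metis divide_eq_0_iff of_int_eq_0_iff)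
  have "inverse (1 - of_nat p * r) = of_int b / of_int (b - int p * a)" unfolding eq by simp
  then show "inverse (1 - of_nat p * r) \<in> localint p" unfolding localint_def using nd by blast
qed

lemma lspan_base: "e \<in> E \<Longrightarrow> e \<in> lspan p E"
  using lspan_step[OF _ localint_one lspan_zero] by fastforce

lemma lspan_add: "x \<in> lspan p E \<Longrightarrow> y \<in> lspan p E \<Longrightarrow> x + y \<in> lspan p E"
proof (induction rule: lspan.induct)
  case (lspan_step e r x)
  then show ?case using lspan.lspan_step[of e E r p "x + y"] by (simp add: add.assoc)
qed auto

lemma lspan_scale: "x \<in> lspan p E \<Longrightarrow> r \<in> localint p \<Longrightarrow> r * x \<in> lspan p E"
proof (induction rule: lspan.induct)
  case lspan_zero
  then show ?case by (simp add: lspan.lspan_zero)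
next
  case (lspan_step e s x)
  then show ?case using lspan.lspan_step[of e E "r * s" p "r * x"] localint_mult by (simp add: algebra_simps)
qed

lemma lspan_linear:
  assumes "\<And>e. e \<in> E \<Longrightarrow> w * e \<in> lspan p F" "x \<in> lspan p E"
  shows "w * x \<in> lspan p F"
  using assms(2)
proof induction
  case (lspan_step e r x)
  then have "r * (w * e) + w * x \<in> lspan p F"
    using lspan_add lspan_scale assms(1) by blast
  then show ?case by (simp add: algebra_simps)
qed (simp add: lspan_zero)

lemma lspan_sum: "(\<And>i. i \<in> I \<Longrightarrow> f i \<in> lspan p E) \<Longrightarrow> sum f I \<in> lspan p E"
  by (induction I rule: infinite_finite_induct) (auto intro: lspan_zero lspan_add)

lemma lspan_insert:
  assumes "x \<in> lspan p (insert a E)"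
  shows "\<exists>r\<in>localint p. \<exists>y\<in>lspan p E. x = r * a + y"
  using assms
proof induction
  case lspan_zero
  then show ?case using localint_zero lspan.lspan_zero by force
next
  case (lspan_step e r x)
  then obtain s y where sy: "s \<in> localint p" "y \<in> lspan p E" "x = s * a + y" by blast
  show ?case
  proof (cases "e = a")
    case True
    then have "r * e + x = (r + s) * a + y" using sy by (simp add: algebra_simps)
    then show ?thesis using sy localint_add lspan_step by blast
  next
    case False
    then have "r * e + y \<in> lspan p E" using lspan_step sy lspan.lspan_step by blast
    moreover have "r * e + x = s * a + (r * e + y)" using sy by simp
    ultimately show ?thesis using sy by blast
  qed
qed

text \<open>Nakayama's lemma, by induction on the generators: from \<open>a = p (r a + z)\<close>
  the generator \<open>a\<close> can be eliminated, because \<open>1 - p r\<close> is a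
  unit.\<close>

lemma lspan_nakayama:
  assumes "finite E" "\<And>e. e \<in> E \<Longrightarrow> \<exists>y\<in>lspan p E. e = of_nat p * y"
  shows "E \<subseteq> {0}"
  using assms
proof (induction E)
  case (insert a E)
  obtain y where y: "y \<in> lspan p (insert a E)" "a = of_nat p * y" using insert.prems by blast
  obtain r z where rz: "r \<in> localint p" "z \<in> lspan p E" "y = r * a + z" using lspan_insert[OF y(1)] by blast
  define w where "w = inverse (1 - of_nat p * r) * z"
  have w: "w \<in> lspan p E" unfolding w_def using localint_inverse_one_minus[OF rz(1)] lspan_scale rz(2) by blast
  have "(1 - of_nat p * r) * a = of_nat p * z" using y(2) rz(3) by (simp add: algebra_simps)
  then have aw: "a = of_nat p * w"
    using localint_inverse_one_minus(1)[OF rz(1)] unfolding w_def by (simp add: field_simps)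
  have "E \<subseteq> {0}"
  proof (rule insert.IH)
    fix e assume "e \<in> E"
    then obtain y' where y': "y' \<in> lspan p (insert a E)" "e = of_nat p * y'" using insert.prems by blast
    obtain r' z' where rz': "r' \<in> localint p" "z' \<in> lspan p E" "y' = r' * a + z'"
      using lspan_insert[OF y'(1)] by blast
    have "r' * (of_nat p * w) + z' \<in> lspan p E"
      using lspan_add lspan_scale rz' w localint_of_int[of "int p"] by simp
    then show "\<exists>y\<in>lspan p E. e = of_nat p * y" using y'(2) rz'(3) aw by blast
  qed
  then have "lspan p E \<subseteq> {0}"
  proof (intro subsetI)
    fix x assume "E \<subseteq> {0}" "x \<in> lspan p E"
    from this(2,1) show "x \<in> {0}" by induction auto
  qed
  then show ?case using aw w \<open>E \<subseteq> {0}\<close> by auto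
qed simp

text \<open>The usual lattice for integral elements: products of powers below \<open>n\<close>,
  adjoining one member of \<open>Z\<close> at a time. Its stabiliser is automatically a ring, so
  sums and products of integral elements need no treatment of their own.\<close>

lemma lspan_closed_exists:
  assumes "finite Z" "n > 0"
    and "\<And>z. z \<in> Z \<Longrightarrow> \<exists>r. (\<forall>i<n. r i \<in> localint p) \<and> z ^ n = (\<Sum>i<n. r i * z ^ i)"
  shows "\<exists>E. finite E \<and> 1 \<in> E \<and> (\<forall>z\<in>Z. \<forall>x\<in>lspan p E. z * x \<in> lspan p E)"
  using assms(1,3)
proof (induction Z)
  case empty
  show ?case by (rule exI[of _ "{1}"]) auto
next
  case (insert z Z)
  then obtain E where E: "finite E" "1 \<in> E" "\<forall>w\<in>Z. \<forall>x\<in>lspan p E. w * x \<in> lspan p E" by auto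
  obtain r where r: "\<forall>i<n. r i \<in> localint p" "z ^ n = (\<Sum>i<n. r i * z ^ i)" using insert.prems by blast
  define F where "F = (\<lambda>(e, i). e * z ^ i) ` (E \<times> {..<n})"
  have F: "x * z ^ i \<in> lspan p F" if "x \<in> lspan p E" "i < n" for x i
  proof -
    have "z ^ i * x \<in> lspan p F"
      by (rule lspan_linear[OF _ that(1)], rule lspan_base)
         (use that(2) in \<open>auto simp: F_def image_iff mult.commute\<close>)
    then show ?thesis by (simp add: mult.commute)
  qed
  have "w * x \<in> lspan p F" if w: "w \<in> insert z Z" and x: "x \<in> lspan p F" for w x
  proof (rule lspan_linear[OF _ x])
    fix f assume "f \<in> F"
    then obtain e i where ei: "e \<in> E" "i < n" "f = e * z ^ i" unfolding F_def by auto
    show "w * f \<in> lspan p F"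
    proof (cases "w = z")
      case True
      show ?thesis
      proof (cases "Suc i = n")
        case True
        have "w * f = e * z ^ n" using \<open>w = z\<close> ei(3) True by auto
        also have "\<dots> = (\<Sum>i<n. r i * (e * z ^ i))" using r(2) by (simp add: sum_distrib_left mult_ac)
        also have "\<dots> \<in> lspan p F"
          by (rule lspan_sum, rule lspan_scale) (use F[OF lspan_base[OF ei(1)]] r(1) in auto)
        finally show ?thesis .
      next
        case False
        then have "e * z ^ Suc i \<in> lspan p F"
          using F[OF lspan_base[OF ei(1)], of "Suc i"] ei(2) by simp
        then show ?thesis using \<open>w = z\<close> ei(3) by (simp add: mult_ac)
      qed
    next
      case False
      then have "w * e \<in> lspan p E" using w E(3) lspan_base[OF ei(1)] by blast
      from F[OF this ei(2)] show ?thesis using ei(3) by (simp add: mult_ac)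
    qed
  qed
  moreover have "finite F" unfolding F_def using E(1) by simp
  moreover have "1 \<in> F" unfolding F_def using E(2) assms(2) by (auto intro!: image_eqI[of _ _ "(1, 0)"])
  ultimately show ?case by blast
qed

text \<open>Otherwise each generator, among them 1, would be \<open>p\<close> times an element of
  the lattice, against Nakayama's lemma.\<close>

lemma lspan_stabilizer_not_inverse:
  assumes "finite E" "1 \<in> E"
  shows "\<not> (\<forall>x\<in>lspan p E. 1 / of_nat p * x \<in> lspan p E)"
proof
  assume *: "\<forall>x\<in>lspan p E. 1 / of_nat p * x \<in> lspan p E"
  have "p \<noteq> 0" using p by auto
  then have "\<exists>y\<in>lspan p E. e = of_nat p * y" if "e \<in> E" for e
    using * lspan_base[OF that] by (intro bexI[of _ "1 / of_nat p * e"]) auto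
  then show False using lspan_nakayama[OF assms(1)] assms(2) by auto
qed

end

text \<open>All powers of \<open>b\<close> lie in a rational vector space of dimension at most
  \<open>card E\<close>; a linear dependence among \<open>card E + 1\<close> of them is the
  polynomial.\<close>

lemma lspan_algebraic:
  assumes E: "finite E" "1 \<in> E" and b: "\<forall>x\<in>lspan p E. b * x \<in> lspan p E" and p: "prime p"
  shows "\<exists>q. (\<forall>i. coeff q i \<in> \<rat>) \<and> q \<noteq> 0 \<and> poly q b = 0"
proof -
  interpret V: vector_space "\<lambda>(q :: rat) (x :: complex). of_rat q * x"
    by unfold_locales (simp_all add: algebra_simps of_rat_add of_rat_mult)
  have span: "lspan p E \<subseteq> V.span E"
  proof
    fix x assume "x \<in> lspan p E"
    then show "x \<in> V.span E"
    proof induction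
      case lspan_zero
      show ?case by (rule V.span_zero)
    next
      case (lspan_step e r x)
      then obtain a c where "r = of_int a / of_int c" unfolding localint_def by blast
      then have "r = of_rat (of_int a / of_int c)" by (simp add: of_rat_divide)
      then show ?case using lspan_step V.span_add V.span_scale V.span_base by metis
    qed
  qed
  have pow: "b ^ i \<in> lspan p E" for i
    using b lspan_base[OF p E(2)] by (induction i) auto
  define n where "n = card E"
  \<comment> \<open>Coinciding powers are treated apart, because linear dependence is a property of
    the set of powers, which would then be too small.\<close>
  show ?thesis
  proof (cases "inj_on (\<lambda>i. b ^ i) {..n}")
    case False
    then obtain i j where ij: "i \<noteq> j" "b ^ i = b ^ j" unfolding inj_on_def by auto
    have "monom 1 i - monom 1 j \<noteq> (0 :: complex poly)"
      using ij(1) by (auto simp: poly_eq_iff)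
    moreover have "\<forall>k. coeff (monom 1 i - monom 1 j :: complex poly) k \<in> \<rat>" by auto
    moreover have "poly (monom 1 i - monom 1 j) b = 0" using ij(2) by (simp add: poly_monom)
    ultimately show ?thesis by blast
  next
    case True
    define T where "T = (\<lambda>i. b ^ i) ` {..n}"
    have T: "finite T" "card T = Suc n" "T \<subseteq> V.span E"
      using card_image[OF True] pow span by (auto simp: T_def)
    then have "V.dependent T"
      using V.independent_span_bound[OF E(1), of T] n_def by fastforce
    then obtain u where u: "(\<Sum>v\<in>T. of_rat (u v) * v) = 0" "\<exists>v\<in>T. u v \<noteq> 0"
      using V.dependent_finite[OF T(1)] by auto
    define q where "q = (\<Sum>i\<le>n. monom (of_rat (u (b ^ i))) i :: complex poly)"
    have co: "coeff q i = (if i \<le> n then of_rat (u (b ^ i)) else 0)" for i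
      by (simp add: q_def coeff_sum)
    have "poly q b = (\<Sum>i\<le>n. of_rat (u (b ^ i)) * b ^ i)"
      by (simp add: q_def poly_sum poly_monom)
    also have "\<dots> = (\<Sum>v\<in>T. of_rat (u v) * v)"
      unfolding T_def by (subst sum.reindex[OF True]) simp
    finally have "poly q b = 0" using u(1) by simp
    moreover have "q \<noteq> 0"
    proof -
      obtain i where "i \<le> n" "u (b ^ i) \<noteq> 0" using u(2) by (auto simp: T_def)
      then have "coeff q i \<noteq> 0" by (simp add: co)
      then show ?thesis by auto
    qed
    moreover have "\<forall>i. coeff q i \<in> \<rat>" by (simp add: co)
    ultimately show ?thesis by blast
  qed
qed

section \<open>Integral rings with a prime ideal above \<open>p\<close>\<close>

text \<open>A ring \<open>B\<close>, integral over the integers localised at \<open>p\<close>, with a prime ideal \<open>m\<close> above \<open>p\<close>.\<close>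

locale integral_model =
  fixes p :: nat and B m :: "complex set"
  assumes prime: "prime p"
    and B_one: "1 \<in> B"
    and B_diff: "x \<in> B \<Longrightarrow> y \<in> B \<Longrightarrow> x - y \<in> B"
    and B_mult: "x \<in> B \<Longrightarrow> y \<in> B \<Longrightarrow> x * y \<in> B"
    and B_Rats: "x \<in> B \<Longrightarrow> x \<in> \<rat> \<Longrightarrow> x \<in> localint p"
    and B_algebraic: "x \<in> B \<Longrightarrow> \<exists>q. (\<forall>i. coeff q i \<in> \<rat>) \<and> q \<noteq> 0 \<and> poly q x = 0"
    and m_B: "m \<subseteq> B"
    and m_diff: "x \<in> m \<Longrightarrow> y \<in> m \<Longrightarrow> x - y \<in> m"
    and m_ideal: "x \<in> m \<Longrightarrow> y \<in> B \<Longrightarrow> x * y \<in> m"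
    and m_prime: "x \<in> B \<Longrightarrow> y \<in> B \<Longrightarrow> x * y \<in> m \<Longrightarrow> x \<in> m \<or> y \<in> m"
    and m_p: "of_nat p \<in> m"
    and m_one: "1 \<notin> m"

text \<open>\<open>B\<close> is the stabiliser of a lattice that is stable under \<open>Z\<close>. A
  maximal ideal above \<open>p\<close> comes from Zorn's lemma, starting with \<open>p B\<close>,
  which is proper because \<open>1 / p\<close> does not stabilise the lattice.\<close>

lemma integral_model_exists:
  assumes p: "prime p" and "finite Z" "n > 0"
    and "\<And>z. z \<in> Z \<Longrightarrow> \<exists>r. (\<forall>i<n. r i \<in> localint p) \<and> z ^ n = (\<Sum>i<n. r i * z ^ i)"
  shows "\<exists>B m. Z \<subseteq> B \<and> integral_model p B m"
proof -
  obtain E where E: "finite E" "1 \<in> E" "\<forall>z\<in>Z. \<forall>x\<in>lspan p E. z * x \<in> lspan p E"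
    using lspan_closed_exists[OF assms] by blast
  define B where "B = {b. \<forall>x\<in>lspan p E. b * x \<in> lspan p E}"
  have B1: "1 \<in> B" by (simp add: B_def)
  have Bm: "x * y \<in> B" if "x \<in> B" "y \<in> B" for x y using that by (simp add: B_def mult.assoc)
  have Ba: "x + y \<in> B" if "x \<in> B" "y \<in> B" for x y
    using that by (simp add: B_def distrib_right lspan_add[OF p])
  have BR: "localint p \<subseteq> B" by (auto simp: B_def lspan_scale[OF p])
  have Bd: "x - y \<in> B" if "x \<in> B" "y \<in> B" for x y
    using Ba[OF that(1) Bm[OF _ that(2)], of "-1"] BR localint_of_int[OF p, of "-1"] by auto
  have p0: "p \<noteq> 0" using p by auto
  have ninv: "1 / of_nat p \<notin> B"
    using lspan_stabilizer_not_inverse[OF p E(1,2)] by (simp add: B_def)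
  \<comment> \<open>If \<open>p\<close> divided the reduced denominator, Bezout would express
    \<open>1 / p\<close> through \<open>x\<close> and integers and put it into
    \<open>B\<close>.\<close>
  have BQ: "x \<in> localint p" if "x \<in> B" "x \<in> \<rat>" for x
  proof (rule ccontr)
    assume nx: "x \<notin> localint p"
    from \<open>x \<in> \<rat>\<close> obtain a b where ab: "b > 0" "coprime a b" "x = of_int a / of_int b"
      by (rule Rats_cases')
    then have "int p dvd b" using nx unfolding localint_def by blast
    then obtain b' where b': "b = int p * b'" by auto
    have "\<not> int p dvd a" using \<open>int p dvd b\<close> ab(2) prime_int_p[OF p] not_coprimeI not_prime_unit by blast
    then have "coprime a (int p)" using prime_int_p[OF p] prime_imp_coprime coprime_commute by blast
    then obtain u v where uv: "u * a + v * int p = 1"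
      by (metis bezout_int coprime_iff_gcd_eq_1)
    have "b' \<noteq> 0" using ab(1) b' by auto
    then have "of_int u * of_int b' * x + of_int v = (of_int (u * a + v * int p) :: complex) / of_nat p"
      using ab(3) b' p0 by (simp add: field_simps)
    also have "\<dots> = 1 / of_nat p" unfolding uv by simp
    finally have "1 / of_nat p \<in> B"
      using Ba Bm \<open>x \<in> B\<close> BR localint_of_int[OF p] by (metis subsetD)
    then show False using ninv by simp
  qed
  define ideals where "ideals = {I. I \<subseteq> B \<and> (\<forall>x\<in>I. \<forall>y\<in>I. x - y \<in> I) \<and> (\<forall>x\<in>I. \<forall>y\<in>B. x * y \<in> I) \<and> of_nat p \<in> I \<and> 1 \<notin> I}"
  have pB: "of_nat p \<in> B" using BR localint_of_int[OF p, of "int p"] by auto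
  have "\<exists>M\<in>ideals. \<forall>X\<in>ideals. M \<subseteq> X \<longrightarrow> X = M"
  proof (rule subset_Zorn_nonempty)
    have "(\<lambda>x. of_nat p * x) ` B \<in> ideals"
      unfolding ideals_def mem_Collect_eq
    proof (intro conjI ballI)
      show "1 \<notin> (\<lambda>x. of_nat p * x) ` B"
      proof
        assume "1 \<in> (\<lambda>x. of_nat p * x) ` B"
        then obtain x where "x \<in> B" "1 = of_nat p * x" by blast
        then have "x = 1 / of_nat p" using p0 by (simp add: field_simps)
        then show False using ninv \<open>x \<in> B\<close> by simp
      qed
      show "(\<lambda>x. of_nat p * x) ` B \<subseteq> B" using pB Bm by blast
      show "of_nat p \<in> (\<lambda>x. of_nat p * x) ` B" using B1 by force
    next
      fix x y assume "x \<in> (\<lambda>x. of_nat p * x) ` B" "y \<in> (\<lambda>x. of_nat p * x) ` B"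
      then show "x - y \<in> (\<lambda>x. of_nat p * x) ` B"
        using Bd by (auto simp: right_diff_distrib[symmetric])
    next
      fix x y assume "x \<in> (\<lambda>x. of_nat p * x) ` B" "y \<in> B"
      then show "x * y \<in> (\<lambda>x. of_nat p * x) ` B"
        using Bm by (auto simp: mult.assoc)
    qed
    then show "ideals \<noteq> {}" by blast
  next
    fix C assume C: "C \<noteq> {}" "subset.chain ideals C"
    have two: "\<exists>I\<in>C. u \<in> I \<and> v \<in> I" if "u \<in> \<Union>C" "v \<in> \<Union>C" for u v
      using that C(2) unfolding subset.chain_def by blast
    have CA: "I \<in> ideals" if "I \<in> C" for I using that C(2) by (auto simp: subset.chain_def)
    show "\<Union>C \<in> ideals"
      unfolding ideals_def mem_Collect_eq
    proof (intro conjI ballI)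
      fix x y assume "x \<in> \<Union>C" "y \<in> \<Union>C"
      then obtain I where "I \<in> C" "x \<in> I" "y \<in> I" using two by blast
      then show "x - y \<in> \<Union>C" using CA[of I] by (auto simp: ideals_def)
    next
      fix x y assume "x \<in> \<Union>C" "y \<in> B"
      then obtain I where I: "I \<in> C" "x \<in> I" by blast
      then have "x * y \<in> I" using CA[of I] \<open>y \<in> B\<close> by (auto simp: ideals_def)
      then show "x * y \<in> \<Union>C" using I(1) by blast
    next
      show "\<Union>C \<subseteq> B" using CA unfolding ideals_def by blast
      show "of_nat p \<in> \<Union>C" using CA C(1) unfolding ideals_def by blast
      show "1 \<notin> \<Union>C" using CA unfolding ideals_def by blast
    qed
  qed
  then obtain m where m: "m \<in> ideals" and max: "\<And>X. X \<in> ideals \<Longrightarrow> m \<subseteq> X \<Longrightarrow> X = m" by blast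
  have mB: "m \<subseteq> B" and md: "\<And>x y. x \<in> m \<Longrightarrow> y \<in> m \<Longrightarrow> x - y \<in> m"
    and mi: "\<And>x y. x \<in> m \<Longrightarrow> y \<in> B \<Longrightarrow> x * y \<in> m" and mp: "of_nat p \<in> m" and m1: "1 \<notin> m"
    using m by (auto simp: ideals_def)
  have mult_m: "x + y \<in> m" if "x \<in> m" "y \<in> m" for x y
    using md[OF that(1) mi[OF that(2), of "-1"]] BR localint_of_int[OF p, of "-1"] by auto
  have mprime: "x \<in> m \<or> y \<in> m" if xy: "x \<in> B" "y \<in> B" "x * y \<in> m" for x y
  proof (rule ccontr)
    assume "\<not> (x \<in> m \<or> y \<in> m)"
    then have nx: "x \<notin> m" and ny: "y \<notin> m" by auto
    \<comment> \<open>The ideal \<open>m + x B\<close>, which contains 1 by maximality of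
      \<open>m\<close>; multiplying \<open>1 = a + x b\<close> by \<open>y\<close> puts
      \<open>y\<close> into \<open>m\<close>.\<close>
    define J where "J = {a + x * b | a b. a \<in> m \<and> b \<in> B}"
    have z: "0 \<in> m" using md[OF mp mp] by simp
    have zB: "0 \<in> B" using z mB by auto
    have "m \<subseteq> J" using zB unfolding J_def by force
    moreover have "x \<in> J" using z B1 unfolding J_def by force
    ultimately have "J \<notin> ideals" using max nx by blast
    moreover have "J \<subseteq> B" using mB Ba Bm xy(1) unfolding J_def by blast
    moreover have "of_nat p \<in> J" using \<open>m \<subseteq> J\<close> mp by blast
    moreover have "u - v \<in> J" if uv: "u \<in> J" "v \<in> J" for u v
    proof -
      obtain a b where 1: "u = a + x * b" "a \<in> m" "b \<in> B"
        using uv(1) unfolding J_def by blast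
      obtain a' b' where 2: "v = a' + x * b'" "a' \<in> m" "b' \<in> B"
        using uv(2) unfolding J_def by blast
      note * = 1 2
      have "u - v = (a - a') + x * (b - b')" using * by (simp add: algebra_simps)
      then show ?thesis unfolding J_def using * md Bd by blast
    qed
    moreover have "u * v \<in> J" if uv: "u \<in> J" "v \<in> B" for u v
    proof -
      obtain a b where *: "u = a + x * b" "a \<in> m" "b \<in> B" using uv(1) unfolding J_def by blast
      have "u * v = a * v + x * (b * v)" using * by (simp add: algebra_simps)
      then show ?thesis unfolding J_def using * mi Bm uv(2) by blast
    qed
    ultimately have "1 \<in> J" unfolding ideals_def by blast
    then obtain a b where ab: "1 = a + x * b" "a \<in> m" "b \<in> B" unfolding J_def by blast
    have "y = y * (a + x * b)" using ab(1) by simp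
    also have "\<dots> = a * y + (x * y) * b" by (simp add: algebra_simps)
    also have "\<dots> \<in> m" using mult_m mi ab xy by blast
    finally show False using ny by simp
  qed
  have "integral_model p B m"
  proof
    show "\<And>x. x \<in> B \<Longrightarrow> \<exists>q. (\<forall>i. coeff q i \<in> \<rat>) \<and> q \<noteq> 0 \<and> poly q x = 0"
      using lspan_algebraic[OF E(1,2) _ p] by (simp add: B_def)
  qed (use p B1 Bd Bm BQ mB md mi mprime mp m1 in auto)
  moreover have "Z \<subseteq> B" using E(3) by (auto simp: B_def)
  ultimately show ?thesis by blast
qed


section \<open>Frobenius on residues\<close>

context integral_model
begin

lemma B_zero: "0 \<in> B"
  using B_diff[OF B_one B_one] by simp

lemma B_uminus: "x \<in> B \<Longrightarrow> - x \<in> B"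
  using B_diff[OF B_zero] by fastforce

lemma B_add: "x \<in> B \<Longrightarrow> y \<in> B \<Longrightarrow> x + y \<in> B"
  using B_diff[OF _ B_uminus, of x y] by simp

lemma B_power: "x \<in> B \<Longrightarrow> x ^ n \<in> B"
  by (induction n) (auto intro: B_one B_mult)

lemma B_of_nat: "of_nat n \<in> B"
  by (induction n) (auto intro: B_one B_zero B_add)

lemma B_of_int: "of_int n \<in> B"
  by (cases n rule: int_cases2) (use B_of_nat B_uminus[OF B_of_nat] in simp_all)

lemma B_sum: "(\<And>i. i \<in> I \<Longrightarrow> f i \<in> B) \<Longrightarrow> sum f I \<in> B"
  by (induction I rule: infinite_finite_induct) (auto intro: B_zero B_add)

lemma m_zero: "0 \<in> m"
  using m_diff[OF m_p m_p] by simp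

lemma m_uminus: "x \<in> m \<Longrightarrow> - x \<in> m"
  using m_diff[OF m_zero] by fastforce

lemma m_add: "x \<in> m \<Longrightarrow> y \<in> m \<Longrightarrow> x + y \<in> m"
  using m_diff[OF _ m_uminus, of x y] by simp

lemma m_ideal': "x \<in> m \<Longrightarrow> y \<in> B \<Longrightarrow> y * x \<in> m"
  using m_ideal[of x y] by (simp add: mult.commute)

lemma m_sum: "(\<And>i. i \<in> I \<Longrightarrow> f i \<in> m) \<Longrightarrow> sum f I \<in> m"
  by (induction I rule: infinite_finite_induct) (auto intro: m_zero m_add)

lemma m_power: "x \<in> B \<Longrightarrow> x ^ n \<in> m \<Longrightarrow> x \<in> m"
  by (induction n) (use m_one m_prime B_power in auto)

lemma m_prod: "finite I \<Longrightarrow> (\<And>i. i \<in> I \<Longrightarrow> f i \<in> B) \<Longrightarrow> prod f I \<in> m \<Longrightarrow> \<exists>i\<in>I. f i \<in> m"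
proof (induction I rule: finite_induct)
  case empty
  then show ?case using m_one by simp
next
  case (insert i I)
  have "prod f I \<in> B"
    using insert.hyps(1) insert.prems(1) by (induction I rule: finite_induct) (auto intro: B_one B_mult)
  then show ?case using m_prime[of "f i" "prod f I"] insert by auto
qed

text \<open>Equality in \<open>B / m\<close>, a domain of characteristic \<open>p\<close>, kept as a
  relation on complex numbers.\<close>

definition mcong :: "complex \<Rightarrow> complex \<Rightarrow> bool" (infix "\<simeq>" 50) where
  "x \<simeq> y \<longleftrightarrow> x - y \<in> m"

lemma mcong_refl: "x \<simeq> x"
  by (simp add: mcong_def m_zero)

lemma mcong_sym: "x \<simeq> y \<Longrightarrow> y \<simeq> x"
  using m_uminus[of "x - y"] by (simp add: mcong_def)

lemma mcong_trans [trans]: "x \<simeq> y \<Longrightarrow> y \<simeq> z \<Longrightarrow> x \<simeq> z"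
  using m_add[of "x - y" "y - z"] by (simp add: mcong_def)

lemma mcong_add: "x \<simeq> y \<Longrightarrow> z \<simeq> w \<Longrightarrow> x + z \<simeq> y + w"
  using m_add[of "x - y" "z - w"] by (simp add: mcong_def algebra_simps)

lemma mcong_diff: "x \<simeq> y \<Longrightarrow> z \<simeq> w \<Longrightarrow> x - z \<simeq> y - w"
  using m_diff[of "x - y" "z - w"] by (simp add: mcong_def algebra_simps)

lemma mcong_mult: "x \<simeq> y \<Longrightarrow> z \<simeq> w \<Longrightarrow> x \<in> B \<Longrightarrow> w \<in> B \<Longrightarrow> x * z \<simeq> y * w"
  using m_add[OF m_ideal'[of "z - w" x] m_ideal[of "x - y" w]] by (simp add: mcong_def algebra_simps)

lemma mcong_power: "x \<simeq> y \<Longrightarrow> x \<in> B \<Longrightarrow> y \<in> B \<Longrightarrow> x ^ n \<simeq> y ^ n"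
  by (induction n) (auto intro: mcong_refl mcong_mult B_power)

lemma mcong_sum: "(\<And>i. i \<in> I \<Longrightarrow> f i \<simeq> g i) \<Longrightarrow> sum f I \<simeq> sum g I"
  using m_sum[of I "\<lambda>i. f i - g i"] by (simp add: mcong_def sum_subtractf)

lemma frobenius_add:
  assumes "x \<in> B" "y \<in> B"
  shows "(x + y) ^ p \<simeq> x ^ p + y ^ p"
proof -
  have p0: "p > 0" using prime by (rule prime_gt_0_nat)
  have "(x + y) ^ p = (\<Sum>k\<le>p. of_nat (p choose k) * x ^ k * y ^ (p - k))" by (rule binomial_ring)
  also have "{..p} = insert 0 (insert p {1..<p})" using p0 by auto
  also have "(\<Sum>k\<in>\<dots>. of_nat (p choose k) * x ^ k * y ^ (p - k)) =
      (x ^ p + y ^ p) + (\<Sum>k=1..<p. of_nat (p choose k) * x ^ k * y ^ (p - k))"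
    using p0 by simp
  finally have "(x + y) ^ p - (x ^ p + y ^ p) = (\<Sum>k=1..<p. of_nat (p choose k) * x ^ k * y ^ (p - k))"
    by simp
  also have "\<dots> \<in> m"
  proof (rule m_sum)
    fix k assume "k \<in> {1..<p}"
    then have "p dvd p choose k" using prime by (intro dvd_choose_prime) auto
    then obtain c where "p choose k = p * c" by auto
    then have eq: "of_nat (p choose k) * x ^ k * y ^ (p - k) = of_nat p * (of_nat c * x ^ k * y ^ (p - k))"
      by simp
    show "of_nat (p choose k) * x ^ k * y ^ (p - k) \<in> m"
      unfolding eq using assms by (intro m_ideal[OF m_p] B_mult B_of_nat B_power)
  qed
  finally show ?thesis by (simp add: mcong_def)
qed

lemma frobenius_pow_add:
  assumes "x \<in> B" "y \<in> B"
  shows "(x + y) ^ (p ^ k) \<simeq> x ^ (p ^ k) + y ^ (p ^ k)"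
proof (induction k)
  case (Suc k)
  have "((x + y) ^ (p ^ k)) ^ p \<simeq> (x ^ (p ^ k) + y ^ (p ^ k)) ^ p"
    using mcong_power[OF Suc.IH, of p] assms B_power B_add by blast
  also have "\<dots> \<simeq> (x ^ (p ^ k)) ^ p + (y ^ (p ^ k)) ^ p"
    using frobenius_add assms B_power by blast
  finally show ?case by (simp add: power_mult[symmetric] mult.commute)
qed (simp add: mcong_refl)

lemma frobenius_pow_diff:
  assumes "x \<in> B" "y \<in> B"
  shows "(x - y) ^ (p ^ k) \<simeq> x ^ (p ^ k) - y ^ (p ^ k)"
  using mcong_diff[OF frobenius_pow_add[OF B_diff[OF assms] assms(2), of k] mcong_refl[of "y ^ (p ^ k)"]]
  by (simp add: mcong_sym)

lemma frobenius_pow_sum: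
  assumes "finite I" "\<And>i. i \<in> I \<Longrightarrow> f i \<in> B"
  shows "(\<Sum>i\<in>I. f i) ^ (p ^ k) \<simeq> (\<Sum>i\<in>I. f i ^ (p ^ k))"
  using assms
proof (induction I rule: finite_induct)
  case empty
  then show ?case using prime_gt_0_nat[OF prime] by (simp add: power_0_left mcong_refl)
next
  case (insert i I)
  have "(f i + sum f I) ^ (p ^ k) \<simeq> f i ^ (p ^ k) + sum f I ^ (p ^ k)"
    using frobenius_pow_add insert.prems B_sum[of I f] by simp
  also have "\<dots> \<simeq> f i ^ (p ^ k) + (\<Sum>i\<in>I. f i ^ (p ^ k))"
    using insert by (intro mcong_add mcong_refl) simp
  finally show ?case using insert.hyps by simp
qed

lemma frobenius_pow_inj:
  assumes "x \<in> B" "y \<in> B" "x ^ (p ^ k) \<simeq> y ^ (p ^ k)"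
  shows "x \<simeq> y"
proof -
  have "(x - y) ^ (p ^ k) \<simeq> x ^ (p ^ k) - y ^ (p ^ k)" using frobenius_pow_diff assms by blast
  also have "\<dots> \<simeq> 0" using assms(3) by (simp add: mcong_def)
  finally have "(x - y) ^ (p ^ k) \<in> m" by (simp add: mcong_def)
  then show ?thesis using m_power B_diff assms(1,2) unfolding mcong_def by blast
qed

lemma fermat_of_nat: "of_nat n ^ p \<simeq> of_nat n"
proof (induction n)
  case 0
  then show ?case using prime_gt_0_nat[OF prime] by (simp add: power_0_left mcong_refl)
next
  case (Suc n)
  have "(1 + of_nat n) ^ p \<simeq> 1 ^ p + of_nat n ^ p" using frobenius_add B_one B_of_nat by blast
  also have "\<dots> \<simeq> 1 + of_nat n" using mcong_add[OF mcong_refl[of 1] Suc.IH] by simp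
  finally show ?case by simp
qed

lemma fermat_of_int: "of_int a ^ p \<simeq> of_int a"
proof (cases a rule: int_cases2)
  case (nonneg n)
  then show ?thesis using fermat_of_nat by simp
next
  case (nonpos n)
  have "(0 - of_nat n) ^ p \<simeq> 0 ^ p - of_nat n ^ p"
    using frobenius_pow_diff[OF B_zero B_of_nat, of n 1] by simp
  also have "\<dots> \<simeq> 0 - of_nat n"
    using mcong_diff[OF mcong_refl[of 0] fermat_of_nat] prime_gt_0_nat[OF prime] by (simp add: power_0_left)
  finally show ?thesis using nonpos by simp
qed

lemma of_int_m_iff: "of_int a \<in> m \<longleftrightarrow> int p dvd a"
proof
  assume a: "of_int a \<in> m"
  show "int p dvd a"
  proof (rule ccontr)
    assume "\<not> int p dvd a"
    then have "coprime a (int p)" using prime_int_p[OF prime] prime_imp_coprime coprime_commute by blast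
    then obtain u v where uv: "u * a + v * int p = 1"
      by (metis bezout_int coprime_iff_gcd_eq_1)
    have "of_int (u * a + v * int p) \<in> m"
      using m_add[OF m_ideal'[OF a B_of_int[of u]] m_ideal'[OF m_p B_of_int[of v]]] by simp
    then show False using m_one unfolding uv by simp
  qed
next
  assume "int p dvd a"
  then obtain c where "a = int p * c" by auto
  then show "of_int a \<in> m" using m_ideal[OF m_p B_of_int[of c]] by simp
qed

text \<open>Fermat for numerator and denominator; the denominator is outside the prime ideal
  \<open>m\<close> and cancels.\<close>

lemma fermat_rat:
  assumes "x \<in> B" "x \<in> \<rat>"
  shows "x ^ p \<simeq> x"
proof -
  obtain a b where ab: "x = of_int a / of_int b" "\<not> int p dvd b"
    using B_Rats[OF assms] unfolding localint_def by blast
  have "b \<noteq> 0" using ab(2) by auto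
  then have bx: "of_int b * x = of_int a" using ab(1) by simp
  have "of_int b * x ^ p \<simeq> of_int b ^ p * x ^ p"
    using mcong_mult[OF mcong_sym[OF fermat_of_int] mcong_refl] B_of_int B_power assms(1) by blast
  also have "of_int b ^ p * x ^ p = of_int a ^ p" by (simp add: power_mult_distrib[symmetric] bx)
  also have "\<dots> \<simeq> of_int b * x" using fermat_of_int bx by simp
  finally have "of_int b * (x ^ p - x) \<in> m" by (simp add: mcong_def right_diff_distrib)
  then show ?thesis
    using m_prime[of "of_int b" "x ^ p - x"] ab(2) of_int_m_iff B_of_int assms(1) B_diff B_power
    unfolding mcong_def by blast
qed

text \<open>With \<open>q = p ^ k\<close> and \<open>P\<close> the polynomial of \<open>T\<close>,
  additivity of \<open>q\<close>-th powers and the fixed coefficients give that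
  \<open>P(d ^ q)\<close> is congruent to \<open>P(d) ^ q = 0\<close>. As \<open>m\<close> is prime,
  one linear factor of \<open>P(d ^ q)\<close> lies in \<open>m\<close>.\<close>

lemma frobenius_roots:
  assumes T: "finite T" "T \<subseteq> B"
    and fixed: "\<And>i. coeff (\<Prod>d\<in>T. [:- d, 1:]) i \<in> B"
      "\<And>i. coeff (\<Prod>d\<in>T. [:- d, 1:]) i ^ (p ^ k) \<simeq> coeff (\<Prod>d\<in>T. [:- d, 1:]) i"
    and d: "d \<in> T"
  shows "\<exists>d'\<in>T. d ^ (p ^ k) \<simeq> d'"
proof -
  define P where "P = (\<Prod>d\<in>T. [:- d, 1:])"
  define q where "q = p ^ k"
  have q0: "q > 0" unfolding q_def using prime_gt_0_nat[OF prime] by simp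
  have dB: "d \<in> B" using d T(2) by blast
  have "poly P d = 0" unfolding P_def poly_prod using T(1) d by (auto intro!: prod_zero bexI[of _ d])
  have "(\<Sum>i\<le>degree P. coeff P i * d ^ i) ^ q \<simeq> (\<Sum>i\<le>degree P. (coeff P i * d ^ i) ^ q)"
    unfolding q_def by (rule frobenius_pow_sum) (use fixed(1) dB B_mult B_power in \<open>auto simp: P_def\<close>)
  also have "\<dots> = (\<Sum>i\<le>degree P. coeff P i ^ q * (d ^ q) ^ i)"
    by (simp add: power_mult_distrib power_mult[symmetric] mult.commute)
  also have "\<dots> \<simeq> (\<Sum>i\<le>degree P. coeff P i * (d ^ q) ^ i)"
  proof (rule mcong_sum, rule mcong_mult[OF _ mcong_refl])
    fix i
    show "coeff P i ^ q \<simeq> coeff P i" unfolding q_def P_def by (rule fixed(2))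
    show "coeff P i ^ q \<in> B" unfolding P_def by (rule B_power, rule fixed(1))
    show "(d ^ q) ^ i \<in> B" using dB B_power by blast
  qed
  also have "\<dots> = poly P (d ^ q)" by (simp add: poly_altdef)
  also have "(\<Sum>i\<le>degree P. coeff P i * d ^ i) = 0" using \<open>poly P d = 0\<close> by (simp add: poly_altdef)
  finally have "poly P (d ^ q) \<in> m" using q0 mcong_sym by (fastforce simp: mcong_def power_0_left dest: m_uminus)
  then have "(\<Prod>e\<in>T. d ^ q - e) \<in> m" by (simp add: P_def poly_prod)
  then have "\<exists>e\<in>T. d ^ q - e \<in> m"
    using T dB by (intro m_prod) (auto intro: B_diff B_power)
  then show ?thesis by (simp add: mcong_def q_def)
qed

lemma frobenius_pow_mult:
  assumes "x \<in> B" "x ^ (p ^ a) \<simeq> x"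
  shows "x ^ (p ^ (a * n)) \<simeq> x"
proof (induction n)
  case (Suc n)
  have "(x ^ (p ^ a)) ^ (p ^ (a * n)) \<simeq> x ^ (p ^ (a * n))"
    using assms B_power by (intro mcong_power) auto
  also note Suc.IH
  finally show ?case by (simp add: power_mult[symmetric] power_add)
qed (simp add: mcong_refl)

text \<open>Among the iterates 0 to \<open>n\<close> of a self-map of at most \<open>n\<close>
  points two agree, say \<open>i < j\<close>. Injectivity of Frobenius cancels the first
  \<open>i\<close> steps, and the period \<open>j - i\<close> is at most \<open>n\<close>, so it
  divides \<open>n!\<close>.\<close>

lemma frobenius_period:
  assumes T: "finite T" "T \<subseteq> B" "card T \<le> n"
    and step: "\<And>d. d \<in> T \<Longrightarrow> \<exists>d'\<in>T. d ^ p \<simeq> d'" and d: "d \<in> T"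
  shows "d ^ (p ^ fact n) \<simeq> d"
proof -
  obtain g where g: "\<And>d. d \<in> T \<Longrightarrow> g d \<in> T \<and> d ^ p \<simeq> g d" using step by metis
  have it: "(g ^^ i) d \<in> T \<and> d ^ (p ^ i) \<simeq> (g ^^ i) d" for i
  proof (induction i)
    case (Suc i)
    have "(d ^ (p ^ i)) ^ p \<simeq> (g ^^ i) d ^ p"
      using Suc T(2) d B_power by (intro mcong_power) auto
    also have "\<dots> \<simeq> g ((g ^^ i) d)" using g Suc by blast
    finally show ?case using g Suc by (simp add: power_mult[symmetric] mult.commute)
  qed (simp add: d mcong_refl)
  have "\<not> inj_on (\<lambda>i. (g ^^ i) d) {..n}"
  proof
    assume "inj_on (\<lambda>i. (g ^^ i) d) {..n}"
    then have "card {..n} \<le> card T" using it T(1) by (intro card_inj_on_le) auto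
    then show False using T(3) by simp
  qed
  then obtain i j where ij: "i < j" "j \<le> n" "(g ^^ i) d = (g ^^ j) d"
    unfolding inj_on_def by (metis atMost_iff linorder_neqE_nat)
  have dB: "d \<in> B" using d T(2) by blast
  have "d ^ (p ^ i) \<simeq> d ^ (p ^ j)" using it[of i] it[of j] ij(3) mcong_sym mcong_trans by metis
  also have "d ^ (p ^ j) = (d ^ (p ^ (j - i))) ^ (p ^ i)"
    using ij(1) by (simp add: power_mult[symmetric] power_add[symmetric])
  finally have "d \<simeq> d ^ (p ^ (j - i))" using frobenius_pow_inj dB B_power by blast
  moreover have "j - i dvd fact n" using ij by (intro dvd_fact) auto
  ultimately show ?thesis using frobenius_pow_mult[OF dB mcong_sym] by (metis dvd_def)
qed

end

section \<open>Galois-stable sets under Frobenius\<close>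

lemma Gal_coeff_prod:
  assumes "\<sigma> \<in> Gal" "finite T" "T \<subseteq> Qbar"
  shows "coeff (\<Prod>d\<in>T. [:- d, 1:]) i \<in> Qbar"
    and "coeff (\<Prod>d\<in>\<sigma> ` T. [:- d, 1:]) i = \<sigma> (coeff (\<Prod>d\<in>T. [:- d, 1:]) i)"
proof -
  define S where "S = {(x, \<sigma> x) | x. x \<in> Qbar}"
  have S: "part_iso S" unfolding S_def by (rule Gal_graph_part_iso[OF assms(1)])
  have "inj_on \<sigma> T" using Gal_eq_iff[OF assms(1)] by (auto intro: inj_onI)
  have "pol_rel S (\<Prod>d\<in>T. [:- d, 1:]) (\<Prod>d\<in>T. [:- \<sigma> d, 1:])"
  proof (rule pol_rel_prod[OF S])
    fix d assume "d \<in> T"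
    then have "d \<in> Qbar" using assms(3) by blast
    then have "(- d, - \<sigma> d) \<in> S"
      using Qbar_uminus[of d] Gal_uminus[OF assms(1), of d] unfolding S_def by force
    then show "pol_rel S [:- d, 1:] [:- \<sigma> d, 1:]"
      by (intro pol_rel_pCons[OF S] pol_rel_0[OF S] part_iso_one[OF S])
  qed
  also have "(\<Prod>d\<in>T. [:- \<sigma> d, 1:]) = (\<Prod>d\<in>\<sigma> ` T. [:- d, 1:])"
    by (simp add: prod.reindex[OF \<open>inj_on \<sigma> T\<close>])
  finally show "coeff (\<Prod>d\<in>T. [:- d, 1:]) i \<in> Qbar"
    "coeff (\<Prod>d\<in>\<sigma> ` T. [:- d, 1:]) i = \<sigma> (coeff (\<Prod>d\<in>T. [:- d, 1:]) i)"
    unfolding pol_rel_def S_def by auto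
qed

context integral_model
begin

lemma B_coeff_prod: "finite T \<Longrightarrow> T \<subseteq> B \<Longrightarrow> coeff (\<Prod>d\<in>T. [:- d, 1:]) i \<in> B"
proof (induction T arbitrary: i rule: finite_induct)
  case empty
  then show ?case by (simp add: coeff_pCons one_pCons B_one B_zero split: nat.splits)
next
  case (insert d T)
  have "coeff [:- d, 1:] j \<in> B" for j
    using insert.prems by (auto simp: coeff_pCons B_one B_zero B_uminus split: nat.splits)
  moreover have "coeff (\<Prod>d\<in>T. [:- d, 1:]) j \<in> B" for j
    using insert by simp
  moreover have "(\<Prod>d\<in>insert d T. [:- d, 1:]) = [:- d, 1:] * (\<Prod>d\<in>T. [:- d, 1:])"
    using insert.hyps by simp
  ultimately show ?case
    unfolding coeff_mult by (simp only: coeff_mult) (intro B_sum B_mult)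
qed

text \<open>The polynomial of a \<open>Gal\<close>-stable set has rational coefficients, whose
  residues Frobenius fixes by Fermat.\<close>

lemma Gal_invariant_frobenius:
  assumes T: "finite T" "T \<subseteq> B" "T \<subseteq> Qbar" "\<And>\<sigma>. \<sigma> \<in> Gal \<Longrightarrow> \<sigma> ` T \<subseteq> T" and d: "d \<in> T"
  shows "\<exists>d'\<in>T. d ^ p \<simeq> d'"
proof -
  have "coeff (\<Prod>d\<in>T. [:- d, 1:]) i \<in> \<rat>" for i
  proof -
    obtain q where "\<forall>i. coeff q i \<in> \<rat>" "q \<noteq> 0" "poly q (coeff (\<Prod>d\<in>T. [:- d, 1:]) i) = 0"
      using B_algebraic[OF B_coeff_prod[OF T(1,2)]] by blast
    then show ?thesis
    proof (rule Gal_fixed_Rats)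
      fix \<sigma> assume \<sigma>: "\<sigma> \<in> Gal"
      have "inj_on \<sigma> T" using Gal_eq_iff[OF \<sigma>] by (auto intro: inj_onI)
      then have "\<sigma> ` T = T" using endo_inj_surj T(1) T(4)[OF \<sigma>] by blast
      then show "\<sigma> (coeff (\<Prod>d\<in>T. [:- d, 1:]) i) = coeff (\<Prod>d\<in>T. [:- d, 1:]) i"
        using Gal_coeff_prod(2)[OF \<sigma> T(1,3), of i] by simp
    qed
  qed
  then have "coeff (\<Prod>d\<in>T. [:- d, 1:]) i ^ p \<simeq> coeff (\<Prod>d\<in>T. [:- d, 1:]) i" for i
    using fermat_rat B_coeff_prod[OF T(1,2)] by blast
  then show ?thesis
    using frobenius_roots[OF T(1,2) B_coeff_prod[OF T(1,2)], of 1 d] d by simp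
qed

text \<open>Since \<open>a u - b v = 1\<close>, triviality of the \<open>a\<close>-th and
  \<open>b\<close>-th iterates of Frobenius at \<open>x\<close> forces that of Frobenius
  itself.\<close>

lemma frobenius_combine:
  assumes "x \<in> B" "x ^ (p ^ a) \<simeq> x" "a * u = b * v + 1" "x ^ (p ^ b) \<simeq> x"
  shows "x ^ p \<simeq> x"
proof -
  have "(x ^ (p ^ (b * v))) ^ p \<simeq> x ^ p"
    using frobenius_pow_mult[OF assms(1,4)] assms(1) by (intro mcong_power B_power)
  also have "(x ^ (p ^ (b * v))) ^ p = x ^ (p ^ (a * u))"
    unfolding assms(3) by (simp add: power_mult[symmetric] mult.commute)
  finally show ?thesis
    using frobenius_pow_mult[OF assms(1,2), of u] mcong_sym mcong_trans by blast
qed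

end

section \<open>Primitivity and solvability\<close>

text \<open>What the reduction has to supply: Frobenius cycles on the residues of \<open>Z\<close>
  have length 1 or 13, and at most one root has a fixed residue.\<close>

locale frobenius_13 = integral_model +
  fixes Z :: "complex set"
  assumes Z_finite: "finite Z" and Z_card: "card Z = 14" and Z_B: "Z \<subseteq> B" and Z_Qbar: "Z \<subseteq> Qbar"
    and Z_Gal: "\<sigma> \<in> Gal \<Longrightarrow> z \<in> Z \<Longrightarrow> \<sigma> z \<in> Z"
    and Z_Rats: "z \<in> Z \<Longrightarrow> z \<notin> \<rat>"
    and Z_13: "z \<in> Z \<Longrightarrow> z ^ (p ^ 13) \<simeq> z"
    and Z_fixed: "z \<in> Z \<Longrightarrow> w \<in> Z \<Longrightarrow> z ^ p \<simeq> z \<Longrightarrow> w ^ p \<simeq> w \<Longrightarrow> z = w"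
begin

text \<open>A Bezout certificate for the coprimality of 7! and 13.\<close>

lemma fact_7_13: "fact 7 * 3 = 13 * 1163 + (1 :: nat)"
  by (simp add: fact_numeral)

text \<open>At each element of \<open>T\<close> both the \<open>7!\<close>-th and the 13th iterate
  of Frobenius are trivial, so every residue is fixed, which \<open>Z_fixed\<close> allows for one
  root only.\<close>

lemma small_frobenius_invariant:
  assumes "T \<subseteq> Z" "card T \<le> 7" "\<And>d. d \<in> T \<Longrightarrow> \<exists>d'\<in>T. d ^ p \<simeq> d'" "z \<in> T" "w \<in> T"
  shows "z = w"
proof -
  have T: "finite T" "T \<subseteq> B" using assms(1) Z_finite Z_B finite_subset by auto
  have "d ^ p \<simeq> d" if "d \<in> T" for d
  proof (rule frobenius_combine[OF _ _ fact_7_13])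
    show "d \<in> B" "d ^ (p ^ 13) \<simeq> d" using that T(2) assms(1) Z_13 by auto
    show "d ^ (p ^ fact 7) \<simeq> d" using frobenius_period[OF T assms(2,3) that] by blast
  qed
  then show ?thesis using Z_fixed assms by blast
qed

text \<open>An orbit of at most 7 roots would be a single root, fixed by \<open>Gal\<close> and
  hence rational. So every orbit has at least 8 of the 14 roots, and any two meet.\<close>

lemma Gal_transitive:
  assumes "z \<in> Z" "w \<in> Z"
  shows "\<exists>\<sigma>\<in>Gal. \<sigma> z = w"
proof -
  define orb where "orb z = (\<lambda>\<sigma>. \<sigma> z) ` Gal" for z
  have orbZ: "orb z \<subseteq> Z" if "z \<in> Z" for z using that Z_Gal by (auto simp: orb_def)
  have inv: "\<sigma> ` orb z \<subseteq> orb z" if "\<sigma> \<in> Gal" for \<sigma> z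
  proof
    fix v assume "v \<in> \<sigma> ` orb z"
    then obtain \<tau> where "\<tau> \<in> Gal" "v = (\<sigma> \<circ> \<tau>) z" by (auto simp: orb_def)
    then show "v \<in> orb z" unfolding orb_def using Gal_comp[OF that] by blast
  qed
  have self: "z \<in> orb z" for z unfolding orb_def by (rule image_eqI[OF _ Gal_id]) simp
  have large: "card (orb z) \<ge> 8" if z: "z \<in> Z" for z
  proof (rule ccontr)
    assume "\<not> card (orb z) \<ge> 8"
    then have "card (orb z) \<le> 7" by simp
    have "\<sigma> z = z" if "\<sigma> \<in> Gal" for \<sigma>
    proof (rule small_frobenius_invariant[OF orbZ[OF z] \<open>card (orb z) \<le> 7\<close>])
      fix d assume d: "d \<in> orb z"
      show "\<exists>d'\<in>orb z. d ^ p \<simeq> d'"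
        by (rule Gal_invariant_frobenius[OF _ _ _ inv d])
           (use orbZ[OF z] Z_finite Z_B Z_Qbar finite_subset in auto)
    qed (use self that in \<open>auto simp: orb_def\<close>)
    moreover obtain q where "\<forall>i. coeff q i \<in> \<rat>" "q \<noteq> 0" "poly q z = 0"
      using B_algebraic z Z_B by blast
    ultimately have "z \<in> \<rat>" using Gal_fixed_Rats by blast
    then show False using Z_Rats z by blast
  qed
  have fin: "finite (orb z)" "finite (orb w)" using orbZ assms Z_finite finite_subset by blast+
  have "orb z \<inter> orb w \<noteq> {}"
  proof
    assume "orb z \<inter> orb w = {}"
    then have "card (orb z \<union> orb w) = card (orb z) + card (orb w)" using fin by (simp add: card_Un_disjoint)
    moreover have "card (orb z \<union> orb w) \<le> card Z" using orbZ assms Z_finite by (intro card_mono) auto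
    ultimately show False using large[OF assms(1)] large[OF assms(2)] Z_card by simp
  qed
  then obtain \<sigma> \<tau> where "\<sigma> \<in> Gal" "\<tau> \<in> Gal" "\<sigma> z = \<tau> w" unfolding orb_def by auto
  then have "(inv \<tau> \<circ> \<sigma>) z = w" "inv \<tau> \<circ> \<sigma> \<in> Gal"
    using Gal_inv_apply Gal_inv Gal_comp by auto
  then show ?thesis by blast
qed

lemma small_block_trivial:
  assumes C: "C \<subseteq> Z" "card C \<le> 7" "card C \<ge> 2"
    and block: "\<And>\<sigma>. \<sigma> \<in> Gal \<Longrightarrow> \<sigma> ` C = C \<or> \<sigma> ` C \<inter> C = {}"
  shows False
proof -
  have finC: "finite C" using C(1) Z_finite finite_subset by blast
  have CB: "C \<subseteq> B" and COm: "C \<subseteq> Qbar" using C(1) Z_B Z_Qbar by auto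
  define K where "K = (\<lambda>\<sigma>. \<sigma> ` C) ` Gal"
  have KZ: "C' \<subseteq> Z" if "C' \<in> K" for C' using that C(1) Z_Gal by (auto simp: K_def)
  have finK: "finite K" using KZ Z_finite by (meson Pow_iff finite_Pow_iff finite_subset subsetI)
  have cardK: "card C' = card C" if "C' \<in> K" for C'
    using that Gal_eq_iff by (auto simp: K_def intro!: card_image inj_onI)
  have disj: "C1 \<inter> C2 = {}" if K: "C1 \<in> K" "C2 \<in> K" "C1 \<noteq> C2" for C1 C2
  proof -
    obtain \<sigma> \<tau> where st: "\<sigma> \<in> Gal" "\<tau> \<in> Gal" "C1 = \<sigma> ` C" "C2 = \<tau> ` C" using K by (auto simp: K_def)
    define \<rho> where "\<rho> = inv \<tau> \<circ> \<sigma>"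
    have \<rho>: "\<rho> \<in> Gal" unfolding \<rho>_def using st Gal_comp Gal_inv by blast
    have C1: "C1 = \<tau> ` (\<rho> ` C)"
      unfolding st(3) \<rho>_def by (simp add: image_comp Gal_apply_inv[OF st(2)] o_def)
    have "\<rho> ` C \<noteq> C" using K(3) st(4) C1 by auto
    then have "\<rho> ` C \<inter> C = {}" using block[OF \<rho>] by blast
    then show ?thesis unfolding C1 st(4)
      using bij_is_inj[OF Gal_bij[OF st(2)]] by (auto simp: image_Int[symmetric])
  qed
  \<comment> \<open>The translates of \<open>C\<close> are disjoint and of equal size at least 2, so
    at most 7 of them fit into 14 points.\<close>
  have "card C * card K = card (\<Union>K)"
  proof (rule card_partition)
    show "finite (\<Union>K)" by (rule finite_subset[OF Union_least Z_finite]) (rule KZ)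
  qed (use finK cardK disj in auto)
  also have "\<dots> \<le> 14" unfolding Z_card[symmetric] using KZ Z_finite by (intro card_mono) auto
  finally have "card C * card K \<le> 14" .
  moreover have "2 * card K \<le> card C * card K" using C(3) by (rule mult_le_mono1)
  ultimately have K7: "card K \<le> 7" by linarith
  define c where "c i = coeff (\<Prod>d\<in>C. [:- d, 1:]) i" for i
  have cB: "c i \<in> B" for i unfolding c_def by (rule B_coeff_prod[OF finC CB])
  have c_frob: "c i ^ (p ^ fact 7) \<simeq> c i" for i
  proof -
    define T where "T = (\<lambda>C'. coeff (\<Prod>d\<in>C'. [:- d, 1:]) i) ` K"
    have T_eq: "T = (\<lambda>\<sigma>. \<sigma> (c i)) ` Gal"
      unfolding T_def K_def image_image c_def
      using Gal_coeff_prod(2)[OF _ finC COm] by (intro image_cong) auto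
    have finT: "finite T" unfolding T_def using finK by simp
    have cardT: "card T \<le> 7" unfolding T_def using card_image_le[OF finK] K7 le_trans by blast
    have TB: "T \<subseteq> B"
    proof
      fix v assume "v \<in> T"
      then obtain C' where C': "C' \<in> K" "v = coeff (\<Prod>d\<in>C'. [:- d, 1:]) i" by (auto simp: T_def)
      show "v \<in> B" unfolding C'(2)
        by (rule B_coeff_prod) (use KZ[OF C'(1)] Z_B Z_finite finite_subset in auto)
    qed
    have "c i \<in> Qbar" unfolding c_def using Gal_coeff_prod(1)[OF Gal_id finC COm] .
    then have TOm: "T \<subseteq> Qbar" unfolding T_eq using Gal_Qbar by auto
    have Tinv: "\<sigma> ` T \<subseteq> T" if "\<sigma> \<in> Gal" for \<sigma>
    proof
      fix v assume "v \<in> \<sigma> ` T"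
      then obtain \<tau> where "\<tau> \<in> Gal" "v = (\<sigma> \<circ> \<tau>) (c i)" by (auto simp: T_eq)
      then show "v \<in> T" unfolding T_eq using Gal_comp[OF that] by blast
    qed
    have "c i \<in> T" unfolding T_eq by (rule image_eqI[OF _ Gal_id]) simp
    then show ?thesis
      using frobenius_period[OF finT TB cardT] Gal_invariant_frobenius[OF finT TB TOm Tinv] by blast
  qed
  have step: "\<exists>d'\<in>C. d ^ p \<simeq> d'" if d: "d \<in> C" for d
  proof -
    \<comment> \<open>The exponent is \<open>7! * 3 = 13 * 1163 + 1\<close>: this iterate fixes the
      coefficients, yet acts on the roots as Frobenius itself.\<close>
    have "c i ^ (p ^ (fact 7 * 3)) \<simeq> c i" for i
      using frobenius_pow_mult[OF cB c_frob] .
    then obtain d' where d': "d' \<in> C" "d ^ (p ^ (fact 7 * 3)) \<simeq> d'"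
      using frobenius_roots[OF finC CB B_coeff_prod[OF finC CB] _ d, of "fact 7 * 3"] unfolding c_def by blast
    have dB: "d \<in> B" using d CB by blast
    have "(d ^ (p ^ (13 * 1163))) ^ p \<simeq> d ^ p"
      using frobenius_pow_mult[OF dB Z_13, of 1163] d C(1) dB by (intro mcong_power B_power) blast+
    also have "(d ^ (p ^ (13 * 1163))) ^ p = d ^ (p ^ (fact 7 * 3))"
      unfolding fact_7_13 by (simp only: power_mult[symmetric] power_add power_one_right)
    finally show ?thesis using d' mcong_sym mcong_trans by blast
  qed
  have "\<exists>z w. z \<in> C \<and> w \<in> C \<and> z \<noteq> w"
    using C(3) by (metis One_nat_def Suc_1 card_le_Suc0_iff_eq finC not_less_eq_eq)
  then show False using small_frobenius_invariant[OF C(1,2) step] by blast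
qed

section \<open>Normal subgroups of a primitive group\<close>

definition normal_subgrp :: "(complex \<Rightarrow> complex) set \<Rightarrow> bool" where
  "normal_subgrp H \<longleftrightarrow> H \<subseteq> Gal \<and> id \<in> H \<and> (\<forall>g\<in>H. \<forall>h\<in>H. g \<circ> h \<in> H) \<and> (\<forall>h\<in>H. inv h \<in> H) \<and>
     (\<forall>\<sigma>\<in>Gal. \<forall>h\<in>H. \<sigma> \<circ> h \<circ> inv \<sigma> \<in> H)"

text \<open>Orbits of a normal subgroup are blocks of equal size. If there are two, each has at most
  7 points and is therefore a single point; conjugation spreads this to all of
  \<open>Z\<close>.\<close>

lemma normal_subgrp_trivial_or_transitive:
  assumes H: "normal_subgrp H"
  shows "(\<forall>h\<in>H. \<forall>z\<in>Z. h z = z) \<or> (\<forall>z\<in>Z. \<forall>w\<in>Z. \<exists>h\<in>H. h z = w)"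
proof (rule disjCI)
  assume nt: "\<not> (\<forall>z\<in>Z. \<forall>w\<in>Z. \<exists>h\<in>H. h z = w)"
  have HG: "H \<subseteq> Gal" and Hid: "id \<in> H" and Hc: "\<And>g h. g \<in> H \<Longrightarrow> h \<in> H \<Longrightarrow> g \<circ> h \<in> H"
    and Hi: "\<And>h. h \<in> H \<Longrightarrow> inv h \<in> H" and Hn: "\<And>\<sigma> h. \<sigma> \<in> Gal \<Longrightarrow> h \<in> H \<Longrightarrow> \<sigma> \<circ> h \<circ> inv \<sigma> \<in> H"
    using H unfolding normal_subgrp_def by auto
  obtain z w where zw: "z \<in> Z" "w \<in> Z" "\<And>h. h \<in> H \<Longrightarrow> h z \<noteq> w" using nt by blast
  define orb where "orb z = (\<lambda>h. h z) ` H" for z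
  have orbZ: "orb y \<subseteq> Z" if "y \<in> Z" for y using that Z_Gal HG by (auto simp: orb_def)
  have self: "y \<in> orb y" for y unfolding orb_def by (rule image_eqI[OF _ Hid]) simp
  have eq: "orb x = orb y" if "u \<in> orb x" "u \<in> orb y" for u x y
  proof -
    have *: "orb x \<subseteq> orb y" if u: "u \<in> orb x" "u \<in> orb y" for x y
    proof -
      obtain g h where gh: "g \<in> H" "h \<in> H" "u = g x" "u = h y" using u by (auto simp: orb_def)
      have x: "x = (inv g \<circ> h) y" using gh HG Gal_inv_apply[of g x] by auto
      have "k x \<in> orb y" if "k \<in> H" for k
      proof -
        have "k x = (k \<circ> (inv g \<circ> h)) y" by (simp add: x)
        then show ?thesis unfolding orb_def using Hc[OF that Hc[OF Hi[OF gh(1)] gh(2)]] by (rule image_eqI)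
      qed
      then show ?thesis by (auto simp: orb_def)
    qed
    show ?thesis using *[OF that] *[OF that(2,1)] by blast
  qed
  have img: "\<sigma> ` orb y = orb (\<sigma> y)" if s: "\<sigma> \<in> Gal" for \<sigma> y
  proof -
    have *: "\<sigma> ` orb y \<subseteq> orb (\<sigma> y)" if s: "\<sigma> \<in> Gal" for \<sigma> y
    proof
      fix v assume "v \<in> \<sigma> ` orb y"
      then obtain h where h: "h \<in> H" "v = \<sigma> (h y)" by (auto simp: orb_def)
      then have "v = (\<sigma> \<circ> h \<circ> inv \<sigma>) (\<sigma> y)" by (simp add: Gal_inv_apply[OF s])
      then show "v \<in> orb (\<sigma> y)" unfolding orb_def using Hn[OF s h(1)] by blast
    qed
    have "orb (\<sigma> y) = \<sigma> ` (inv \<sigma> ` orb (\<sigma> y))"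
      by (simp add: image_comp o_def Gal_apply_inv[OF s])
    also have "\<dots> \<subseteq> \<sigma> ` orb y"
      using *[OF Gal_inv[OF s], of "\<sigma> y"] by (auto simp: Gal_inv_apply[OF s])
    finally show ?thesis using *[OF s] by blast
  qed
  have fin: "finite (orb z)" "finite (orb w)" using orbZ zw Z_finite finite_subset by blast+
  obtain \<sigma> where \<sigma>: "\<sigma> \<in> Gal" "\<sigma> z = w" using Gal_transitive[OF zw(1,2)] by blast
  have "card (orb w) = card (orb z)"
    unfolding \<sigma>(2)[symmetric] img[OF \<sigma>(1), symmetric]
    by (rule card_image) (simp add: inj_on_def Gal_eq_iff[OF \<sigma>(1)])
  moreover have "orb z \<inter> orb w = {}"
  proof (rule ccontr)
    assume "orb z \<inter> orb w \<noteq> {}"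
    then obtain u where "u \<in> orb z" "u \<in> orb w" by blast
    then have "w \<in> orb z" using eq self by blast
    then show False using zw(3) by (auto simp: orb_def)
  qed
  then have "card (orb z) + card (orb w) = card (orb z \<union> orb w)" using fin by (simp add: card_Un_disjoint)
  moreover have "card (orb z \<union> orb w) \<le> card Z" using orbZ zw Z_finite by (intro card_mono) auto
  ultimately have "card (orb z) \<le> 7" using Z_card by simp
  moreover have "\<tau> ` orb z = orb z \<or> \<tau> ` orb z \<inter> orb z = {}" if "\<tau> \<in> Gal" for \<tau>
    unfolding img[OF that] using eq by blast
  ultimately have "\<not> 2 \<le> card (orb z)" using small_block_trivial[OF orbZ[OF zw(1)]] by blast
  then have "card (orb z) \<le> Suc 0" by simp
  then have fixz: "h z = z" if "h \<in> H" for h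
  proof -
    have "h z \<in> orb z" unfolding orb_def using that by blast
    then show ?thesis using self[of z] card_le_Suc0_iff_eq[OF fin(1)] \<open>card (orb z) \<le> Suc 0\<close> by blast
  qed
  show "\<forall>h\<in>H. \<forall>y\<in>Z. h y = y"
  proof (intro ballI)
    fix h y assume h: "h \<in> H" and "y \<in> Z"
    then obtain \<tau> where \<tau>: "\<tau> \<in> Gal" "\<tau> y = z" using Gal_transitive zw(1) by blast
    have "(\<tau> \<circ> h \<circ> inv \<tau>) z = z" using fixz Hn[OF \<tau>(1) h] by blast
    then have "\<tau> (h y) = \<tau> y" using \<tau>(2) Gal_inv_apply[OF \<tau>(1), of y] by auto
    then show "h y = y" using Gal_eq_iff[OF \<tau>(1)] by blast
  qed
qed

text \<open>A nontrivial abelian normal subgroup would act regularly on the 14 points, and so would its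
  exponent-2 part, unless that part is trivial. But a group of order 14 has an element of order 2 and
  no Klein four-subgroup.\<close>

lemma no_abelian_normal_subgrp:
  assumes A: "normal_subgrp A" and comm: "\<And>a b z. a \<in> A \<Longrightarrow> b \<in> A \<Longrightarrow> z \<in> Z \<Longrightarrow> a (b z) = b (a z)"
    and a: "a \<in> A" and z: "z \<in> Z"
  shows "a z = z"
proof (rule ccontr)
  assume nontriv: "a z \<noteq> z"
  have AG: "A \<subseteq> Gal" and Aid: "id \<in> A" and Ac: "\<And>g h. g \<in> A \<Longrightarrow> h \<in> A \<Longrightarrow> g \<circ> h \<in> A"
    and Ai: "\<And>h. h \<in> A \<Longrightarrow> inv h \<in> A" and An: "\<And>\<sigma> h. \<sigma> \<in> Gal \<Longrightarrow> h \<in> A \<Longrightarrow> \<sigma> \<circ> h \<circ> inv \<sigma> \<in> A"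
    using A unfolding normal_subgrp_def by auto
  have AZ: "b y \<in> Z" if "b \<in> A" "y \<in> Z" for b y using that AG Z_Gal by blast
  have trans: "\<exists>b\<in>A. b x = y" if "x \<in> Z" "y \<in> Z" for x y
    using normal_subgrp_trivial_or_transitive[OF A] nontriv a z that by blast
  \<comment> \<open>A transitive abelian group acts regularly: an element fixing one point fixes
    all.\<close>
  have reg: "b y = y" if b: "b \<in> A" "x \<in> Z" "b x = x" "y \<in> Z" for b x y
  proof -
    obtain c where c: "c \<in> A" "c x = y" using trans b(2,4) by blast
    then show ?thesis using comm[OF b(1) c(1) b(2)] b(3) by simp
  qed
  define A2 where "A2 = {b \<in> A. \<forall>y\<in>Z. b (b y) = y}"
  have "normal_subgrp A2"
    unfolding normal_subgrp_def
  proof (intro conjI ballI)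
    show "A2 \<subseteq> Gal" "id \<in> A2" using AG Aid by (auto simp: A2_def)
    fix g assume g: "g \<in> A2"
    then have gA: "g \<in> A" and gG: "g \<in> Gal" using AG by (auto simp: A2_def)
    show "inv g \<in> A2"
    proof -
      have "inv g (inv g y) = y" if "y \<in> Z" for y
        using g that Gal_inv_apply[OF gG] unfolding A2_def by (metis (mono_tags, lifting) mem_Collect_eq)
      then show ?thesis using Ai[OF gA] by (simp add: A2_def)
    qed
    { fix h assume h: "h \<in> A2"
      then have hA: "h \<in> A" by (auto simp: A2_def)
      have "g (h (g (h y))) = y" if y: "y \<in> Z" for y
      proof -
        have "h (g (h y)) = h (h (g y))" using comm[OF gA hA y] by simp
        also have "\<dots> = g y" using h AZ[OF gA y] by (simp add: A2_def)
        finally show ?thesis using g y by (simp add: A2_def)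
      qed
      then show "g \<circ> h \<in> A2" using Ac[OF gA hA] by (simp add: A2_def)
    }
  next
    fix \<sigma> g assume \<sigma>: "\<sigma> \<in> Gal" and g: "g \<in> A2"
    have "(\<sigma> \<circ> g \<circ> inv \<sigma>) ((\<sigma> \<circ> g \<circ> inv \<sigma>) y) = y" if "y \<in> Z" for y
      using g Z_Gal[OF Gal_inv[OF \<sigma>] that] by (simp add: Gal_inv_apply[OF \<sigma>] Gal_apply_inv[OF \<sigma>] A2_def)
    then show "\<sigma> \<circ> g \<circ> inv \<sigma> \<in> A2" using An[OF \<sigma>] g unfolding A2_def by blast
  qed
  from normal_subgrp_trivial_or_transitive[OF this] show False
  proof
    assume triv: "\<forall>h\<in>A2. \<forall>z\<in>Z. h z = z"
    \<comment> \<open>By \<open>reg\<close>, the action on \<open>Z\<close> of an element carrying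
      \<open>z\<close> to \<open>y\<close> is determined by \<open>y\<close>. So \<open>Z\<close> is
      identified with the acting group, \<open>z\<close> with its identity, and
      \<open>\<iota>\<close> with inversion.\<close>
    define act where "act y = (SOME b. b \<in> A \<and> b z = y)" for y
    have act: "act y \<in> A" "act y z = y" if "y \<in> Z" for y
      using someI_ex[of "\<lambda>b. b \<in> A \<and> b z = y"] trans[OF z that] unfolding act_def by blast+
    define \<iota> where "\<iota> y = inv (act y) z" for y
    have act_i: "act y (\<iota> y) = z" if "y \<in> Z" for y
      unfolding \<iota>_def using Gal_apply_inv act(1)[OF that] AG by blast
    have iZ: "\<iota> y \<in> Z" if "y \<in> Z" for y
      unfolding \<iota>_def using AZ Ai act(1)[OF that] z by blast
    have swap: "act (\<iota> y) y = z" if y: "y \<in> Z" for y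
    proof -
      have "act (\<iota> y) (act y z) = act y (act (\<iota> y) z)"
        using comm act(1) y iZ z by blast
      then show ?thesis using act(2) y iZ act_i by simp
    qed
    have ii: "\<iota> (\<iota> y) = y" if y: "y \<in> Z" for y
    proof -
      have "act (\<iota> y) \<in> Gal" using act(1)[OF iZ[OF y]] AG by blast
      then show ?thesis using act_i[OF iZ[OF y]] swap[OF y] Gal_eq_iff by metis
    qed
    have nofix: "\<iota> y \<noteq> y" if y: "y \<in> Z - {z}" for y
    proof
      assume "\<iota> y = y"
      then have "(act y \<circ> act y) z = z" using act_i[of y] act(2)[of y] y by simp
      then have "(act y \<circ> act y) u = u" if "u \<in> Z" for u
        using reg[of "act y \<circ> act y" z u] Ac act(1) y z that by blast
      then have "act y \<in> A2" using act(1) y by (simp add: A2_def)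
      then have "act y z = z" using triv z by blast
      then show False using act(2)[of y] y by simp
    qed
    have iz: "\<iota> y \<noteq> z" if y: "y \<in> Z - {z}" for y
    proof
      assume "\<iota> y = z"
      then show False using act_i[of y] act(2)[of y] y by simp
    qed
    \<comment> \<open>Without elements of order 2, inversion pairs off the remaining 13 points, an
      odd number.\<close>
    have "2 dvd card (\<Union>((\<lambda>y. {y, \<iota> y}) ` (Z - {z})))"
    proof (rule dvd_partition)
      show "\<forall>c1\<in>(\<lambda>y. {y, \<iota> y}) ` (Z - {z}). \<forall>c2\<in>(\<lambda>y. {y, \<iota> y}) ` (Z - {z}). c1 \<noteq> c2 \<longrightarrow> c1 \<inter> c2 = {}"
        using ii by auto (metis DiffD1 ii)+
      show "\<forall>c\<in>(\<lambda>y. {y, \<iota> y}) ` (Z - {z}). 2 dvd card c"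
        using nofix[symmetric] by (auto simp: card_insert_if)
    qed (use Z_finite in auto)
    also have "\<Union>((\<lambda>y. {y, \<iota> y}) ` (Z - {z})) = Z - {z}" using iZ iz by auto
    finally show False using Z_finite z Z_card by simp
  next
    assume tr: "\<forall>z\<in>Z. \<forall>w\<in>Z. \<exists>h\<in>A2. h z = w"
    obtain y where y: "y \<in> Z" "y \<noteq> z" using AZ[OF a z] nontriv by blast
    have "\<not> Z \<subseteq> {z, y}"
    proof
      assume "Z \<subseteq> {z, y}"
      then have "card Z \<le> card {z, y}" by (intro card_mono) auto
      then show False using Z_card by (simp add: card_insert_if split: if_splits)
    qed
    then obtain x where x: "x \<in> Z" "x \<noteq> z" "x \<noteq> y" by blast
    obtain b c where b: "b \<in> A2" "b z = y" and c: "c \<in> A2" "c z = x" using tr z y(1) x(1) by blast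
    have bA: "b \<in> A" and cA: "c \<in> A" and bb: "\<And>u. u \<in> Z \<Longrightarrow> b (b u) = u" and cc: "\<And>u. u \<in> Z \<Longrightarrow> c (c u) = u"
      using b(1) c(1) by (auto simp: A2_def)
    have bc: "b (c u) = c (b u)" if "u \<in> Z" for u using comm bA cA that by blast
    have bZ: "b u \<in> Z" and cZ: "c u \<in> Z" if "u \<in> Z" for u using AZ bA cA that by auto
    have b1: "b u \<noteq> u" if "u \<in> Z" for u using reg[OF bA that _ z] b(2) y by auto
    have c1: "c u \<noteq> u" if "u \<in> Z" for u using reg[OF cA that _ z] c(2) x by auto
    have bcu: "b u \<noteq> c u" if u: "u \<in> Z" for u
    proof
      assume "b u = c u"
      then have "(b \<circ> c) u = u" using bb u by (metis comp_apply)
      then have "(b \<circ> c) z = z" using reg[OF Ac[OF bA cA] u _ z] by blast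
      then have "b (b (c z)) = b z" by simp
      then show False using bb cZ z b(2) c(2) x by simp
    qed
    \<comment> \<open>The orbits of the Klein four-group generated by \<open>b\<close> and
      \<open>c\<close>; they have 4 points each, and 4 does not divide 14.\<close>
    define X where "X u = {u, b u, c u, b (c u)}" for u
    have cardX: "card (X u) = 4" if u: "u \<in> Z" for u
    proof -
      have "u \<noteq> b (c u)" using bcu[OF u] bb[OF cZ[OF u]] by metis
      moreover have "b u \<noteq> b (c u)" using c1[OF u] Gal_eq_iff bA AG by (metis subsetD)
      ultimately show ?thesis
        using b1[OF u] c1[OF u] bcu[OF u] b1[OF cZ[OF u]] by (simp add: X_def card_insert_if)
    qed
    have XX: "X v = X u" if "u \<in> Z" "v \<in> X u" for u v
      using that bb cc bc bZ cZ by (auto simp: X_def)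
    have "4 dvd card (\<Union>(X ` Z))"
    proof (rule dvd_partition)
      show "\<forall>c1\<in>X ` Z. \<forall>c2\<in>X ` Z. c1 \<noteq> c2 \<longrightarrow> c1 \<inter> c2 = {}"
        using XX by blast
    qed (use Z_finite cardX in \<open>auto simp: X_def\<close>)
    also have "\<Union>(X ` Z) = Z" using bZ cZ by (auto simp: X_def)
    finally show False using Z_card by simp
  qed
qed

text \<open>Commutation is required only on \<open>Z\<close>, that is, for the induced permutations
  of the roots.\<close>

definition centr :: "(complex \<Rightarrow> complex) set \<Rightarrow> (complex \<Rightarrow> complex) set" where
  "centr X = {\<sigma> \<in> Gal. \<forall>\<tau>\<in>X. \<forall>z\<in>Z. \<sigma> (\<tau> z) = \<tau> (\<sigma> z)}"

lemma normal_subgrp_centr: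
  assumes X: "X \<subseteq> Gal" "\<And>\<sigma> h. \<sigma> \<in> Gal \<Longrightarrow> h \<in> X \<Longrightarrow> \<sigma> \<circ> h \<circ> inv \<sigma> \<in> X"
  shows "normal_subgrp (centr X)"
  unfolding normal_subgrp_def
proof (intro conjI ballI)
  show "centr X \<subseteq> Gal" "id \<in> centr X" using Gal_id by (auto simp: centr_def)
next
  fix g h assume "g \<in> centr X" "h \<in> centr X"
  then show "g \<circ> h \<in> centr X" using Z_Gal Gal_comp by (auto simp: centr_def)
next
  fix g assume g: "g \<in> centr X"
  then have gG: "g \<in> Gal" by (simp add: centr_def)
  have "inv g (\<tau> z) = \<tau> (inv g z)" if "\<tau> \<in> X" "z \<in> Z" for \<tau> z
  proof -
    have "g (\<tau> (inv g z)) = \<tau> (g (inv g z))"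
      using g that Z_Gal[OF Gal_inv[OF gG] that(2)] by (simp add: centr_def)
    then show ?thesis using Gal_inv_apply[OF gG] Gal_apply_inv[OF gG] by metis
  qed
  then show "inv g \<in> centr X" using Gal_inv[OF gG] by (simp add: centr_def)
next
  fix \<sigma> g assume \<sigma>: "\<sigma> \<in> Gal" and g: "g \<in> centr X"
  then have gG: "g \<in> Gal" by (simp add: centr_def)
  have "(\<sigma> \<circ> g \<circ> inv \<sigma>) (\<tau> z) = \<tau> ((\<sigma> \<circ> g \<circ> inv \<sigma>) z)" if \<tau>: "\<tau> \<in> X" and z: "z \<in> Z" for \<tau> z
  proof -
    define \<rho> where "\<rho> = inv \<sigma> \<circ> \<tau> \<circ> inv (inv \<sigma>)"
    have "\<rho> \<in> X" unfolding \<rho>_def using X(2)[OF Gal_inv[OF \<sigma>] \<tau>] .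
    moreover have \<rho>: "\<rho> u = inv \<sigma> (\<tau> (\<sigma> u))" for u
      using Gal_bij[OF \<sigma>] by (simp add: \<rho>_def inv_inv_eq)
    ultimately have "g (\<rho> (inv \<sigma> z)) = \<rho> (g (inv \<sigma> z))"
      using g Z_Gal[OF Gal_inv[OF \<sigma>] z] unfolding centr_def by blast
    then have "g (inv \<sigma> (\<tau> z)) = inv \<sigma> (\<tau> (\<sigma> (g (inv \<sigma> z))))"
      by (simp add: \<rho> Gal_apply_inv[OF \<sigma>])
    then show ?thesis by (simp add: Gal_apply_inv[OF \<sigma>])
  qed
  then show "\<sigma> \<circ> g \<circ> inv \<sigma> \<in> centr X" using Gal_comp Gal_inv \<sigma> gG by (simp add: centr_def del: o_apply)
qed

lemma normal_subgrp_Int: "normal_subgrp H \<Longrightarrow> normal_subgrp K \<Longrightarrow> normal_subgrp (H \<inter> K)"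
  unfolding normal_subgrp_def by blast

theorem not_fixed_by_Der:
  assumes z: "z \<in> Z" and fixed: "\<forall>c\<in>Der n. c z = z"
  shows False
proof -
  define triv where "triv k \<longleftrightarrow> (\<forall>c\<in>Der k. \<forall>y\<in>Z. c y = y)" for k
  have "triv n"
    unfolding triv_def
  proof (intro ballI)
    fix c y assume c: "c \<in> Der n" and "y \<in> Z"
    then obtain \<sigma> where \<sigma>: "\<sigma> \<in> Gal" "\<sigma> y = z" using Gal_transitive z by blast
    have "(\<sigma> \<circ> c \<circ> inv \<sigma>) z = z" using fixed Der_conj[OF \<sigma>(1) c] by blast
    then have "\<sigma> (c y) = \<sigma> y" using \<sigma>(2) Gal_inv_apply[OF \<sigma>(1), of y] by auto
    then show "c y = y" using Gal_eq_iff[OF \<sigma>(1)] by blast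
  qed
  have "\<not> triv 0"
  proof
    assume "triv 0"
    have "\<not> Z \<subseteq> {z}"
      using Z_card card_mono[of "{z}" Z] by fastforce
    then obtain w where "w \<in> Z" "w \<noteq> z" by blast
    moreover obtain \<sigma> where "\<sigma> \<in> Gal" "\<sigma> z = w" using Gal_transitive[OF z \<open>w \<in> Z\<close>] by blast
    ultimately show False using \<open>triv 0\<close> z unfolding triv_def Der.simps(1) by metis
  qed
  \<comment> \<open>The last nontrivial level: \<open>Der k\<close> moves a root, but its
    commutators do not, so its elements commute on \<open>Z\<close>.\<close>
  then obtain k where k: "\<not> triv k" "triv (Suc k)"
    using \<open>triv n\<close> ex_least_nat_less[of triv n] by blast
  have comm: "\<sigma> (\<tau> y) = \<tau> (\<sigma> y)" if st: "\<sigma> \<in> Der k" "\<tau> \<in> Der k" and y: "y \<in> Z" for \<sigma> \<tau> y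
  proof -
    have G: "\<tau> \<circ> \<sigma> \<in> Gal" "\<sigma> \<circ> \<tau> \<in> Gal" using st Der_Gal Gal_comp by blast+
    define c where "c = inv (\<tau> \<circ> \<sigma>) \<circ> (\<sigma> \<circ> \<tau>)"
    have "c \<in> Gal" unfolding c_def using G Gal_comp Gal_inv by blast
    moreover have c: "\<tau> \<circ> \<sigma> \<circ> c = \<sigma> \<circ> \<tau>"
      unfolding c_def using Gal_apply_inv[OF G(1)] by (auto simp: fun_eq_iff)
    ultimately have "c \<in> Der (Suc k)" using st by (auto simp: Der.simps(2))
    then have "c y = y" using k(2) y by (simp add: triv_def)
    then show ?thesis using fun_cong[OF c, of y] by simp
  qed
  \<comment> \<open>\<open>Der k\<close> is a mere set, closed under conjugation. The centre of its
    centraliser is a normal subgroup, abelian on \<open>Z\<close>, that contains it.\<close>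
  define C where "C = centr (Der k)"
  define A where "A = C \<inter> centr C"
  have C: "normal_subgrp C"
    unfolding C_def using Der_Gal Der_conj by (intro normal_subgrp_centr) auto
  then have "normal_subgrp (centr C)"
    unfolding normal_subgrp_def[of C] by (intro normal_subgrp_centr) auto
  with C have A: "normal_subgrp A" unfolding A_def by (rule normal_subgrp_Int)
  have "Der k \<subseteq> C" unfolding C_def centr_def using comm Der_Gal by blast
  moreover have "Der k \<subseteq> centr C"
    unfolding centr_def[of C] using Der_Gal by (auto simp: C_def centr_def)
  ultimately have "Der k \<subseteq> A" by (simp add: A_def)
  moreover have "a (b y) = b (a y)" if "a \<in> A" "b \<in> A" "y \<in> Z" for a b y
  proof -
    have "a \<in> centr C" "b \<in> C" using that(1,2) by (auto simp: A_def)
    then show ?thesis using that(3) unfolding centr_def[of C] by blast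
  qed
  ultimately have "triv k"
    unfolding triv_def using no_abelian_normal_subgrp[OF A] by blast
  then show False using k(1) by blast
qed

end

section \<open>A polynomial of degree 14\<close>

text \<open>Constant term first. This is the factor left beside \<open>(t - 1)^3 (t + 1)\<close>
  when \<open>w\<close> is eliminated in \<open>elimination\<close>.\<close>

definition paw_coeffs :: "int list" where
  "paw_coeffs = [89424, -73104768, -531305208, -1254598056, -1759003635, -1916641434, -1777641935,
     -579668896, 261750022, 298000612, 149563286, 50276104, 10946461, 1636214, 141361]"

definition paw_poly :: "int poly" where
  "paw_poly = Poly paw_coeffs"

text \<open>Congruence modulo the ideal generated by 67 and \<open>paw_poly\<close>. Explicit
  cofactors can be evaluated at a root, where \<open>paw_poly\<close> vanishes and 67 lies in
  \<open>m\<close>.\<close>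

definition cong67 :: "int poly \<Rightarrow> int poly \<Rightarrow> bool" where
  "cong67 a b \<longleftrightarrow> (\<exists>h k. a - b = paw_poly * h + smult 67 k)"

lemma cong67_refl: "cong67 a a"
  unfolding cong67_def by (rule exI[of _ 0], rule exI[of _ 0]) simp

lemma cong67_sym: "cong67 a b \<Longrightarrow> cong67 b a"
proof -
  assume "cong67 a b"
  then obtain h k where "a - b = paw_poly * h + smult 67 k" unfolding cong67_def by auto
  then have "b - a = paw_poly * (- h) + smult 67 (- k)" by (simp add: algebra_simps)
  then show ?thesis unfolding cong67_def by blast
qed

lemma cong67_trans [trans]: "cong67 a b \<Longrightarrow> cong67 b c \<Longrightarrow> cong67 a c"
proof -
  assume "cong67 a b" "cong67 b c"
  then obtain h k h' k' where "a - b = paw_poly * h + smult 67 k" "b - c = paw_poly * h' + smult 67 k'"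
    unfolding cong67_def by auto
  then have "a - c = paw_poly * (h + h') + smult 67 (k + k')"
    by (simp add: algebra_simps smult_add_right)
  then show ?thesis unfolding cong67_def by blast
qed

lemma cong67_add: "cong67 a b \<Longrightarrow> cong67 c d \<Longrightarrow> cong67 (a + c) (b + d)"
proof -
  assume "cong67 a b" "cong67 c d"
  then obtain h k h' k' where "a - b = paw_poly * h + smult 67 k" "c - d = paw_poly * h' + smult 67 k'"
    unfolding cong67_def by auto
  then have "(a + c) - (b + d) = paw_poly * (h + h') + smult 67 (k + k')"
    by (simp add: algebra_simps smult_add_right)
  then show ?thesis unfolding cong67_def by blast
qed

lemma cong67_mult_left: "cong67 a b \<Longrightarrow> cong67 (c * a) (c * b)"
proof -
  assume "cong67 a b"
  then obtain h k where hk: "a - b = paw_poly * h + smult 67 k" unfolding cong67_def by auto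
  have "c * a - c * b = c * (a - b)" by (simp add: algebra_simps)
  also have "\<dots> = paw_poly * (c * h) + smult 67 (c * k)" unfolding hk by (simp add: algebra_simps)
  finally show ?thesis unfolding cong67_def by blast
qed

lemma cong67_mult: "cong67 a b \<Longrightarrow> cong67 c d \<Longrightarrow> cong67 (a * c) (b * d)"
  by (metis cong67_mult_left cong67_trans mult.commute)

lemma cong67_power: "cong67 a b \<Longrightarrow> cong67 (a ^ n) (b ^ n)"
  by (induction n) (auto intro: cong67_refl cong67_mult)

lemma cong67_of_smult: "a - b = smult 67 k \<Longrightarrow> cong67 a b"
  unfolding cong67_def by (rule exI[of _ 0], rule exI[of _ k]) simp

section \<open>Frobenius computed on lists of residues\<close>

definition paw_X14 :: "int list" where
  "paw_X14 = [20, 60, 56, 14, 3, 33, 21, 33, 13, 62, 51, 12, 15, 38]"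

text \<open>Lists of length 14 represent residues modulo 67 and \<open>paw_poly\<close>; multiplication by \<open>X\<close> uses that
  \<open>X\<^sup>14\<close> is congruent to \<open>Poly paw_X14\<close>.\<close>

definition mulX :: "int list \<Rightarrow> int list" where
  "mulX v = (let l = last v in map2 (\<lambda>a c. (l * a + c) mod 67) paw_X14 (0 # butlast v))"

text \<open>Horner's scheme in the first factor, reducing after each step.\<close>

primrec vmul :: "int list \<Rightarrow> int list \<Rightarrow> int list" where
  "vmul [] v = replicate 14 0"
| "vmul (a # as) v = map2 (\<lambda>x y. (a * x + y) mod 67) v (mulX (vmul as v))"

text \<open>The 67th power by repeated squaring, from \<open>67 = 64 + 2 + 1\<close>.\<close>

definition frobv :: "int list \<Rightarrow> int list" where
  "frobv v = (let v2 = vmul v v; v4 = vmul v2 v2; v8 = vmul v4 v4; v16 = vmul v8 v8;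
     v32 = vmul v16 v16; v64 = vmul v32 v32 in vmul (vmul v64 v2) v)"

lemma cong67_map2:
  "length xs = length ys \<Longrightarrow>
    cong67 (Poly (map2 (\<lambda>x y. (a * x + y) mod 67) xs ys)) (smult a (Poly xs) + Poly ys)"
proof -
  assume "length xs = length ys"
  then have "\<exists>k. Poly (map2 (\<lambda>x y. (a * x + y) mod 67) xs ys) - (smult a (Poly xs) + Poly ys) = smult 67 k"
  proof (induction rule: list_induct2)
    case Nil
    show ?case by (rule exI[of _ 0]) simp
  next
    case (Cons x xs y ys)
    then obtain k where k: "Poly (map2 (\<lambda>x y. (a * x + y) mod 67) xs ys) - (smult a (Poly xs) + Poly ys) = smult 67 k"
      by auto
    have "(a * x + y) mod 67 - (a * x + y) = 67 * (- ((a * x + y) div 67))"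
      by (simp add: minus_mult_div_eq_mod [symmetric])
    with k show ?case
      by (intro exI[of _ "pCons (- ((a * x + y) div 67)) k"]) (simp add: algebra_simps)
  qed
  then show ?thesis using cong67_of_smult by blast
qed

lemma length_mulX: "length v = 14 \<Longrightarrow> length (mulX v) = 14"
  by (simp add: mulX_def Let_def paw_X14_def)

lemma length_vmul: "length v = 14 \<Longrightarrow> length (vmul as v) = 14"
  by (induction as) (auto simp: length_mulX)

lemma cong67_X14: "cong67 (Poly paw_X14) (monom 1 14)"
proof -
  have "monom 1 14 = Poly [0, 0, 0, 0, 0, 0, 0, 0, 0, 0, 0, 0, 0, 0, 1 :: int]"
    by (simp add: monom_altdef eval_nat_numeral)
  \<comment> \<open>Modulo 67 the leading coefficient 141361 has inverse 52, whence the cofactor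
    -52.\<close>
  then have "Poly paw_X14 - monom 1 14 = paw_poly * [:-52:] + smult 67 (Poly
    [69404, -56738028, -412356280, -973717894, -1365196851, -1487542605, -1379662397, -449892277,
     203149271, 231284058, 116078969, 39020260, 8495761, 1269898, 109713])"
    by (simp add: paw_poly_def paw_coeffs_def paw_X14_def)
  then show ?thesis unfolding cong67_def by blast
qed

lemma cong67_mulX:
  assumes "length v = 14"
  shows "cong67 (Poly (mulX v)) (pCons 0 (Poly v))"
proof -
  have "v \<noteq> []" using assms by auto
  then have v: "v = butlast v @ [last v]" by simp
  have "Poly v = Poly (butlast v) + monom 1 13 * [:last v:]"
    by (subst v, subst Poly_append) (use assms in \<open>simp\<close>)
  then have 1: "pCons 0 (Poly v) = smult (last v) (monom 1 14) + Poly (0 # butlast v)"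
    by (simp add: monom_Suc eval_nat_numeral algebra_simps)
  have "cong67 (Poly (mulX v)) (smult (last v) (Poly paw_X14) + Poly (0 # butlast v))"
    unfolding mulX_def Let_def by (rule cong67_map2) (use assms in \<open>simp add: paw_X14_def\<close>)
  moreover have "cong67 (smult (last v) (Poly paw_X14) + Poly (0 # butlast v))
     (smult (last v) (monom 1 14) + Poly (0 # butlast v))"
    using cong67_add[OF cong67_mult_left[OF cong67_X14, of "[:last v:]"] cong67_refl] by simp
  ultimately show ?thesis unfolding 1 by (rule cong67_trans)
qed

lemma cong67_vmul:
  assumes "length v = 14"
  shows "cong67 (Poly (vmul as v)) (Poly as * Poly v)"
proof (induction as)
  case Nil
  show ?case by (simp add: eval_nat_numeral cong67_refl)
next
  case (Cons a as)
  have "cong67 (Poly (vmul (a # as) v)) (smult a (Poly v) + Poly (mulX (vmul as v)))"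
    unfolding vmul.simps by (rule cong67_map2) (simp add: length_mulX length_vmul assms)
  also have "cong67 \<dots> (smult a (Poly v) + pCons 0 (Poly as * Poly v))"
  proof (rule cong67_add[OF cong67_refl])
    have "cong67 (pCons 0 (Poly (vmul as v))) (pCons 0 (Poly as * Poly v))"
      using cong67_mult_left[OF Cons.IH, of "[:0, 1:]"] by simp
    then show "cong67 (Poly (mulX (vmul as v))) (pCons 0 (Poly as * Poly v))"
      using cong67_mulX[OF length_vmul[OF assms]] cong67_trans by blast
  qed
  finally show ?case by simp
qed

lemma length_frobv: "length v = 14 \<Longrightarrow> length (frobv v) = 14"
  by (simp add: frobv_def Let_def length_vmul)

lemma cong67_frobv:
  assumes "length v = 14"
  shows "cong67 (Poly (frobv v)) (Poly v ^ 67)"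
proof -
  have mu: "length (vmul w w') = 14 \<and> cong67 (Poly (vmul w w')) (Poly v ^ m)"
    if "length w = 14 \<and> cong67 (Poly w) (Poly v ^ n)" "length w' = 14 \<and> cong67 (Poly w') (Poly v ^ n')"
      "m = n + n'" for w n w' n' m
    using that cong67_vmul[of w' w] cong67_mult[of "Poly w" "Poly v ^ n" "Poly w'" "Poly v ^ n'"]
      cong67_trans length_vmul by (metis power_add)
  have 1: "length v = 14 \<and> cong67 (Poly v) (Poly v ^ 1)"
    using assms by (simp add: cong67_refl)
  note 2 = mu[OF 1 1, of 2, simplified]
  note 4 = mu[OF 2 2, of 4, simplified]
  note 8 = mu[OF 4 4, of 8, simplified]
  note 16 = mu[OF 8 8, of 16, simplified]
  note 32 = mu[OF 16 16, of 32, simplified]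
  note 64 = mu[OF 32 32, of 64, simplified]
  note 66 = mu[OF 64 2, of 66, simplified]
  note 67 = mu[OF 66 1, of 67, simplified]
  then show ?thesis
    by (simp add: frobv_def Let_def)
qed

definition Xv :: "int list" where
  "Xv = [0, 1, 0, 0, 0, 0, 0, 0, 0, 0, 0, 0, 0, 0]"

lemma frobv_Xv: "frobv Xv = [64, 6, 46, 16, 8, 0, 63, 66, 56, 65, 55, 29, 47, 5]"
  by code_simp

text \<open>The residues of \<open>X ^ (67 ^ n)\<close> for \<open>n\<close> from 2 to 13, the last
  being \<open>X\<close> again. Explicit intermediate values keep each evaluation small.\<close>

lemma frobv_steps:
  "frobv [64, 6, 46, 16, 8, 0, 63, 66, 56, 65, 55, 29, 47, 5] =
    [24, 29, 58, 66, 37, 23, 15, 12, 8, 63, 29, 43, 38, 26]"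
  "frobv [24, 29, 58, 66, 37, 23, 15, 12, 8, 63, 29, 43, 38, 26] =
    [7, 26, 10, 9, 41, 29, 33, 20, 10, 12, 7, 47, 20, 0]"
  "frobv [7, 26, 10, 9, 41, 29, 33, 20, 10, 12, 7, 47, 20, 0] =
    [21, 40, 13, 23, 27, 22, 12, 43, 12, 21, 55, 11, 14, 0]"
  "frobv [21, 40, 13, 23, 27, 22, 12, 43, 12, 21, 55, 11, 14, 0] =
    [26, 66, 36, 48, 21, 49, 10, 66, 30, 38, 57, 10, 65, 14]"
  "frobv [26, 66, 36, 48, 21, 49, 10, 66, 30, 38, 57, 10, 65, 14] =
    [63, 27, 6, 44, 20, 9, 49, 3, 31, 51, 66, 36, 51, 15]"
  "frobv [63, 27, 6, 44, 20, 9, 49, 3, 31, 51, 66, 36, 51, 15] =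
    [44, 55, 48, 56, 32, 31, 62, 0, 16, 51, 53, 61, 7, 25]"
  "frobv [44, 55, 48, 56, 32, 31, 62, 0, 16, 51, 53, 61, 7, 25] =
    [55, 44, 25, 31, 19, 3, 57, 52, 51, 48, 10, 62, 64, 18]"
  "frobv [55, 44, 25, 31, 19, 3, 57, 52, 51, 48, 10, 62, 64, 18] =
    [58, 66, 10, 29, 25, 45, 31, 16, 53, 53, 27, 29, 45, 50]"
  "frobv [58, 66, 10, 29, 25, 45, 31, 16, 53, 53, 27, 29, 45, 50] =
    [63, 44, 62, 22, 26, 1, 66, 23, 26, 25, 43, 40, 34, 10]"
  "frobv [63, 44, 62, 22, 26, 1, 66, 23, 26, 25, 43, 40, 34, 10] =
    [45, 60, 64, 26, 25, 61, 25, 39, 49, 47, 0, 48, 25, 11]"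
  "frobv [45, 60, 64, 26, 25, 61, 25, 39, 49, 47, 0, 48, 25, 11] =
    [8, 59, 65, 28, 15, 5, 14, 30, 46, 50, 6, 33, 65, 64]"
  "frobv [8, 59, 65, 28, 15, 5, 14, 30, 46, 50, 6, 33, 65, 64] =
    [0, 1, 0, 0, 0, 0, 0, 0, 0, 0, 0, 0, 0, 0]"
  by code_simp+

lemma frobv_pow_13: "(frobv ^^ 13) Xv = Xv"
  by (simp add: eval_nat_numeral frobv_Xv frobv_steps) (simp add: Xv_def)

lemma cong67_frobv_pow:
  "length ((frobv ^^ n) Xv) = 14 \<and> cong67 (Poly ((frobv ^^ n) Xv)) (monom 1 (67 ^ n))"
proof (induction n)
  case 0
  show ?case by (simp add: Xv_def monom_altdef cong67_refl)
next
  case (Suc n)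
  then have "cong67 (Poly ((frobv ^^ Suc n) Xv)) (Poly ((frobv ^^ n) Xv) ^ 67)"
    using cong67_frobv by simp
  also have "cong67 \<dots> (monom 1 (67 ^ n) ^ 67)"
    using Suc cong67_power by blast
  also have "monom 1 (67 ^ n) ^ 67 = (monom 1 (67 ^ Suc n) :: int poly)"
    by (simp add: monom_power mult.commute)
  finally show ?case using Suc length_frobv by simp
qed

text \<open>Modulo 67, \<open>paw_poly\<close> divides \<open>X ^ (67 ^ 13) - X\<close>; so its
  irreducible factors are distinct and have degree 1 or 13.\<close>

lemma frobenius_13: "cong67 (monom 1 (67 ^ 13)) (monom 1 1)"
proof -
  have "Poly Xv = monom 1 1" by (simp add: Xv_def monom_altdef)
  then show ?thesis
    using cong67_frobv_pow[of 13] unfolding frobv_pow_13 by (metis cong67_sym)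
qed

text \<open>A Bezout identity modulo 67 for \<open>paw_poly\<close> and \<open>X ^ 67 - X\<close>: a
  root whose residue is fixed by Frobenius has residue 11. The multiple of 67 is what the two
  cofactors leave over the integers.\<close>

lemma fixed_root_certificate:
  "\<exists>U V K. [:-11, 1:] = paw_poly * U + (monom 1 67 - monom 1 1) * V + smult 67 (K :: int poly)"
proof -
  have "cong67 (monom 1 67) (Poly [64, 6, 46, 16, 8, 0, 63, 66, 56, 65, 55, 29, 47, 5])"
    using cong67_frobv_pow[of 1] frobv_Xv cong67_sym by simp
  then obtain h k where hk: "monom 1 67 - Poly [64, 6, 46, 16, 8, 0, 63, 66, 56, 65, 55, 29, 47, 5] = paw_poly * h + smult 67 k"
    unfolding cong67_def by blast
  define U where "U = Poly [9, 62, 25, 3, 25, 49, 51, 1, 43, 28, 6, 57 :: int]"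
  define V where "V = Poly [30, 52, 1, 18, 37, 26, 65, 29, 33, 62, 40, 60, 49 :: int]"
  define K where "K = Poly [-12041, 9737241, 138985152, 687457497, 1598743545, 2404329845, 2976561588, 3429119668, 3229714980, 3025047011, 3426655487, 3767179061, 3353856287, 2658890167, 2694518760, 2422910179, 1704753927, 1214465809, 238852466, -345652757, -295085094, -137369763, -44527102, -9518330, -1404701, -120266 :: int]"
  have *: "[:-11, 1:] = paw_poly * U + (Poly [64, 6, 46, 16, 8, 0, 63, 66, 56, 65, 55, 29, 47, 5] - monom 1 1) * V + smult 67 K"
    by (simp add: paw_poly_def paw_coeffs_def U_def V_def K_def monom_altdef)
  have eq: "Poly [64, 6, 46, 16, 8, 0, 63, 66, 56, 65, 55, 29, 47, 5] = monom 1 67 - (paw_poly * h + smult 67 k)"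
    using hk by (simp add: algebra_simps)
  have "[:-11, 1:] = paw_poly * (U - h * V) + (monom 1 67 - monom 1 1) * V + smult 67 (K - k * V)"
    unfolding * eq by (simp add: algebra_simps smult_diff_right)
  then show ?thesis by blast
qed

section \<open>Evaluation of integer polynomials and its reduction\<close>

definition iev :: "int poly \<Rightarrow> 'a :: comm_ring_1 \<Rightarrow> 'a" where
  "iev a z = poly (map_poly of_int a) z"

lemma iev_pCons [simp]: "iev (pCons c a) z = of_int c + z * iev a z"
  by (simp add: iev_def map_poly_pCons)

lemma iev_0 [simp]: "iev 0 z = 0"
  by (simp add: iev_def)

lemma iev_add: "iev (a + b) z = iev a z + iev b z"
proof (induction a arbitrary: b)
  case (pCons c a)
  show ?case
  proof (cases b)
    case (pCons d b')
    then show ?thesis using pCons.IH[of b'] by (simp add: algebra_simps)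
  qed
qed simp

lemma iev_smult: "iev (smult c a) z = of_int c * iev a z"
  by (induction a) (simp_all add: algebra_simps)

lemma iev_diff: "iev (a - b) z = iev a z - iev b z"
  using iev_add[of "a - b" b z] by simp

lemma iev_mult: "iev (a * b) z = iev a z * iev b z"
  by (induction a) (simp_all add: algebra_simps iev_add iev_smult)

lemma iev_monom: "iev (monom c n) z = of_int c * z ^ n"
  by (induction n) (simp_all add: monom_0 monom_Suc)

lemma iev_of_int: "iev a (of_int c) = of_int (poly a c)"
  by (induction a) simp_all

lemma iev_Poly: "iev (Poly xs) z = (\<Sum>i<length xs. of_int (xs ! i) * z ^ i)"
  by (induction xs) (simp_all add: sum.lessThan_Suc_shift sum_distrib_left mult_ac del: sum.lessThan_Suc)

context integral_model
begin

lemma iev_B: "z \<in> B \<Longrightarrow> iev a z \<in> B"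
  by (induction a) (auto intro: B_zero B_add B_mult B_of_int)

lemma iev_mcong: "z \<simeq> w \<Longrightarrow> z \<in> B \<Longrightarrow> w \<in> B \<Longrightarrow> iev a z \<simeq> iev a w"
  by (induction a) (auto intro!: mcong_refl mcong_add mcong_mult iev_B)

text \<open>First-order expansion with remainder in \<open>B\<close>. It serves to show that two
  distinct roots congruent modulo \<open>m\<close> would force the derivative into
  \<open>m\<close>.\<close>

lemma iev_Taylor:
  assumes "z \<in> B" "w \<in> B"
  shows "\<exists>c\<in>B. iev a w = iev a z + iev (pderiv a) z * (w - z) + (w - z)\<^sup>2 * c"
proof (induction a)
  case 0
  show ?case using B_zero by force
next
  case (pCons k q)
  then obtain c where c: "c \<in> B" "iev q w = iev q z + iev (pderiv q) z * (w - z) + (w - z)\<^sup>2 * c" by blast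
  have expand: "k' + w * (Q + D * (w - z) + (w - z)\<^sup>2 * c) =
      k' + z * Q + (Q + z * D) * (w - z) + (w - z)\<^sup>2 * (D + z * c + (w - z) * c)" for k' Q D
    by (simp add: power2_eq_square algebra_simps)
  have "iev (pCons k q) w = of_int k + w * iev q w" by simp
  also have "\<dots> = iev (pCons k q) z + iev (pderiv (pCons k q)) z * (w - z) +
      (w - z)\<^sup>2 * (iev (pderiv q) z + z * c + (w - z) * c)"
    unfolding c(2) expand by (simp add: pderiv_pCons iev_add)
  finally have "iev (pCons k q) w = iev (pCons k q) z + iev (pderiv (pCons k q)) z * (w - z) +
      (w - z)\<^sup>2 * (iev (pderiv q) z + z * c + (w - z) * c)" .
  moreover have "iev (pderiv q) z + z * c + (w - z) * c \<in> B"
    using c(1) assms by (intro B_add B_mult B_diff iev_B)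
  ultimately show ?case by blast
qed

text \<open>By Bezout the denominator is invertible modulo \<open>p\<close>, so rational elements of
  \<open>B\<close> have residues in the prime field.\<close>

lemma rational_residue:
  assumes "x \<in> B" "x \<in> \<rat>"
  shows "\<exists>c. 0 \<le> c \<and> c < int p \<and> x \<simeq> of_int c"
proof -
  obtain a b where ab: "x = of_int a / of_int b" "\<not> int p dvd b"
    using B_Rats[OF assms] unfolding localint_def by blast
  have "b \<noteq> 0" using ab(2) by auto
  have "coprime b (int p)" using ab(2) prime_int_p[OF prime] prime_imp_coprime coprime_commute by blast
  then obtain u v where uv: "u * b + v * int p = 1" by (metis bezout_int coprime_iff_gcd_eq_1)
  have "x * of_int b = of_int a" using ab(1) \<open>b \<noteq> 0\<close> by simp
  then have "x - of_int (a * u) = x * of_int (u * b + v * int p) - x * of_int b * of_int u"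
    unfolding uv by simp
  also have "\<dots> = of_nat p * (x * of_int v)" by (simp add: algebra_simps)
  finally have 1: "x \<simeq> of_int (a * u)"
    using m_ideal[OF m_p B_mult[OF assms(1) B_of_int[of v]]] by (simp add: mcong_def)
  have "int p dvd a * u - a * u mod int p" by (simp add: minus_mod_eq_mult_div)
  then have 2: "of_int (a * u) \<simeq> of_int (a * u mod int p)"
    unfolding mcong_def of_int_diff[symmetric] of_int_m_iff .
  have "int p > 0" using prime_gt_0_nat[OF prime] by simp
  then show ?thesis using mcong_trans[OF 1 2] by (intro exI[of _ "a * u mod int p"]) simp
qed

end

section \<open>The roots of the polynomial\<close>

definition paw_roots :: "complex set" where
  "paw_roots = {z. iev paw_poly z = 0}"

text \<open>The leading coefficient is a unit at \<open>p\<close>; dividing by it gives an integral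
  equation over \<open>localint p\<close>.\<close>

lemma paw_roots_relation:
  assumes "z \<in> paw_roots" "prime p" "\<not> int p dvd 141361"
  shows "\<exists>r. (\<forall>i<14. r i \<in> localint p) \<and> z ^ 14 = (\<Sum>i<14. r i * z ^ i)"
proof (intro exI conjI allI impI)
  define r where "r i = (of_int (- (paw_coeffs ! i)) / of_int 141361 :: complex)" for i
  show "r i \<in> localint p" for i
    unfolding r_def by (rule localint_divide_int[OF assms(2) localint_of_int[OF assms(2)] assms(3)])
  have "{..<15} = insert 14 {..<(14::nat)}" by auto
  moreover have "length paw_coeffs = 15" "paw_coeffs ! 14 = 141361" by (simp_all add: paw_coeffs_def)
  ultimately have "141361 * z ^ 14 + (\<Sum>i<14. of_int (paw_coeffs ! i) * z ^ i) = 0"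
    using assms(1) by (simp add: paw_roots_def paw_poly_def iev_Poly)
  then have "141361 * z ^ 14 = 141361 * (\<Sum>i<14. r i * z ^ i)"
    by (simp add: r_def sum_distrib_left add_eq_0_iff sum_negf)
  then show "z ^ 14 = (\<Sum>i<14. r i * z ^ i)" by simp
qed

lemma degree_paw_poly: "degree paw_poly = 14"
  by (simp add: paw_poly_def paw_coeffs_def)

lemma finite_paw_roots: "finite paw_roots"
proof -
  have "map_poly of_int paw_poly \<noteq> (0 :: complex poly)"
    using degree_paw_poly by (simp add: map_poly_eq_0_iff) (auto)
  then show ?thesis unfolding paw_roots_def iev_def by (rule poly_roots_finite)
qed

lemma poly_Poly: "poly (Poly xs) c = foldr (\<lambda>a x. a + c * x) xs 0"
  by (induction xs) simp_all

text \<open>No root modulo 29, hence no rational root. The prime 67 cannot serve here, because 11 is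
  a root modulo 67.\<close>

lemma paw_coeffs_residues_29: "list_all (\<lambda>c. foldr (\<lambda>a x. a + c * x) paw_coeffs 0 mod 29 \<noteq> 0) [0..28]"
  by code_simp

lemma paw_roots_irrational: "z \<in> paw_roots \<Longrightarrow> z \<notin> \<rat>"
proof
  assume z: "z \<in> paw_roots" "z \<in> \<rat>"
  have "prime (29 :: nat)" by simp
  from integral_model_exists[OF this finite_paw_roots _ paw_roots_relation[OF _ this]]
  obtain B m where B: "paw_roots \<subseteq> B" "integral_model 29 B m" by auto
  interpret integral_model 29 B m by (rule B(2))
  obtain c where c: "0 \<le> c" "c < 29" "mcong z (of_int c)" using rational_residue[of z] z B(1) by auto
  have "mcong (iev paw_poly z) (iev paw_poly (of_int c))"
    using iev_mcong[OF c(3)] z(1) B(1) B_of_int by auto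
  then have "of_int (poly paw_poly c) \<in> m"
    using z(1) m_uminus by (fastforce simp: paw_roots_def mcong_def iev_of_int)
  then have "poly paw_poly c mod 29 = 0" using of_int_m_iff by auto
  then show False
    using paw_coeffs_residues_29 c by (auto simp: list_all_iff paw_poly_def poly_Poly)
qed

lemma paw_poly_root_not_radical:
  assumes z: "iev paw_poly z = 0"
  shows "z \<notin> radical_computable"
proof
  assume rad: "z \<in> radical_computable"
  have "prime (67 :: nat)" by simp
  from integral_model_exists[OF this finite_paw_roots _ paw_roots_relation[OF _ this]]
  obtain B m where B: "paw_roots \<subseteq> B" "integral_model 67 B m" by auto
  interpret integral_model 67 B m by (rule B(2))
  have m67: "67 * x \<in> m" if "x \<in> B" for x
    using m_ideal[OF m_p that] by simp
  obtain h k where hk: "monom 1 (67 ^ 13) - monom 1 1 = paw_poly * h + smult 67 k"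
    using frobenius_13 unfolding cong67_def by blast
  \<comment> \<open>The derivative of \<open>X ^ (67 ^ 13) - X\<close> is -1 modulo 67. So at a root
    \<open>y\<close> the derivative of \<open>paw_poly\<close> times \<open>h(y)\<close> is
    congruent to -1 and cannot vanish modulo \<open>m\<close>.\<close>
  have simple: "iev (pderiv paw_poly) y \<notin> m" if y: "y \<in> paw_roots" for y
  proof
    assume d: "iev (pderiv paw_poly) y \<in> m"
    have yB: "y \<in> B" using y B(1) by blast
    have "pderiv (monom 1 (67 ^ 13) - monom (1 :: int) 1) = monom (67 ^ 13) (67 ^ 13 - 1) - 1"
      by (simp add: pderiv_diff pderiv_monom one_pCons monom_0)
    moreover have "pderiv (paw_poly * h + smult 67 k) = paw_poly * pderiv h + pderiv paw_poly * h + smult 67 (pderiv k)"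
      by (simp add: pderiv_add pderiv_mult pderiv_smult mult.commute)
    ultimately have "monom (67 ^ 13) (67 ^ 13 - 1) - 1 =
        paw_poly * pderiv h + pderiv paw_poly * h + smult 67 (pderiv k)"
      unfolding hk by (simp only:)
    from arg_cong[OF this, of "\<lambda>a. iev a y"]
    have "67 * (67 ^ 12 * y ^ (67 ^ 13 - 1)) - 1 = iev (pderiv paw_poly) y * iev h y + 67 * iev (pderiv k) y"
      using y unfolding paw_roots_def
      by (simp add: iev_diff iev_add iev_mult iev_smult iev_monom one_pCons del: power_Suc)
    then have "1 = 67 * (67 ^ 12 * y ^ (67 ^ 13 - 1)) - (iev (pderiv paw_poly) y * iev h y + 67 * iev (pderiv k) y)"
      by (simp add: algebra_simps)
    also have "\<dots> \<in> m"
    proof (intro m_diff m_add)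
      have "67 ^ 12 * y ^ (67 ^ 13 - 1) \<in> B" using B_of_nat[of "67 ^ 12"] B_power[OF yB] B_mult by simp
      then show "67 * (67 ^ 12 * y ^ (67 ^ 13 - 1)) \<in> m" by (rule m67)
      show "iev (pderiv paw_poly) y * iev h y \<in> m" using m_ideal[OF d] iev_B[OF yB] by blast
      show "67 * iev (pderiv k) y \<in> m" using m67 iev_B[OF yB] by blast
    qed
    finally show False using m_one by simp
  qed
  have distinct: "x = y" if xy: "x \<in> paw_roots" "y \<in> paw_roots" "mcong x y" for x y
  proof (rule ccontr)
    assume "x \<noteq> y"
    have xyB: "x \<in> B" "y \<in> B" using xy B(1) by auto
    obtain c where c: "c \<in> B" "iev paw_poly y = iev paw_poly x + iev (pderiv paw_poly) x * (y - x) + (y - x)\<^sup>2 * c"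
      using iev_Taylor[OF xyB] by blast
    then have "(y - x) * (iev (pderiv paw_poly) x + (y - x) * c) = 0"
      using xy by (simp add: paw_roots_def algebra_simps power2_eq_square)
    then have "iev (pderiv paw_poly) x + (y - x) * c = 0"
      using \<open>x \<noteq> y\<close> unfolding mult_eq_0_iff by auto
    then have "iev (pderiv paw_poly) x = (x - y) * c"
      by (simp add: algebra_simps eq_neg_iff_add_eq_0)
    then have "iev (pderiv paw_poly) x \<in> m" using xy(3) c(1) m_ideal by (simp add: mcong_def)
    then show False using simple xy(1) by blast
  qed
  define f where "f = (map_poly of_int paw_poly :: complex poly)"
  have degf: "degree f = 14"
    unfolding f_def using degree_paw_poly by (subst degree_map_poly) auto
  have roots: "paw_roots = {z. poly f z = 0}" by (simp add: paw_roots_def iev_def f_def)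
  have pd: "pderiv f = map_poly of_int (pderiv paw_poly)"
    unfolding f_def by (rule poly_eqI) (simp add: coeff_pderiv coeff_map_poly)
  \<comment> \<open>At a multiple complex root the derivative would be 0, an element of
    \<open>m\<close>. Squarefreeness yields exactly 14 roots.\<close>
  have sqf: "rsquarefree f"
    unfolding rsquarefree_roots
  proof (intro allI notI)
    fix a assume "poly f a = 0 \<and> poly (pderiv f) a = 0"
    then show False using simple[of a] m_zero unfolding roots pd by (simp add: iev_def)
  qed
  have "f = smult (lead_coeff f) (\<Prod>z\<in>paw_roots. [:- z, 1:])"
    unfolding roots using complex_poly_decompose_rsquarefree[OF sqf] by simp
  moreover have "degree (\<Prod>z\<in>paw_roots. [:- z, 1:]) = card paw_roots"
    by (subst degree_prod_sum_eq) auto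
  ultimately have "card paw_roots = 14"
    using degf by (metis degree_smult_eq leading_coeff_0_iff degree_0 zero_neq_numeral)
  interpret frobenius_13 67 B m paw_roots
  proof
    show "paw_roots \<subseteq> Qbar"
    proof
      fix y assume "y \<in> paw_roots"
      then have "poly f y = 0" by (simp add: roots)
      moreover have "\<forall>i. coeff f i \<in> Qbar" by (simp add: f_def coeff_map_poly Qbar_of_int)
      moreover have "f \<noteq> 0" using degf by auto
      ultimately show "y \<in> Qbar" using Qbar_root by blast
    qed
    then show "\<sigma> y \<in> paw_roots" if "\<sigma> \<in> Gal" "y \<in> paw_roots" for \<sigma> y
    proof -
      have yOm: "y \<in> Qbar" using \<open>paw_roots \<subseteq> Qbar\<close> that by blast
      have "iev a y \<in> Qbar \<and> \<sigma> (iev a y) = iev a (\<sigma> y)" for a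
        by (induction a)
           (use yOm that(1) in \<open>auto simp: Gal_zero Gal_add Gal_mult Gal_of_int Qbar_zero Qbar_add Qbar_mult Qbar_of_int\<close>)
      then show ?thesis using that Gal_zero[OF that(1)] by (metis (mono_tags, lifting) paw_roots_def mem_Collect_eq)
    qed
  next
    fix y assume y: "y \<in> paw_roots"
    then have yB: "y \<in> B" using B(1) by blast
    from arg_cong[OF hk, of "\<lambda>a. iev a y"]
    have "y ^ (67 ^ 13) - y = 67 * iev k y"
      using y by (simp add: iev_diff iev_add iev_mult iev_smult iev_monom paw_roots_def)
    then show "mcong (y ^ (67 ^ 13)) y"
      using m67 iev_B[OF yB] by (simp add: mcong_def)
  next
    have fixed: "mcong y 11" if y: "y \<in> paw_roots" "mcong (y ^ 67) y" for y
    proof -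
      have yB: "y \<in> B" using B(1) y by blast
      obtain U V K where "[:-11, 1:] = paw_poly * U + (monom 1 67 - monom 1 1) * V + smult 67 K"
        using fixed_root_certificate by blast
      from arg_cong[OF this, of "\<lambda>a. iev a y"]
      have "y - 11 = (y ^ 67 - y) * iev V y + 67 * iev K y"
        using y by (simp add: iev_diff iev_add iev_mult iev_smult iev_monom paw_roots_def)
      also have "\<dots> \<in> m"
        using y(2) by (intro m_add m_ideal m67 iev_B[OF yB]) (simp add: mcong_def)
      finally show ?thesis by (simp add: mcong_def)
    qed
    show "x = y" if "x \<in> paw_roots" "y \<in> paw_roots" "mcong (x ^ 67) x" "mcong (y ^ 67) y" for x y
      using distinct fixed that mcong_sym mcong_trans by blast
  qed (use finite_paw_roots \<open>card paw_roots = 14\<close> B(1) paw_roots_irrational in auto)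
  obtain n where "\<forall>c\<in>Der n. c z = z" using radical_computable_Der[OF rad] by blast
  then show False using not_fixed_by_Der[of z n] z by (simp add: paw_roots_def)
qed

section \<open>Existence and algebraicity of the stress\<close>

text \<open>At an interior fixed point of the clamped step, \<open>d\<close> vanishes; at an end
  point the sign of \<open>d\<close> pushes inwards, so there is no fixed point.\<close>

lemma fixpoint_clamp:
  fixes l h x d :: real
  assumes "l < h" "x = max l (min h (x - d))" "x = l \<Longrightarrow> d < 0" "x = h \<Longrightarrow> d > 0"
  shows "d = 0"
  using assms by (auto simp: max_def min_def split: if_splits)

text \<open>The Poincare-Miranda theorem, from Brouwer's theorem for the map
  \<open>z - (f z, g z)\<close> clamped to the rectangle.\<close>

lemma two_dim_intermediate_value:
  fixes f g :: "real \<Rightarrow> real \<Rightarrow> real"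
  assumes "a < b" "c < d"
    and cont: "continuous_on ({a..b} \<times> {c..d}) (\<lambda>z. f (fst z) (snd z))"
      "continuous_on ({a..b} \<times> {c..d}) (\<lambda>z. g (fst z) (snd z))"
    and f: "\<And>y. y \<in> {c..d} \<Longrightarrow> f a y < 0" "\<And>y. y \<in> {c..d} \<Longrightarrow> f b y > 0"
    and g: "\<And>x. x \<in> {a..b} \<Longrightarrow> g x c < 0" "\<And>x. x \<in> {a..b} \<Longrightarrow> g x d > 0"
  shows "\<exists>x\<in>{a..b}. \<exists>y\<in>{c..d}. f x y = 0 \<and> g x y = 0"
proof -
  define S where "S = {a..b} \<times> {c..d}"
  define F where "F z = (max a (min b (fst z - f (fst z) (snd z))), max c (min d (snd z - g (fst z) (snd z))))" for z
  obtain z where "z \<in> S" "F z = z"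
  proof (rule brouwer)
    show "compact S" unfolding S_def by (intro compact_Times compact_Icc)
    show "convex S" unfolding S_def by (intro convex_Times convex_real_interval)
    show "S \<noteq> {}" using assms(1,2) by (auto simp: S_def)
    show "continuous_on S F"
      unfolding F_def using cont unfolding S_def[symmetric] by (intro continuous_intros)
    show "F \<in> S \<rightarrow> S" using assms(1,2) by (auto simp: S_def F_def)
  qed
  then obtain x y where xy: "x \<in> {a..b}" "y \<in> {c..d}"
    "x = max a (min b (x - f x y))" "y = max c (min d (y - g x y))"
    by (cases z) (auto simp: S_def F_def)
  have "f x y = 0" using fixpoint_clamp[OF assms(1) xy(3)] f xy(2) by auto
  moreover have "g x y = 0" using fixpoint_clamp[OF assms(2) xy(4)] g xy(1) by auto
  ultimately show ?thesis using xy(1,2) by blast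
qed

text \<open>The stresses of the edges \<open>03\<close>, \<open>01\<close>, \<open>12\<close> and of the pair \<open>13\<close> determine the lengths
  \<open>1 / stP\<close>, \<open>1 / stQ\<close>, \<open>1 / (1 + w)\<close> and \<open>2 / stS\<close>.\<close>

definition stP :: "real \<Rightarrow> real \<Rightarrow> real" where "stP t w = 1 - w * (t * (t + 2))"
definition stQ :: "real \<Rightarrow> real \<Rightarrow> real" where "stQ t w = 1 - w * (t + 2)"
definition stS :: "real \<Rightarrow> real \<Rightarrow> real" where "stS t w = 1 + 4 * (w * t)"

lemma div_square_le: "0 \<le> c \<Longrightarrow> c \<le> c' \<Longrightarrow> 0 < l \<Longrightarrow> l \<le> x \<Longrightarrow> c / x\<^sup>2 \<le> c' / l\<^sup>2" for c c' l x :: real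
  by (intro frac_le power_mono) auto

text \<open>Keeps the denominators away from zero on the rectangle that is to contain the
  solution.\<close>

lemma stress_bounds:
  assumes "t \<in> {67/40..71/40}" "w \<in> {13/10000..43/10000}"
  shows "stP t w \<ge> 19/20" "stQ t w \<ge> 49/50" "stS t w \<ge> 1"
proof -
  have "t * (t + 2) \<le> 71/40 * (71/40 + 2)" using assms by (intro mult_mono) auto
  then have "w * (t * (t + 2)) \<le> 43/10000 * (71/40 * (71/40 + 2))" using assms by (intro mult_mono) auto
  then show "stP t w \<ge> 19/20" unfolding stP_def by (simp add: field_simps)
  have "w * (t + 2) \<le> 43/10000 * (71/40 + 2)" using assms by (intro mult_mono) auto
  then show "stQ t w \<ge> 49/50" unfolding stQ_def by simp
  show "stS t w \<ge> 1" unfolding stS_def using assms by simp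
qed

text \<open>Pythagoras, times 4, in the isosceles triangles 012 and 312 over the common base 12. The
  first expression changes sign with \<open>t\<close>, the second with \<open>w\<close>; on each
  side of the rectangle every term is bounded by its extreme value.\<close>

lemma stress_exists:
  "\<exists>t\<in>{67/40..71/40}. \<exists>w\<in>{13/10000..43/10000}.
     t\<^sup>2 / (stP t w)\<^sup>2 + 1 / (1 + w)\<^sup>2 - 4 / (stQ t w)\<^sup>2 = 0 \<and>
     (t + 2)\<^sup>2 / (stP t w)\<^sup>2 + 1 / (1 + w)\<^sup>2 - 16 / (stS t w)\<^sup>2 = 0"
proof (rule two_dim_intermediate_value)
  let ?S = "{67/40..71/40} \<times> {13/10000..43/10000} :: (real \<times> real) set"
  have nz: "(stP (fst z) (snd z))\<^sup>2 \<noteq> 0" "(stQ (fst z) (snd z))\<^sup>2 \<noteq> 0" "(stS (fst z) (snd z))\<^sup>2 \<noteq> 0"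
    "(1 + snd z)\<^sup>2 \<noteq> 0" if "z \<in> ?S" for z
    using stress_bounds[of "fst z" "snd z"] that by auto
  have c: "continuous_on ?S (\<lambda>z. stP (fst z) (snd z))" "continuous_on ?S (\<lambda>z. stQ (fst z) (snd z))"
     "continuous_on ?S (\<lambda>z. stS (fst z) (snd z))"
    unfolding stP_def stQ_def stS_def by (intro continuous_intros)+
  show "continuous_on ?S (\<lambda>z. (fst z)\<^sup>2 / (stP (fst z) (snd z))\<^sup>2 + 1 / (1 + snd z)\<^sup>2 - 4 / (stQ (fst z) (snd z))\<^sup>2)"
    using nz c by (intro continuous_intros) blast+
  show "continuous_on ?S (\<lambda>z. (fst z + 2)\<^sup>2 / (stP (fst z) (snd z))\<^sup>2 + 1 / (1 + snd z)\<^sup>2 - 16 / (stS (fst z) (snd z))\<^sup>2)"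
    using nz c by (intro continuous_intros) blast+
next
  fix w :: real assume w: "w \<in> {13/10000..43/10000}"
  let ?t = "67/40 :: real"
  have "stP ?t w \<ge> 1 - 43/10000 * (67/40 * (67/40 + 2))" unfolding stP_def using w by simp
  then have "?t\<^sup>2 / (stP ?t w)\<^sup>2 \<le> ?t\<^sup>2 / (1 - 43/10000 * (67/40 * (67/40 + 2)))\<^sup>2"
    by (intro div_square_le) auto
  moreover have "1 / (1 + w)\<^sup>2 \<le> 1 / (1 + 13/10000)\<^sup>2" using w by (intro div_square_le) auto
  moreover have "4 / (1 - 13/10000 * (67/40 + 2))\<^sup>2 \<le> 4 / (stQ ?t w)\<^sup>2"
    by (rule div_square_le) (use w stress_bounds[of ?t w] in \<open>auto simp: stQ_def\<close>)
  ultimately show "?t\<^sup>2 / (stP ?t w)\<^sup>2 + 1 / (1 + w)\<^sup>2 - 4 / (stQ ?t w)\<^sup>2 < 0"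
    by (simp add: power2_eq_square)
next
  fix w :: real assume w: "w \<in> {13/10000..43/10000}"
  let ?t = "71/40 :: real"
  have "?t\<^sup>2 / (1 - 13/10000 * (71/40 * (71/40 + 2)))\<^sup>2 \<le> ?t\<^sup>2 / (stP ?t w)\<^sup>2"
    by (rule div_square_le) (use w stress_bounds[of ?t w] in \<open>auto simp: stP_def\<close>)
  moreover have "1 / (1 + 43/10000)\<^sup>2 \<le> 1 / (1 + w)\<^sup>2" using w by (intro div_square_le) auto
  moreover have "4 / (stQ ?t w)\<^sup>2 \<le> 4 / (1 - 43/10000 * (71/40 + 2))\<^sup>2"
    by (rule div_square_le) (use w in \<open>auto simp: stQ_def\<close>)
  ultimately show "?t\<^sup>2 / (stP ?t w)\<^sup>2 + 1 / (1 + w)\<^sup>2 - 4 / (stQ ?t w)\<^sup>2 > 0"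
    by (simp add: power2_eq_square)
next
  fix t :: real assume t: "t \<in> {67/40..71/40}"
  let ?w = "13/10000 :: real"
  have tt: "t * (t + 2) \<le> 71/40 * (71/40 + 2)" using t by (intro mult_mono) auto
  have "(t + 2)\<^sup>2 / (stP t ?w)\<^sup>2 \<le> (71/40 + 2)\<^sup>2 / (1 - 13/10000 * (71/40 * (71/40 + 2)))\<^sup>2"
    by (rule div_square_le) (use t tt in \<open>auto simp: stP_def intro!: power_mono\<close>)
  moreover have "16 / (1 + 4 * (13/10000 * (71/40)))\<^sup>2 \<le> 16 / (stS t ?w)\<^sup>2"
    by (rule div_square_le) (use t in \<open>auto simp: stS_def\<close>)
  ultimately show "(t + 2)\<^sup>2 / (stP t ?w)\<^sup>2 + 1 / (1 + ?w)\<^sup>2 - 16 / (stS t ?w)\<^sup>2 < 0"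
    by (simp add: power2_eq_square)
next
  fix t :: real assume t: "t \<in> {67/40..71/40}"
  let ?w = "43/10000 :: real"
  have tt: "67/40 * (67/40 + 2) \<le> t * (t + 2)" using t by (intro mult_mono) auto
  have "(67/40 + 2)\<^sup>2 / (1 - 43/10000 * (67/40 * (67/40 + 2)))\<^sup>2 \<le> (t + 2)\<^sup>2 / (stP t ?w)\<^sup>2"
    by (rule div_square_le) (use t tt stress_bounds[of t ?w] in \<open>auto simp: stP_def intro!: power_mono\<close>)
  moreover have "16 / (stS t ?w)\<^sup>2 \<le> 16 / (1 + 4 * (43/10000 * (67/40)))\<^sup>2"
    by (rule div_square_le) (use t in \<open>auto simp: stS_def\<close>)
  ultimately show "(t + 2)\<^sup>2 / (stP t ?w)\<^sup>2 + 1 / (1 + ?w)\<^sup>2 - 16 / (stS t ?w)\<^sup>2 > 0"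
    by (simp add: power2_eq_square)
qed auto

section \<open>Elimination of \<open>w\<close>\<close>

definition bipoly :: "int list list \<Rightarrow> int poly poly" where
  "bipoly xss = Poly (map Poly xss)"

text \<open>A bivariate polynomial is one in \<open>w\<close> whose coefficients are integer
  polynomials in \<open>t\<close>.\<close>

definition biev :: "int poly poly \<Rightarrow> real \<Rightarrow> real \<Rightarrow> real" where
  "biev a t w = poly (map_poly (\<lambda>c. iev c t) a) w"

lemma biev_pCons: "biev (pCons c a) t w = iev c t + w * biev a t w"
  by (simp add: biev_def map_poly_pCons)

lemma biev_0: "biev 0 t w = 0"
  by (simp add: biev_def)

lemma biev_add: "biev (a + b) t w = biev a t w + biev b t w"
proof (induction a arbitrary: b)
  case (pCons c a)
  show ?case
  proof (cases b)
    case (pCons d b')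
    then show ?thesis using pCons.IH[of b'] by (simp add: algebra_simps biev_pCons iev_add)
  qed
qed (simp add: biev_0)

lemma biev_mult: "biev (a * b) t w = biev a t w * biev b t w"
proof (induction a)
  case (pCons c a)
  have "biev (smult c b) t w = iev c t * biev b t w"
    by (induction b) (simp_all add: biev_pCons biev_0 iev_mult algebra_simps)
  with pCons show ?case by (simp add: algebra_simps biev_pCons biev_add biev_0)
qed (simp add: biev_0)

definition bP :: "int poly poly" where "bP = bipoly [[1], [0, -2, -1]]"
definition bQ :: "int poly poly" where "bQ = bipoly [[1], [-2, -1]]"
definition bS :: "int poly poly" where "bS = bipoly [[1], [0, 4]]"
definition bM :: "int poly poly" where "bM = bipoly [[1], [1]]"
definition bT :: "int poly poly" where "bT = bipoly [[0, 1]]"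

text \<open>The first equation cleared of denominators.\<close>

definition bE1 :: "int poly poly" where
  "bE1 = [:[:4:]:] * (bP * bP * (bM * bM)) - bT * bT * (bQ * bQ * (bM * bM)) - bQ * bQ * (bP * bP)"

text \<open>The difference of the two equations, in which the term with \<open>1 + w\<close>
  cancels, cleared of denominators and divided by 4. The factor \<open>t + 1\<close> comes from
  \<open>(t + 2)^2 - t^2 = 4 (t + 1)\<close>.\<close>

definition bE2 :: "int poly poly" where
  "bE2 = [:[:4:]:] * (bP * bP * (bQ * bQ)) - bP * bP * (bS * bS) - (bT + 1) * (bS * bS * (bQ * bQ))"

text \<open>Cofactors of the resultant of the two equations with respect to \<open>w\<close>, divided by their common
  content.\<close>

definition bA :: "int poly poly" where
  "bA = bipoly [
      [-19440, 15890688, 117024840, 142320072, -257403567, 115394554, -43326699, -270132778,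
      457866563, 316487172, -39475724, -115843324, -75392307, -27699230, -7496849, -1134018,
      -141361],
      [15552, -12636000, -156655296, -201888432, 890866908, -1276700598, -3829765502,
      -3587620322, -6392711048, -5684114002, -94570690, 2002803728, 1130926982, 422660570,
      105095408, 10607122, 1120150, -282722],
      [0, -124416, 102207744, 338943744, -76819392, 2995168992, 7735364592, 8470386240,
      12465897612, 11422217244, 3324436260, -34167720, -1166032632, -1409719872, -691174008,
      -243184536, -68451156, -10187964, -1506588],
      [0, 0, 0, 0, -62208, 51145344, 135354240, -111574080, 1597708368, 2691452520, 2784730176,
      4017448224, 2524105440, -227559384, -913335840, -522029160, -199064304, -50445648,
      -7887456, -916920]]"

definition bB :: "int poly poly" where
  "bB = bipoly [
      [-15552, 12798000, 23399856, -97930440, 93705792, -361008993, -283091246, -34752059,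
      -399243514, 122652030, 263539780, 36619226, -10662516, -12138701, -6449158, -1040215,
      -219474],
      [0, 67392, -55434240, -127994688, 229232688, -1231096548, -797108428, -384053184,
      -1433043436, 448057166, 1200243248, 335372372, -31739056, -64490188, -37631620, -9893364,
      -1810612, -189054],
      [0, 0, -79056, 64959120, 172290120, -187598304, 1745588627, 3012783311, 3185100136,
      4699668637, 3108698811, -14595090, -1008088056, -674748030, -278258175, -78115085,
      -14936504, -1960447, -129151],
      [0, 0, 5184, -4241376, -28322784, -40082352, -107230524, -747559326, -1262354052,
      -1487318454, -1781552376, -1157192550, -58377672, 366910992, 266709732, 114061002,
      34061196, 6909366, 962928, 76410]]"

text \<open>A polynomial identity, checked by expansion. The extra factor vanishes only at 1 and -1,
  outside the interval for \<open>t\<close>.\<close>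

lemma elimination: "bA * bE1 + bB * bE2 = [:paw_poly * ([:-1, 1:] * [:-1, 1:] * [:-1, 1:] * [:1, 1:]):]"
  by (simp add: bA_def bB_def bE1_def bE2_def bP_def bQ_def bS_def bM_def bT_def bipoly_def paw_poly_def paw_coeffs_def one_pCons)

lemma stress_algebraic:
  assumes t: "t \<in> {67/40..71/40}" and w: "w \<in> {13/10000..43/10000}"
    and "t\<^sup>2 / (stP t w)\<^sup>2 + 1 / (1 + w)\<^sup>2 - 4 / (stQ t w)\<^sup>2 = 0"
    and "(t + 2)\<^sup>2 / (stP t w)\<^sup>2 + 1 / (1 + w)\<^sup>2 - 16 / (stS t w)\<^sup>2 = 0"
  shows "iev paw_poly t = 0"
proof -
  define P Q S M where "P = stP t w" "Q = stQ t w" "S = stS t w" "M = 1 + w"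
  have nz: "P \<noteq> 0" "Q \<noteq> 0" "S \<noteq> 0" "M \<noteq> 0"
    using stress_bounds[OF t w] w by (auto simp: P_Q_S_M_def)
  have ev: "biev bP t w = P" "biev bQ t w = Q" "biev bS t w = S" "biev bM t w = M" "biev bT t w = t"
    by (simp_all add: bP_def bQ_def bS_def bM_def bT_def bipoly_def biev_pCons biev_0 iev_pCons
        P_Q_S_M_def stP_def stQ_def stS_def algebra_simps)
  have uminus: "biev (- a) t w = - biev a t w" for a
    using biev_add[of a "- a" t w] by (simp add: biev_0)
  have diff: "biev (a - b) t w = biev a t w - biev b t w" for a b
    using biev_add[of a "- b" t w] uminus by simp
  have const: "biev [:[:4:]:] t w = 4" "biev 1 t w = 1"
    by (simp_all add: biev_pCons biev_0 iev_pCons one_pCons)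
  have 1: "t\<^sup>2 / P\<^sup>2 + 1 / M\<^sup>2 = 4 / Q\<^sup>2" and 2: "(t + 2)\<^sup>2 / P\<^sup>2 + 1 / M\<^sup>2 = 16 / S\<^sup>2"
    using assms(3,4) by (simp_all add: P_Q_S_M_def)
  have "(t + 2)\<^sup>2 / P\<^sup>2 - t\<^sup>2 / P\<^sup>2 = 4 * (t + 1) / P\<^sup>2"
    by (simp add: diff_divide_distrib[symmetric] power2_eq_square algebra_simps)
  with 1 2 have 3: "16 / S\<^sup>2 - 4 / Q\<^sup>2 = 4 * (t + 1) / P\<^sup>2" by linarith
  have "4 * (P\<^sup>2 * M\<^sup>2) = P\<^sup>2 * M\<^sup>2 * Q\<^sup>2 * (4 / Q\<^sup>2)" using nz by simp
  also have "\<dots> = t\<^sup>2 * (Q\<^sup>2 * M\<^sup>2) + Q\<^sup>2 * P\<^sup>2" unfolding 1[symmetric] using nz by (simp add: field_simps)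
  finally have "biev bE1 t w = 0"
    by (simp only: bE1_def diff biev_mult ev const) (simp add: power2_eq_square algebra_simps)
  moreover have "4 * (P\<^sup>2 * Q\<^sup>2) - P\<^sup>2 * S\<^sup>2 = (t + 1) * (S\<^sup>2 * Q\<^sup>2)"
  proof -
    have "4 * (P\<^sup>2 * Q\<^sup>2) - P\<^sup>2 * S\<^sup>2 = P\<^sup>2 * Q\<^sup>2 * S\<^sup>2 * (16 / S\<^sup>2 - 4 / Q\<^sup>2) / 4"
      using nz by (simp add: field_simps)
    also have "\<dots> = (t + 1) * (S\<^sup>2 * Q\<^sup>2)"
      unfolding 3 using nz by simp
    finally show ?thesis .
  qed
  then have "biev bE2 t w = 0"
    by (simp only: bE2_def diff biev_mult biev_add ev const) (simp add: power2_eq_square algebra_simps)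
  ultimately have "biev (bA * bE1 + bB * bE2) t w = 0"
    by (simp add: biev_mult biev_add)
  then have "iev paw_poly t * ((t - 1) * (t - 1) * (t - 1) * (t + 1)) = 0"
    by (simp only: elimination biev_pCons biev_0 iev_mult iev_pCons) (simp add: algebra_simps)
  moreover have "(t - 1) * (t - 1) * (t - 1) * (t + 1) \<noteq> 0" using t by simp
  ultimately show ?thesis by (simp only: mult_eq_0_iff) blast
qed

section \<open>The paw graph\<close>

definition paw :: "nat \<Rightarrow> nat \<Rightarrow> bool" where
  "paw i j \<longleftrightarrow> (i, j) \<in> {(0, 1), (1, 0), (0, 2), (2, 0), (1, 2), (2, 1), (0, 3), (3, 0)}"

lemma less_4_cases: "i < 4 \<longleftrightarrow> i = 0 \<or> i = 1 \<or> i = 2 \<or> i = (3 :: nat)"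
  by auto

lemma simple_graph_paw: "simple_graph 4 paw"
  by (auto simp: simple_graph_def paw_def)

lemma edge_rel_paw: "edge_rel 4 paw = {(0, 1), (1, 0), (0, 2), (2, 0), (1, 2), (2, 1), (0, 3), (3, 0)}"
  by (auto simp: edge_rel_def paw_def)

lemma graph_connected_paw: "graph_connected 4 paw"
proof -
  have "(i, 0) \<in> (edge_rel 4 paw)\<^sup>* \<and> (0, i) \<in> (edge_rel 4 paw)\<^sup>*" if "i < 4" for i
    using that unfolding less_4_cases edge_rel_paw by (auto intro: r_into_rtrancl)
  then show ?thesis unfolding graph_connected_def by (meson rtrancl_trans)
qed

lemma graph_dist_1:
  assumes "i \<noteq> j" "(i, j) \<in> edge_rel n G"
  shows "graph_dist n G i j = 1"
  unfolding graph_dist_def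
proof (rule Least_equality)
  show "1 \<le> m" if "(i, j) \<in> edge_rel n G ^^ m" for m
    using that assms(1) by (cases m) auto
qed (use assms in auto)

lemma graph_dist_2:
  assumes "i \<noteq> j" "(i, j) \<notin> edge_rel n G" "(i, k) \<in> edge_rel n G" "(k, j) \<in> edge_rel n G"
  shows "graph_dist n G i j = 2"
  unfolding graph_dist_def
proof (rule Least_equality)
  show "(i, j) \<in> edge_rel n G ^^ 2" using assms by (auto simp: numeral_2_eq_2)
  show "2 \<le> m" if "(i, j) \<in> edge_rel n G ^^ m" for m
  proof -
    have "m \<noteq> 0" using that assms(1) by (intro notI) auto
    moreover have "m \<noteq> 1" using that assms(2) by (intro notI) auto
    ultimately show ?thesis by simp
  qed
qed

lemma kk_energy_paw:
  "kk_energy 4 paw p = (cmod (p 0 - p 1) - 1)\<^sup>2 / 2 + (cmod (p 0 - p 2) - 1)\<^sup>2 / 2 + (cmod (p 0 - p 3) - 1)\<^sup>2 / 2 +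
     (cmod (p 1 - p 2) - 1)\<^sup>2 / 2 + (cmod (p 1 - p 3) - 2)\<^sup>2 / 8 + (cmod (p 2 - p 3) - 2)\<^sup>2 / 8"
proof -
  have "graph_dist 4 paw 0 1 = 1" "graph_dist 4 paw 0 2 = 1" "graph_dist 4 paw 0 3 = 1" "graph_dist 4 paw 1 2 = 1"
    by (rule graph_dist_1; simp add: edge_rel_paw)+
  moreover have "graph_dist 4 paw 1 3 = 2" "graph_dist 4 paw 2 3 = 2"
    by (rule graph_dist_2[of _ _ _ _ 0]; simp add: edge_rel_paw)+
  moreover have "{..<4} = {0, 1, 2, 3 :: nat}" "{0<..<4} = {1, 2, 3 :: nat}" "{1<..<4} = {2, 3 :: nat}"
    "{2<..<4} = {3 :: nat}" "{3<..<4} = ({} :: nat set)" by auto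
  ultimately show ?thesis unfolding kk_energy_def by (simp add: Let_def)
qed

section \<open>Energy bounds from a stress\<close>

text \<open>AM-GM: \<open>2 d x \<le> d (x\<^sup>2 / s + s)\<close>, with equality at \<open>x = s\<close>. Hence an equilibrium whose stress
  matrix is positive semidefinite is a global minimum.\<close>

lemma spring_energy_ge:
  fixes x d s :: real
  assumes "s > 0" "d \<ge> 0"
  shows "(1 - d / s) * x\<^sup>2 + d\<^sup>2 - d * s \<le> (x - d)\<^sup>2"
proof -
  have "(x - d)\<^sup>2 - ((1 - d / s) * x\<^sup>2 + d\<^sup>2 - d * s) = d * (x - s)\<^sup>2 / s"
    using assms(1) by (simp add: field_simps power2_eq_square)
  moreover have "d * (x - s)\<^sup>2 / s \<ge> 0" using assms by simp
  ultimately show ?thesis by linarith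
qed

lemma spring_energy_eq:
  fixes d s :: real
  assumes "s > 0"
  shows "(s - d)\<^sup>2 = (1 - d / s) * s\<^sup>2 + d\<^sup>2 - d * s"
  using assms by (simp add: field_simps power2_eq_square)

text \<open>The rank-one stress \<open>- \<lambda>\<^sub>i \<lambda>\<^sub>j\<close> with \<open>\<lambda> = (- (t + 2), 1, 1, t)\<close>.\<close>

lemma rank_one_stress:
  fixes q0 q1 q2 q3 :: complex and t :: real
  shows "t * (t + 2) * (cmod (q0 - q3))\<^sup>2 + (t + 2) * (cmod (q0 - q1))\<^sup>2 + (t + 2) * (cmod (q0 - q2))\<^sup>2
     - (cmod (q1 - q2))\<^sup>2 - t * (cmod (q1 - q3))\<^sup>2 - t * (cmod (q2 - q3))\<^sup>2 =
     (cmod (of_real t * q3 + q1 + q2 - of_real (t + 2) * q0))\<^sup>2"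
proof -
  have real: "t * (t + 2) * (a0 - a3)\<^sup>2 + (t + 2) * (a0 - a1)\<^sup>2 + (t + 2) * (a0 - a2)\<^sup>2
     - (a1 - a2)\<^sup>2 - t * (a1 - a3)\<^sup>2 - t * (a2 - a3)\<^sup>2 = (t * a3 + a1 + a2 - (t + 2) * a0)\<^sup>2" for a0 a1 a2 a3 :: real
    by algebra
  show ?thesis
    unfolding cmod_power2
    using real[of "Re q0" "Re q3" "Re q1" "Re q2"] real[of "Im q0" "Im q3" "Im q1" "Im q2"]
    by (simp add: distrib_left)
qed

lemma iev_of_real: "iev a (of_real t) = of_real (iev a t)"
  by (induction a) (simp_all add: map_poly_pCons)

text \<open>The modulus of \<open>z\<close> is a square root of \<open>z * cnj z\<close>.\<close>

lemma radical_computable_cmod_diff: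
  assumes "x \<in> radical_computable" "y \<in> radical_computable"
  shows "of_real (cmod (x - y)) \<in> radical_computable"
proof (rule radical_computable.root)
  show "(x - y) * cnj (x - y) \<in> radical_computable"
    using assms by (intro radical_computable.mult radical_computable.diff radical_computable.conj)
  show "complex_of_real (cmod (x - y)) ^ 2 = (x - y) * cnj (x - y)"
    using complex_norm_square[of "x - y"] by simp
qed simp

lemma congruent_drawing_cmod:
  assumes "congruent_drawing n p q" "i < n" "j < n"
  shows "cmod (q i - q j) = cmod (p i - p j)"
proof -
  from assms(1) obtain a b where a: "cmod a = 1" and
    "(\<forall>i<n. q i = a * p i + b) \<or> (\<forall>i<n. q i = a * cnj (p i) + b)"
    unfolding congruent_drawing_def by blast
  then have "q i - q j = a * (p i - p j) \<or> q i - q j = a * cnj (p i - p j)"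
    using assms(2,3) by (auto simp: algebra_simps)
  then show ?thesis using a by (auto simp: norm_mult simp del: complex_cnj_diff)
qed

theorem theorem4:
  shows "\<exists>G. simple_graph 4 G \<and> graph_connected 4 G \<and>
           (\<exists>p. kk_equilibrium 4 G p \<and>
                (\<forall>q. congruent_drawing 4 p q \<longrightarrow> \<not> drawing_constructible 4 q))"
proof -
  obtain t w where t: "t \<in> {67/40..71/40}" and w: "w \<in> {13/10000..43/10000}"
    and eq1: "t\<^sup>2 / (stP t w)\<^sup>2 + 1 / (1 + w)\<^sup>2 - 4 / (stQ t w)\<^sup>2 = 0"
    and eq2: "(t + 2)\<^sup>2 / (stP t w)\<^sup>2 + 1 / (1 + w)\<^sup>2 - 16 / (stS t w)\<^sup>2 = 0"
    using stress_exists by blast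
  have t0: "t > 0" and w0: "w > 0" using t w by auto
  have pos: "stP t w > 0" "stQ t w > 0" "stS t w > 0" using stress_bounds[OF t w] by auto
  have rootF: "iev paw_poly (of_real t) = 0"
    unfolding iev_of_real stress_algebraic[OF t w eq1 eq2] by simp
  \<comment> \<open>The lengths belonging to the stresses: \<open>u\<close> for 03, \<open>s\<close>
    for 01 and 02, \<open>2 y\<close> for 12, \<open>r\<close> for 13 and 23. Vertices 1 and 2 lie
    at height \<open>y\<close> and \<open>- y\<close> over the abscissa \<open>v\<close>; the choice
    \<open>v = t u / 2\<close> makes the rank-one form vanish at the drawing.\<close>
  define u s r y v where "u = 1 / stP t w" and "s = 1 / stQ t w" and "r = 2 / stS t w"
    and "y = 1 / (1 + w) / 2" and "v = t * u / 2"
  have upos: "u > 0" "s > 0" "r > 0" "2 * y > 0"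
    using pos w0 by (simp_all add: u_def s_def r_def y_def)
  have s2: "v\<^sup>2 + y\<^sup>2 = s\<^sup>2"
  proof -
    have "v\<^sup>2 = t\<^sup>2 / (stP t w)\<^sup>2 / 4" "y\<^sup>2 = 1 / (1 + w)\<^sup>2 / 4" "4 / (stQ t w)\<^sup>2 / 4 = s\<^sup>2"
      unfolding v_def u_def y_def s_def by (simp_all only: power_divide power_mult_distrib) simp_all
    moreover have "t\<^sup>2 / (stP t w)\<^sup>2 + 1 / (1 + w)\<^sup>2 = 4 / (stQ t w)\<^sup>2" using eq1 by simp
    ultimately show ?thesis by (metis add_divide_distrib)
  qed
  have r2: "(u + v)\<^sup>2 + y\<^sup>2 = r\<^sup>2"
  proof -
    have uv: "u + v = (t + 2) * u / 2" by (simp add: v_def field_simps)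
    have "(u + v)\<^sup>2 = (t + 2)\<^sup>2 / (stP t w)\<^sup>2 / 4" "y\<^sup>2 = 1 / (1 + w)\<^sup>2 / 4" "16 / (stS t w)\<^sup>2 / 4 = r\<^sup>2"
      unfolding uv unfolding u_def y_def r_def by (simp_all only: power_divide power_mult_distrib) simp_all
    moreover have "(t + 2)\<^sup>2 / (stP t w)\<^sup>2 + 1 / (1 + w)\<^sup>2 = 16 / (stS t w)\<^sup>2" using eq2 by simp
    ultimately show ?thesis by (metis add_divide_distrib)
  qed
  \<comment> \<open>Each left side is \<open>1 - d / length\<close>. The factor 4 offsets the spring
    constant \<open>1 / 4\<close> of pairs at distance 2.\<close>
  have stress: "1 - 1 / u = w * (t * (t + 2))" "1 - 1 / s = w * (t + 2)" "1 - 1 / (2 * y) = - w" "1 - 2 / r = - (4 * (w * t))"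
    using pos w0 by (simp_all add: u_def s_def r_def y_def stP_def stQ_def stS_def add_divide_distrib)
  define p :: "nat \<Rightarrow> complex" where
    "p i = (if i = 1 then Complex v y else if i = 2 then Complex v (- y) else if i = 3 then Complex (- u) 0 else 0)" for i
  have dist: "cmod (p 0 - p 1) = s" "cmod (p 0 - p 2) = s" "cmod (p 0 - p 3) = u" "cmod (p 1 - p 2) = 2 * y"
    "cmod (p 1 - p 3) = r" "cmod (p 2 - p 3) = r"
    using s2 r2 upos by (simp_all add: p_def cmod_def add.commute real_sqrt_mult)
  \<comment> \<open>\<open>E0\<close> collects the constant parts of \<open>spring_energy_ge\<close>
    with their weights in the energy; the quadratic parts add up to \<open>W\<close>, which is
    nonnegative as \<open>w > 0\<close>.\<close>
  define E0 where "E0 = (1 - u) / 2 + (1 - s) + (1 - 2 * y) / 2 + (4 - 2 * r) / 4"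
  define W where "W q = w / 2 * (cmod (of_real t * q 3 + q 1 + q 2 - of_real (t + 2) * q 0))\<^sup>2" for q :: "nat \<Rightarrow> complex"
  have W: "W q = (w * (t * (t + 2)) * (cmod (q 0 - q 3))\<^sup>2 + w * (t + 2) * (cmod (q 0 - q 1))\<^sup>2
      + w * (t + 2) * (cmod (q 0 - q 2))\<^sup>2 - w * (cmod (q 1 - q 2))\<^sup>2) / 2
      - (4 * (w * t) * (cmod (q 1 - q 3))\<^sup>2 + 4 * (w * t) * (cmod (q 2 - q 3))\<^sup>2) / 8" for q
    unfolding W_def rank_one_stress[symmetric] by (simp add: field_simps)
  have lower: "E0 + W q \<le> kk_energy 4 paw q" for q
    unfolding kk_energy_paw E0_def W
    using spring_energy_ge[of s 1 "cmod (q 0 - q 1)"] spring_energy_ge[of s 1 "cmod (q 0 - q 2)"]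
      spring_energy_ge[of u 1 "cmod (q 0 - q 3)"] spring_energy_ge[of "2 * y" 1 "cmod (q 1 - q 2)"]
      spring_energy_ge[of r 2 "cmod (q 1 - q 3)"] spring_energy_ge[of r 2 "cmod (q 2 - q 3)"] upos
    unfolding stress by (simp add: field_simps)
  have "kk_energy 4 paw p = E0 + W p"
    unfolding kk_energy_paw E0_def W dist
    using spring_energy_eq[of s 1] spring_energy_eq[of u 1] spring_energy_eq[of "2 * y" 1]
      spring_energy_eq[of r 2] upos
    unfolding stress by (simp add: field_simps)
  also have "W p = 0"
    by (simp add: W_def p_def v_def complex_eq_iff Complex_eq algebra_simps)
  finally have energy: "kk_energy 4 paw p = E0" by simp
  have "kk_energy 4 paw p \<le> kk_energy 4 paw q" for q
    using lower[of q] w0 unfolding energy W_def by (smt (verit) mult_nonneg_nonneg zero_le_power2 divide_nonneg_nonneg)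
  then have "kk_equilibrium 4 paw p"
    unfolding kk_equilibrium_def by (intro exI[of _ 1]) auto
  moreover have "\<not> drawing_constructible 4 q" if cong: "congruent_drawing 4 p q" for q
  proof
    assume "drawing_constructible 4 q"
    then have rad: "of_real (cmod (p i - p j)) \<in> radical_computable" if "i < 4" "j < 4" for i j
      using that radical_computable_cmod_diff[of "q i" "q j"] congruent_drawing_cmod[OF cong that]
      unfolding drawing_constructible_def by metis
    have u: "of_real u \<in> radical_computable" and s: "of_real s \<in> radical_computable"
      and y2: "of_real (2 * y) \<in> radical_computable"
      using rad[of 0 3] rad[of 0 1] rad[of 1 2] by (simp_all only: dist)
    have 2: "2 \<in> radical_computable" using radical_computable.const[of 2] by simp
    have y: "of_real y \<in> radical_computable"
      using radical_computable.divide[OF y2 2] by simp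
    \<comment> \<open>\<open>v\<close> is the height of the triangle 012 over its base 12, and
      \<open>t = 2 v / u\<close>.\<close>
    have "of_real v \<in> radical_computable"
    proof (rule radical_computable.root)
      show "of_real s * of_real s - of_real y * of_real y \<in> radical_computable"
        using s y by (intro radical_computable.mult radical_computable.diff)
      show "complex_of_real v ^ 2 = of_real s * of_real s - of_real y * of_real y"
        using s2 by (simp add: power2_eq_square flip: of_real_mult of_real_diff)
    qed simp
    then have "2 * of_real v / of_real u \<in> radical_computable"
      using 2 u upos by (intro radical_computable.mult radical_computable.divide) auto
    moreover have "2 * of_real v / of_real u = complex_of_real t"
      using upos by (simp add: v_def)
    ultimately show False using paw_poly_root_not_radical[OF rootF] by simp
  qed
  ultimately show ?thesis using simple_graph_paw graph_connected_paw by blast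
qed

end
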